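(* Suppose that Assumptions (A1), (A2) and (A3) (stated in the context) hold and $\phi:\mathbb R\to\mathbb R$ is bounded and Lipschitz. Let $T>0$, $\Delta\in(0,1)$, let $u$ be the viscosity solution of the fully nonlinear PIDE in the context with initial datum $\phi$, and let $u_\Delta$ be the discrete scheme defined in the context. Then for any $(t,x)\in[0,T]\times\mathbb R$, $$|u(t,x)-u_\Delta(t,x)|\le C_0\Delta^{\Gamma(\alpha,q)},\qquad \Gamma(\alpha,q)=\min\Big\{\tfrac14,\tfrac{2-\alpha}{2\alpha},\tfrac q2\Big\},$$ where $q>0$ is the constant in (A3) and the Berry-Esseen constant is $C_0=L_0\vee U_0$ with $L_0,U_0$ given in the context.
   Context: **Lévy measures.** Fix $\alpha\in(1,2)$ and a nonempty measurable set $K_\pm\subset(\lambda_1,\lambda_2)$ with $\lambda_1,\lambda_2\ge0$. The symbol $k_\pm\in K_\pm$ denotes a pair $(k_-,k_+)$ with $k_-,k_+\in K_\pm$; a subscript $k_\pm$ indicates dependence on the pair. Let $$F_{k_\pm}(dz)=\frac{k_-}{|z|^{\alpha+1}}\mathbf 1_{(-\infty,0)}(z)dz+\frac{k_+}{|z|^{\alpha+1}}\mathbf 1_{(0,\infty)}(z)dz,\qquad \Theta=\{(0,0,F_{k_\pm}):k_\pm\in K_\pm\}.$$ **Nonlinear Lévy process and PIDE.** $X=(X_t)_{t\ge0}$, $X_0=0$, is the canonical process on the Skorokhod space of real càdlàg paths, and $\hat{\mathbb E}[\cdot]=\sup_{P\in\mathfrak B_\Theta}E^P[\cdot]$, where $\mathfrak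 B_\Theta$ is the set of all probability measures $P$ under which $X$ is a semimartingale with absolutely continuous characteristics (relative to the truncation function $h(z)=z$) whose differential characteristics take values in $\Theta$ ($dt\otimes P$-a.e.). It is known that $u(t,x)=\hat{\mathbb E}[\phi(x+X_t)]$ is the unique viscosity solution of $$\partial_tu(t,x)-\sup_{k_\pm\in K_\pm}\Big\{\int_{\mathbb R}\delta_zu(t,x)F_{k_\pm}(dz)\Big\}=0\ \text{ on }(0,T]\times\mathbb R,\qquad u(0,x)=\phi(x),$$ with $\delta_zu(t,x)=u(t,x+z)-u(t,x)-D_xu(t,x)z$. **The random variable $\xi$ and $\tilde{\mathbb E}$.** For each $k_\pm$ let $W_{k_\pm}$ be a classical mean-zero random variable with cdf $$F_{W_{k_\pm}}(z)=\begin{cases}[k_-/\alpha+\beta_{1,k_\pm}(z)]\,|z|^{-\alpha},&z<0,\\ 1-[k_+/\alpha+\beta_{2,k_\pm}(z)]\,z^{-\alpha},&z>0,\end{cases}$$ with functions $\beta_{1,k_\pm}:(-\infty,0]\to\mathbb R$, $\beta_{2,k_\pm}:[0,\infty)\to\mathbb R$ such that $\lim_{z\to-\infty}\beta_{1,k_\pm}(z)=\lim_{z\to\infty}\beta_{2,k_\pm}(z)=0$. Define $\tilde{\mathbb E}[\varphi]=\sup_{k_\pm\in K_\pm}\int_{\mathbb R}\varphi(z)\,dF_{W_{k_\pm}}(z)$ for Lipschitz $\varphi:\mathbb R\to\mathbb R$, and $\xi(z)=z$, so $\tilde{\mathbb E}[\varphi(\xi)]=\tilde{\mathbb E}[\varphi]$.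 **Discrete scheme.** $u_\Delta:[0,T]\times\mathbb R\to\mathbb R$ is defined recursively by $u_\Delta(t,x)=\phi(x)$ if $t\in[0,\Delta)$, and $u_\Delta(t,x)=\tilde{\mathbb E}[u_\Delta(t-\Delta,x+\Delta^{1/\alpha}\xi)]$ if $t\in[\Delta,T]$. **Assumptions.** (A1) For each $k_\pm$, $\beta_{1,k_\pm},\beta_{2,k_\pm}$ are continuously differentiable and $\int_{\mathbb R}z\,dF_{W_{k_\pm}}(z)=0$. (A2) There is $M>0$ such that for all $k_\pm$: $\big|\int_{-\infty}^{-1}\beta_{1,k_\pm}(z)|z|^{-\alpha}dz\big|<M$ and $\big|\int_1^\infty\beta_{2,k_\pm}(z)z^{-\alpha}dz\big|<M$. (A3) There are $q>0$, $C>0$ such that for all $k_\pm$ and all $\Delta\in(0,1)$ the following are less than $C\Delta^q$: $|\beta_{1,k_\pm}(-\Delta^{-1/\alpha})|$, $\int_{-\infty}^{-1}|\beta_{1,k_\pm}(\Delta^{-1/\alpha}z)||z|^{-\alpha}dz$, $\int_{-1}^0|\beta_{1,k_\pm}(\Delta^{-1/\alpha}z)||z|^{1-\alpha}dz$, $|\beta_{2,k_\pm}(\Delta^{-1/\alpha})|$, $\int_1^\infty|\beta_{2,k_\pm}(\Delta^{-1/\alpha}z)|z^{-\alpha}dz$, $\int_0^1|\beta_{2,k_\pm}(\Delta^{-1/\alpha}z)|z^{1-\alpha}dz$. The constant $M$ is chosen so that it also bounds, for all $k_\pm$, the quantities $|\beta_{1,k_\pm}(-1)|$, $|\beta_{2,k_\pm}(1)|$,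 $\int_{-1}^0|-\beta_{1,k_\pm}'(z)z+\alpha\beta_{1,k_\pm}(z)||z|^{1-\alpha}dz$, $\int_0^1|-\beta_{2,k_\pm}'(z)z+\alpha\beta_{2,k_\pm}(z)|z^{1-\alpha}dz$ (these are uniformly bounded under (A1)). **Constants.** $C_\phi$ is the Lipschitz constant of $\phi$; $M_X^1=\hat{\mathbb E}[|X_1|]$; $M_\xi^1=\tilde{\mathbb E}[|\xi|]$; $C_{\phi,\mathcal K}$ is a constant depending only on $C_\phi$ and $\mathcal K=\sup_{k_\pm}\int_{\mathbb R}(|z|\wedge|z|^2)F_{k_\pm}(dz)<\infty$ such that $|u(t,x)-u(s,y)|\le C_{\phi,\mathcal K}(|x-y|+|t-s|^{1/\alpha})$ for all $s,t\in[0,T]$, $x,y\in\mathbb R$. Fix a nonnegative $\zeta\in C^\infty(\mathbb R^2)$ with unit integral and support in $\{(t,x):-1<t<0,|x|<1\}$, and let $$M_\zeta:=\max_{k+l\ge1}\int_{-1<t<0}\int_{|x|<1}|\partial_t^lD_x^k\zeta(t,x)|\,dx\,dt<\infty.$$ Let $I_\Delta=\sqrt{I_{1,\Delta}}+2I_{2,\Delta}$ with $$I_{1,\Delta}=\sup_{k_\pm}\Big\{\tfrac{k_-+k_+}{2-\alpha}+2\int_0^1\tfrac{|\beta_{1,k_\pm}(-\Delta^{-1/\alpha}z)|+|\beta_{2,k_\pm}(\Delta^{-1/\alpha}z)|}{z^{\alpha-1}}dz+|\beta_{1,k_\pm}(-\Delta^{-1/\alpha})|+|\beta_{2,k_\pm}(\Delta^{-1/\alpha})|\Big\},$$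 $$I_{2,\Delta}=\sup_{k_\pm}\Big\{\tfrac{k_-+k_+}{\alpha-1}+\int_1^\infty\tfrac{|\beta_{1,k_\pm}(-\Delta^{-1/\alpha}z)|+|\beta_{2,k_\pm}(\Delta^{-1/\alpha}z)|}{z^{\alpha}}dz+|\beta_{1,k_\pm}(-\Delta^{-1/\alpha})|+|\beta_{2,k_\pm}(\Delta^{-1/\alpha})|\Big\}.$$ Then $$L_0=C_\phi(M_X^1+M_\xi^1)+4C_{\phi,\mathcal K}+2TC_{\phi,\mathcal K}M_\zeta[2(1+M_\xi^1)+4M+26C],$$ $$U_0=C_\phi\big[M_X^1+M_\xi^1+4(1+I_\Delta)+2TM_\zeta(1+I_\Delta)(2(1+M_\xi^1)+4M+26C)\big].$$
   Formalization: M_ζ is taken as the maximum over 1 ≤ k+l ≤ 2 instead of all k+l ≥ 1: over all orders it is infinite for every smooth compactly supported ζ with unit integral. Any larger range of orders gives a larger constant, so the stated bound is the stronger one. *)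

theory Defs
  imports "HOL-Probability.Probability"
begin

section \<open>Processes, martingales and semimartingales\<close>

text \<open>
  A process is a function \<open>X :: real \<Rightarrow> 'a \<Rightarrow> real\<close> of which only the times \<open>t \<ge> 0\<close> matter.  A filtration
  is a family \<open>G :: real \<Rightarrow> 'a measure\<close> of which only the underlying \<open>\<sigma>\<close>-algebras matter.
\<close>

definition cadlag_path :: "(real \<Rightarrow> real) \<Rightarrow> bool" where
  "cadlag_path f \<longleftrightarrow>
     (\<forall>t\<ge>0. (f \<longlongrightarrow> f t) (at_right t)) \<and> (\<forall>t>0. \<exists>l. (f \<longlongrightarrow> l) (at_left t))"

definition finite_variation_path :: "(real \<Rightarrow> real) \<Rightarrow> bool" where
  "finite_variation_path f \<longleftrightarrow>
     (\<forall>t\<ge>0. \<exists>V. \<forall>(p :: nat \<Rightarrow> real) n. mono p \<longrightarrow> range p \<subseteq> {0..t} \<longrightarrow>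
        (\<Sum>i<n. \<bar>f (p (Suc i)) - f (p i)\<bar>) \<le> V)"

definition adapted :: "(real \<Rightarrow> 'a measure) \<Rightarrow> (real \<Rightarrow> 'a \<Rightarrow> real) \<Rightarrow> bool" where
  "adapted G Y \<longleftrightarrow> (\<forall>t\<ge>0. Y t \<in> borel_measurable (G t))"

definition predictable_sigma :: "'a set \<Rightarrow> (real \<Rightarrow> 'a measure) \<Rightarrow> (real \<times> 'a) measure" where
  "predictable_sigma \<Omega> G = sigma ({0..} \<times> \<Omega>)
     ({{0} \<times> A | A. A \<in> sets (G 0)} \<union> {{s<..t} \<times> A | s t A. 0 \<le> s \<and> s < t \<and> A \<in> sets (G s)})"

definition predictable :: "'a measure \<Rightarrow> (real \<Rightarrow> 'a measure) \<Rightarrow> (real \<Rightarrow> 'a \<Rightarrow> real) \<Rightarrow> bool" where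
  "predictable Q G Y \<longleftrightarrow> (\<lambda>(t, \<omega>). Y t \<omega>) \<in> borel_measurable (predictable_sigma (space Q) G)"

definition martingale :: "'a measure \<Rightarrow> (real \<Rightarrow> 'a measure) \<Rightarrow> (real \<Rightarrow> 'a \<Rightarrow> real) \<Rightarrow> bool" where
  "martingale Q G Y \<longleftrightarrow>
     adapted G Y \<and> (\<forall>t\<ge>0. integrable Q (Y t)) \<and>
     (\<forall>s t. 0 \<le> s \<and> s \<le> t \<longrightarrow> (AE \<omega> in Q. real_cond_exp Q (G s) (Y t) \<omega> = Y s \<omega>))"

text \<open>
  Real-valued localizing times suffice, because \<open>\<tau>\<^sub>n\<close> may be replaced by \<open>\<tau>\<^sub>n \<and> n\<close>.
\<close>

definition local_martingale :: "'a measure \<Rightarrow> (real \<Rightarrow> 'a measure) \<Rightarrow> (real \<Rightarrow> 'a \<Rightarrow> real) \<Rightarrow> bool" where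
  "local_martingale Q G Y \<longleftrightarrow>
     adapted G Y \<and> (\<forall>\<omega>\<in>space Q. cadlag_path (\<lambda>t. Y t \<omega>)) \<and>
     (\<exists>\<tau> :: nat \<Rightarrow> 'a \<Rightarrow> real.
        (\<forall>n. stopping_time G (\<tau> n) \<and> (\<forall>\<omega>\<in>space Q. 0 \<le> \<tau> n \<omega>)) \<and>
        (AE \<omega> in Q. incseq (\<lambda>n. \<tau> n \<omega>) \<and> filterlim (\<lambda>n. \<tau> n \<omega>) at_top sequentially) \<and>
        (\<forall>n. martingale Q G (\<lambda>t \<omega>. Y (min t (\<tau> n \<omega>)) \<omega>)))"

definition null_at_0 :: "'a measure \<Rightarrow> (real \<Rightarrow> 'a \<Rightarrow> real) \<Rightarrow> bool" where
  "null_at_0 Q Y \<longleftrightarrow> (\<forall>\<omega>\<in>space Q. Y 0 \<omega> = 0)"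

definition continuous_local_martingale ::
    "'a measure \<Rightarrow> (real \<Rightarrow> 'a measure) \<Rightarrow> (real \<Rightarrow> 'a \<Rightarrow> real) \<Rightarrow> bool" where
  "continuous_local_martingale Q G N \<longleftrightarrow>
     local_martingale Q G N \<and> null_at_0 Q N \<and> (\<forall>\<omega>\<in>space Q. continuous_on {0..} (\<lambda>t. N t \<omega>))"

definition purely_discontinuous_local_martingale ::
    "'a measure \<Rightarrow> (real \<Rightarrow> 'a measure) \<Rightarrow> (real \<Rightarrow> 'a \<Rightarrow> real) \<Rightarrow> bool" where
  "purely_discontinuous_local_martingale Q G Y \<longleftrightarrow>
     local_martingale Q G Y \<and> null_at_0 Q Y \<and>
     (\<forall>N. continuous_local_martingale Q G N \<longrightarrow> local_martingale Q G (\<lambda>t \<omega>. Y t \<omega> * N t \<omega>))"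

definition finite_variation_process ::
    "'a measure \<Rightarrow> (real \<Rightarrow> 'a measure) \<Rightarrow> (real \<Rightarrow> 'a \<Rightarrow> real) \<Rightarrow> bool" where
  "finite_variation_process Q G A \<longleftrightarrow>
     adapted G A \<and> null_at_0 Q A \<and>
     (\<forall>\<omega>\<in>space Q. cadlag_path (\<lambda>t. A t \<omega>) \<and> finite_variation_path (\<lambda>t. A t \<omega>))"

definition semimartingale :: "'a measure \<Rightarrow> (real \<Rightarrow> 'a measure) \<Rightarrow> (real \<Rightarrow> 'a \<Rightarrow> real) \<Rightarrow> bool" where
  "semimartingale Q G X \<longleftrightarrow>
     adapted G X \<and> (\<forall>\<omega>\<in>space Q. cadlag_path (\<lambda>t. X t \<omega>)) \<and>
     (\<exists>M A. local_martingale Q G M \<and> null_at_0 Q M \<and> finite_variation_process Q G A \<and>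
        (\<forall>\<omega>\<in>space Q. \<forall>t\<ge>0. X t \<omega> = X 0 \<omega> + M t \<omega> + A t \<omega>))"


section \<open>Semimartingale characteristics\<close>

definition jump :: "(real \<Rightarrow> 'a \<Rightarrow> real) \<Rightarrow> real \<Rightarrow> 'a \<Rightarrow> real" where
  "jump X t \<omega> = X t \<omega> - Lim (at_left t) (\<lambda>s. X s \<omega>)"

definition jump_measure :: "(real \<Rightarrow> 'a \<Rightarrow> real) \<Rightarrow> 'a \<Rightarrow> (real \<times> real) measure" where
  "jump_measure X \<omega> =
     distr (count_space {s. 0 < s \<and> jump X s \<omega> \<noteq> 0}) borel (\<lambda>s. (s, jump X s \<omega>))"

definition predictable_random_measure ::
    "'a measure \<Rightarrow> (real \<Rightarrow> 'a measure) \<Rightarrow> ('a \<Rightarrow> (real \<times> real) measure) \<Rightarrow> bool" where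
  "predictable_random_measure Q G \<nu> \<longleftrightarrow>
     (\<forall>\<omega>\<in>space Q. sets (\<nu> \<omega>) = sets borel) \<and>
     (\<forall>W \<in> borel_measurable (predictable_sigma (space Q) G \<Otimes>\<^sub>M borel).
        (\<lambda>(t, \<omega>). \<integral>\<^sup>+ p. W ((fst p, \<omega>), snd p) * indicator ({0<..t} \<times> UNIV) p \<partial>\<nu> \<omega>)
          \<in> (predictable_sigma (space Q) G \<rightarrow>\<^sub>M (borel :: ennreal measure)))"

definition compensator ::
    "'a measure \<Rightarrow> (real \<Rightarrow> 'a measure) \<Rightarrow> ('a \<Rightarrow> (real \<times> real) measure) \<Rightarrow>
     ('a \<Rightarrow> (real \<times> real) measure) \<Rightarrow> bool" where
  "compensator Q G \<mu> \<nu> \<longleftrightarrow>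
     predictable_random_measure Q G \<nu> \<and>
     (\<forall>W :: (real \<times> 'a) \<times> real \<Rightarrow> ennreal.
        W \<in> borel_measurable (predictable_sigma (space Q) G \<Otimes>\<^sub>M borel) \<longrightarrow>
        (\<integral>\<^sup>+ \<omega>. (\<integral>\<^sup>+ p. W ((fst p, \<omega>), snd p) * indicator ({0<..} \<times> UNIV) p \<partial>\<mu> \<omega>) \<partial>Q) =
        (\<integral>\<^sup>+ \<omega>. (\<integral>\<^sup>+ p. W ((fst p, \<omega>), snd p) * indicator ({0<..} \<times> UNIV) p \<partial>\<nu> \<omega>) \<partial>Q))"

text \<open>
  Characteristics \<open>(B, C, \<nu>)\<close> of a semimartingale relative to the truncation function \<open>h(z) = z\<close>.
  For this \<open>h\<close> the process \<open>X(h) = X - \<Sum>\<^sub>s (\<Delta>X\<^sub>s - h(\<Delta>X\<^sub>s))\<close> is \<open>X\<close> itself, so \<open>B\<close> is the predictable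
  finite variation part of \<open>X\<close>; \<open>N\<close> is the continuous martingale part \<open>X\<^sup>c\<close>, and \<open>C\<close> is its
  predictable quadratic variation.
\<close>

definition characteristics ::
    "'a measure \<Rightarrow> (real \<Rightarrow> 'a measure) \<Rightarrow> (real \<Rightarrow> 'a \<Rightarrow> real) \<Rightarrow>
     (real \<Rightarrow> 'a \<Rightarrow> real) \<Rightarrow> (real \<Rightarrow> 'a \<Rightarrow> real) \<Rightarrow> ('a \<Rightarrow> (real \<times> real) measure) \<Rightarrow> bool" where
  "characteristics Q G X B C \<nu> \<longleftrightarrow>
     predictable Q G B \<and> finite_variation_process Q G B \<and>
     local_martingale Q G (\<lambda>t \<omega>. X t \<omega> - X 0 \<omega> - B t \<omega>) \<and>
     (\<exists>N. continuous_local_martingale Q G N \<and>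
        purely_discontinuous_local_martingale Q G (\<lambda>t \<omega>. X t \<omega> - X 0 \<omega> - B t \<omega> - N t \<omega>) \<and>
        predictable Q G C \<and> finite_variation_process Q G C \<and>
        (\<forall>\<omega>\<in>space Q. continuous_on {0..} (\<lambda>t. C t \<omega>) \<and> mono_on {0..} (\<lambda>t. C t \<omega>)) \<and>
        local_martingale Q G (\<lambda>t \<omega>. (N t \<omega>)\<^sup>2 - C t \<omega>)) \<and>
     compensator Q G (jump_measure X) \<nu>"

definition differential_characteristics ::
    "'a measure \<Rightarrow> (real \<Rightarrow> 'a measure) \<Rightarrow> (real \<Rightarrow> 'a \<Rightarrow> real) \<Rightarrow>
     (real \<Rightarrow> 'a \<Rightarrow> real) \<Rightarrow> (real \<Rightarrow> 'a \<Rightarrow> real) \<Rightarrow> (real \<Rightarrow> 'a \<Rightarrow> real measure) \<Rightarrow> bool" where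
  "differential_characteristics Q G X b c F \<longleftrightarrow>
     predictable Q G b \<and> predictable Q G c \<and>
     (\<forall>t \<omega>. sets (F t \<omega>) = sets borel) \<and>
     (\<forall>A\<in>sets borel. (\<lambda>(t, \<omega>). emeasure (F t \<omega>) A)
        \<in> borel_measurable (predictable_sigma (space Q) G)) \<and>
     (\<exists>B C \<nu>. characteristics Q G X B C \<nu> \<and>
        (AE \<omega> in Q.
           (\<forall>t\<ge>0. set_integrable lborel {0..t} (\<lambda>s. b s \<omega>) \<and> B t \<omega> = (LBINT s:{0..t}. b s \<omega>)) \<and>
           (\<forall>t\<ge>0. set_integrable lborel {0..t} (\<lambda>s. c s \<omega>) \<and> C t \<omega> = (LBINT s:{0..t}. c s \<omega>)) \<and>
           (\<forall>A\<in>sets borel. emeasure (\<nu> \<omega>) A =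
              (\<integral>\<^sup>+ t\<in>{0..}. emeasure (F t \<omega>) {z. (t, z) \<in> A} \<partial>lborel))))"


section \<open>The canonical space and the sublinear expectation\<close>

definition skorokhod_space :: "(real \<Rightarrow> real) set" where
  "skorokhod_space = {\<omega>. \<omega> \<in> extensional {0..} \<and> \<omega> 0 = 0 \<and> cadlag_path \<omega>}"

definition coordinate_sigma :: "real set \<Rightarrow> (real \<Rightarrow> real) measure" where
  "coordinate_sigma I =
     sigma skorokhod_space {(\<lambda>\<omega>. \<omega> s) -` A \<inter> skorokhod_space | s A. s \<in> I \<and> A \<in> sets borel}"

text \<open>
  The usual augmentation under \<open>P\<close> of the filtration generated by the canonical process.
\<close>

definition canonical_filtration :: "(real \<Rightarrow> real) measure \<Rightarrow> real \<Rightarrow> (real \<Rightarrow> real) measure" where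
  "canonical_filtration P t =
     sigma skorokhod_space
       ((\<Inter>r\<in>{t<..}. sets (coordinate_sigma {0..r})) \<union> null_sets (completion P))"

definition nonlinear_levy_laws :: "(real \<times> real \<times> real measure) set \<Rightarrow> (real \<Rightarrow> real) measure set" where
  "nonlinear_levy_laws \<Theta> = {P. prob_space P \<and> sets P = sets (coordinate_sigma {0..}) \<and>
     (let Q = completion P; G = canonical_filtration P; X = (\<lambda>t \<omega>. \<omega> t) in
       semimartingale Q G X \<and>
       (\<exists>b c F. differential_characteristics Q G X b c F \<and>
          (AE p in restrict_space lborel {0..} \<Otimes>\<^sub>M Q.
             (b (fst p) (snd p), c (fst p) (snd p), F (fst p) (snd p)) \<in> \<Theta>)))}"

definition stable_levy_measure :: "real \<Rightarrow> real \<times> real \<Rightarrow> real measure" where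
  "stable_levy_measure \<alpha> k = density lborel (\<lambda>z. ennreal
     (if z < 0 then fst k / \<bar>z\<bar> powr (\<alpha> + 1) else if 0 < z then snd k / \<bar>z\<bar> powr (\<alpha> + 1) else 0))"

definition stable_triplets :: "real \<Rightarrow> real set \<Rightarrow> (real \<times> real \<times> real measure) set" where
  "stable_triplets \<alpha> K = {(0, 0, stable_levy_measure \<alpha> k) | k. k \<in> K \<times> K}"

definition Ehat :: "real \<Rightarrow> real set \<Rightarrow> ((real \<Rightarrow> real) \<Rightarrow> real) \<Rightarrow> ereal" where
  "Ehat \<alpha> K f = (SUP P\<in>nonlinear_levy_laws (stable_triplets \<alpha> K).
     enn2ereal (\<integral>\<^sup>+ \<omega>. ennreal (f \<omega>) \<partial>P) - enn2ereal (\<integral>\<^sup>+ \<omega>. ennreal (- f \<omega>) \<partial>P))"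


section \<open>Viscosity solutions of the integro-differential equation\<close>

text \<open>Test functions: \<open>C\<^sub>b\<^sup>2\<^sup>,\<^sup>3((0,\<infinity>) \<times> \<real>)\<close>.\<close>

definition test_function :: "(real \<Rightarrow> real \<Rightarrow> real) \<Rightarrow> bool" where
  "test_function \<psi> \<longleftrightarrow>
     (\<exists>\<psi>t \<psi>tt \<psi>x \<psi>xx \<psi>xxx.
        (\<forall>g\<in>{\<psi>, \<psi>t, \<psi>tt, \<psi>x, \<psi>xx, \<psi>xxx}.
           continuous_on ({0<..} \<times> UNIV) (\<lambda>(t, x). g t x) \<and>
           bounded ((\<lambda>(t, x). g t x) ` ({0<..} \<times> UNIV))) \<and>
        (\<forall>t>0. \<forall>x.
           ((\<lambda>s. \<psi> s x) has_real_derivative \<psi>t t x) (at t) \<and>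
           ((\<lambda>s. \<psi>t s x) has_real_derivative \<psi>tt t x) (at t) \<and>
           (\<psi> t has_real_derivative \<psi>x t x) (at x) \<and>
           (\<psi>x t has_real_derivative \<psi>xx t x) (at x) \<and>
           (\<psi>xx t has_real_derivative \<psi>xxx t x) (at x)))"

definition delta :: "real \<Rightarrow> (real \<Rightarrow> real \<Rightarrow> real) \<Rightarrow> real \<Rightarrow> real \<Rightarrow> real" where
  "delta z v t x = v t (x + z) - v t x - deriv (v t) x * z"

definition pide_operator ::
    "real \<Rightarrow> real set \<Rightarrow> (real \<Rightarrow> real \<Rightarrow> real) \<Rightarrow> real \<Rightarrow> real \<Rightarrow> real" where
  "pide_operator \<alpha> K v t x =
     deriv (\<lambda>s. v s x) t - (SUP k\<in>K \<times> K. \<integral>z. delta z v t x \<partial>stable_levy_measure \<alpha> k)"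

definition viscosity_subsolution ::
    "real \<Rightarrow> real set \<Rightarrow> real \<Rightarrow> (real \<Rightarrow> real) \<Rightarrow> (real \<Rightarrow> real \<Rightarrow> real) \<Rightarrow> bool" where
  "viscosity_subsolution \<alpha> K T \<phi> u \<longleftrightarrow>
     bounded ((\<lambda>(t, x). u t x) ` ({0..T} \<times> UNIV)) \<and>
     (\<forall>a. openin (top_of_set ({0..T} \<times> UNIV)) {(t, x). t \<in> {0..T} \<and> u t x < a}) \<and>
     (\<forall>x. u 0 x \<le> \<phi> x) \<and>
     (\<forall>\<psi> t x. test_function \<psi> \<and> t \<in> {0<..T} \<and>
        (\<forall>s\<in>{0<..T}. \<forall>y. u s y \<le> \<psi> s y) \<and> \<psi> t x = u t x \<longrightarrow> pide_operator \<alpha> K \<psi> t x \<le> 0)"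

definition viscosity_supersolution ::
    "real \<Rightarrow> real set \<Rightarrow> real \<Rightarrow> (real \<Rightarrow> real) \<Rightarrow> (real \<Rightarrow> real \<Rightarrow> real) \<Rightarrow> bool" where
  "viscosity_supersolution \<alpha> K T \<phi> u \<longleftrightarrow>
     bounded ((\<lambda>(t, x). u t x) ` ({0..T} \<times> UNIV)) \<and>
     (\<forall>a. openin (top_of_set ({0..T} \<times> UNIV)) {(t, x). t \<in> {0..T} \<and> a < u t x}) \<and>
     (\<forall>x. \<phi> x \<le> u 0 x) \<and>
     (\<forall>\<psi> t x. test_function \<psi> \<and> t \<in> {0<..T} \<and>
        (\<forall>s\<in>{0<..T}. \<forall>y. \<psi> s y \<le> u s y) \<and> \<psi> t x = u t x \<longrightarrow> 0 \<le> pide_operator \<alpha> K \<psi> t x)"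

definition viscosity_solution ::
    "real \<Rightarrow> real set \<Rightarrow> real \<Rightarrow> (real \<Rightarrow> real) \<Rightarrow> (real \<Rightarrow> real \<Rightarrow> real) \<Rightarrow> bool" where
  "viscosity_solution \<alpha> K T \<phi> u \<longleftrightarrow>
     viscosity_subsolution \<alpha> K T \<phi> u \<and> viscosity_supersolution \<alpha> K T \<phi> u"


section \<open>The random variable \<open>\<xi>\<close> and the discrete scheme\<close>

text \<open>
  \<open>W k\<close> is the law of the classical random variable with index \<open>k = (k\<^sub>-, k\<^sub>+)\<close>.
\<close>

definition xi_laws ::
    "real \<Rightarrow> real set \<Rightarrow> (real \<times> real \<Rightarrow> real measure) \<Rightarrow>
     (real \<times> real \<Rightarrow> real \<Rightarrow> real) \<Rightarrow> (real \<times> real \<Rightarrow> real \<Rightarrow> real) \<Rightarrow> bool" where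
  "xi_laws \<alpha> K W \<beta>1 \<beta>2 \<longleftrightarrow>
     (\<forall>k\<in>K \<times> K. real_distribution (W k) \<and>
        (\<forall>z<0. cdf (W k) z = (fst k / \<alpha> + \<beta>1 k z) * \<bar>z\<bar> powr (- \<alpha>)) \<and>
        (\<forall>z>0. cdf (W k) z = 1 - (snd k / \<alpha> + \<beta>2 k z) * z powr (- \<alpha>)) \<and>
        (\<beta>1 k \<longlongrightarrow> 0) at_bot \<and> (\<beta>2 k \<longlongrightarrow> 0) at_top)"

definition Etilde :: "real set \<Rightarrow> (real \<times> real \<Rightarrow> real measure) \<Rightarrow> (real \<Rightarrow> real) \<Rightarrow> real" where
  "Etilde K W f = (SUP k\<in>K \<times> K. \<integral>z. f z \<partial>W k)"

definition discrete_scheme ::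
    "real \<Rightarrow> real set \<Rightarrow> (real \<times> real \<Rightarrow> real measure) \<Rightarrow> real \<Rightarrow> real \<Rightarrow> (real \<Rightarrow> real) \<Rightarrow>
     (real \<Rightarrow> real \<Rightarrow> real) \<Rightarrow> bool" where
  "discrete_scheme \<alpha> K W T \<Delta> \<phi> v \<longleftrightarrow>
     (\<forall>t\<in>{0..T}. \<forall>x. v t x =
        (if t < \<Delta> then \<phi> x else Etilde K W (\<lambda>z. v (t - \<Delta>) (x + \<Delta> powr (1 / \<alpha>) * z))))"


section \<open>Assumptions\<close>

definition C1_on :: "real set \<Rightarrow> (real \<Rightarrow> real) \<Rightarrow> bool" where
  "C1_on S f \<longleftrightarrow>
     (\<exists>f'. (\<forall>x\<in>S. (f has_real_derivative f' x) (at x within S)) \<and> continuous_on S f')"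

definition assumption_A1 ::
    "real set \<Rightarrow> (real \<times> real \<Rightarrow> real measure) \<Rightarrow>
     (real \<times> real \<Rightarrow> real \<Rightarrow> real) \<Rightarrow> (real \<times> real \<Rightarrow> real \<Rightarrow> real) \<Rightarrow> bool" where
  "assumption_A1 K W \<beta>1 \<beta>2 \<longleftrightarrow>
     (\<forall>k\<in>K \<times> K. C1_on {..0} (\<beta>1 k) \<and> C1_on {0..} (\<beta>2 k) \<and>
        integrable (W k) (\<lambda>z. z) \<and> (\<integral>z. z \<partial>W k) = 0)"

definition assumption_A2 ::
    "real \<Rightarrow> real set \<Rightarrow> (real \<times> real \<Rightarrow> real \<Rightarrow> real) \<Rightarrow> (real \<times> real \<Rightarrow> real \<Rightarrow> real) \<Rightarrow> real \<Rightarrow> bool" where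
  "assumption_A2 \<alpha> K \<beta>1 \<beta>2 M \<longleftrightarrow>
     (\<forall>k\<in>K \<times> K.
        \<bar>LBINT z:{..-1}. \<beta>1 k z * \<bar>z\<bar> powr (- \<alpha>)\<bar> < M \<and>
        \<bar>LBINT z:{1..}. \<beta>2 k z * z powr (- \<alpha>)\<bar> < M)"

text \<open>
  Integrals of nonnegative functions are taken in \<open>ennreal\<close>, so that the bounds include their
  finiteness; in particular the integrands in the previous definition are integrable.
\<close>

definition assumption_A3 ::
    "real \<Rightarrow> real set \<Rightarrow> (real \<times> real \<Rightarrow> real \<Rightarrow> real) \<Rightarrow> (real \<times> real \<Rightarrow> real \<Rightarrow> real) \<Rightarrow>
     real \<Rightarrow> real \<Rightarrow> bool" where
  "assumption_A3 \<alpha> K \<beta>1 \<beta>2 q C \<longleftrightarrow>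
     (\<forall>k\<in>K \<times> K. \<forall>\<Delta>\<in>{0<..<1}. let r = \<Delta> powr (- 1 / \<alpha>); bound = C * \<Delta> powr q in
        \<bar>\<beta>1 k (- r)\<bar> < bound \<and>
        (\<integral>\<^sup>+ z\<in>{..-1}. ennreal (\<bar>\<beta>1 k (r * z)\<bar> * \<bar>z\<bar> powr (- \<alpha>)) \<partial>lborel) < ennreal bound \<and>
        (\<integral>\<^sup>+ z\<in>{-1..0}. ennreal (\<bar>\<beta>1 k (r * z)\<bar> * \<bar>z\<bar> powr (1 - \<alpha>)) \<partial>lborel) < ennreal bound \<and>
        \<bar>\<beta>2 k r\<bar> < bound \<and>
        (\<integral>\<^sup>+ z\<in>{1..}. ennreal (\<bar>\<beta>2 k (r * z)\<bar> * z powr (- \<alpha>)) \<partial>lborel) < ennreal bound \<and>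
        (\<integral>\<^sup>+ z\<in>{0..1}. ennreal (\<bar>\<beta>2 k (r * z)\<bar> * z powr (1 - \<alpha>)) \<partial>lborel) < ennreal bound)"

definition beta_bound ::
    "real \<Rightarrow> real set \<Rightarrow> (real \<times> real \<Rightarrow> real \<Rightarrow> real) \<Rightarrow> (real \<times> real \<Rightarrow> real \<Rightarrow> real) \<Rightarrow> real \<Rightarrow> bool" where
  "beta_bound \<alpha> K \<beta>1 \<beta>2 M \<longleftrightarrow>
     (\<forall>k\<in>K \<times> K.
        \<bar>\<beta>1 k (-1)\<bar> \<le> M \<and> \<bar>\<beta>2 k 1\<bar> \<le> M \<and>
        (\<integral>\<^sup>+ z\<in>{-1<..<0}. ennreal (\<bar>- deriv (\<beta>1 k) z * z + \<alpha> * \<beta>1 k z\<bar> * \<bar>z\<bar> powr (1 - \<alpha>)) \<partial>lborel)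
          \<le> ennreal M \<and>
        (\<integral>\<^sup>+ z\<in>{0<..<1}. ennreal (\<bar>- deriv (\<beta>2 k) z * z + \<alpha> * \<beta>2 k z\<bar> * z powr (1 - \<alpha>)) \<partial>lborel)
          \<le> ennreal M)"


section \<open>Constants\<close>

definition smooth_plane :: "(real \<Rightarrow> real \<Rightarrow> real) \<Rightarrow> bool" where
  "smooth_plane f \<longleftrightarrow>
     (\<exists>D :: nat \<Rightarrow> nat \<Rightarrow> real \<Rightarrow> real \<Rightarrow> real. D 0 0 = f \<and>
        (\<forall>l k. continuous_on UNIV (\<lambda>(t, x). D l k t x)) \<and>
        (\<forall>l k t x. ((\<lambda>s. D l k s x) has_real_derivative D (Suc l) k t x) (at t) \<and>
                   (D l k t has_real_derivative D l (Suc k) t x) (at x)))"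

definition mollifier :: "(real \<Rightarrow> real \<Rightarrow> real) \<Rightarrow> bool" where
  "mollifier \<zeta> \<longleftrightarrow>
     smooth_plane \<zeta> \<and> (\<forall>t x. 0 \<le> \<zeta> t x) \<and>
     closure {(t, x). \<zeta> t x \<noteq> 0} \<subseteq> {(t, x). -1 < t \<and> t < 0 \<and> \<bar>x\<bar> < 1} \<and>
     (LBINT p. \<zeta> (fst p) (snd p)) = 1"

definition partial_tx :: "nat \<Rightarrow> nat \<Rightarrow> (real \<Rightarrow> real \<Rightarrow> real) \<Rightarrow> real \<Rightarrow> real \<Rightarrow> real" where
  "partial_tx l k f = ((\<lambda>g t x. deriv (\<lambda>s. g s x) t) ^^ l) (((\<lambda>g t x. deriv (g t) x) ^^ k) f)"

text \<open>
  The maximum is over the derivatives of total order 1 and 2, the ones used in the error analysis.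
  Over all orders \<open>k + l \<ge> 1\<close> the supremum of these \<open>L\<^sup>1\<close>-norms is infinite for every
  nonzero smooth \<open>\<zeta>\<close> with compact support (uniformly bounded derivatives of all orders make
  \<open>\<zeta>\<close> real analytic), so it would not define a finite constant; the maximum over any larger finite
  set of orders is a larger constant.
\<close>

definition M_zeta :: "(real \<Rightarrow> real \<Rightarrow> real) \<Rightarrow> real" where
  "M_zeta \<zeta> = Max ((\<lambda>(l, k). LBINT t:{-1<..<0}. LBINT x:{-1<..<1}. \<bar>partial_tx l k \<zeta> t x\<bar>)
     ` {(l, k). 1 \<le> k + l \<and> k + l \<le> 2})"

definition I1_Delta ::
    "real \<Rightarrow> real set \<Rightarrow> (real \<times> real \<Rightarrow> real \<Rightarrow> real) \<Rightarrow> (real \<times> real \<Rightarrow> real \<Rightarrow> real) \<Rightarrow> real \<Rightarrow> real" where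
  "I1_Delta \<alpha> K \<beta>1 \<beta>2 \<Delta> = (let r = \<Delta> powr (- 1 / \<alpha>) in SUP k\<in>K \<times> K.
     (fst k + snd k) / (2 - \<alpha>)
     + 2 * (LBINT z:{0..1}. (\<bar>\<beta>1 k (- r * z)\<bar> + \<bar>\<beta>2 k (r * z)\<bar>) / z powr (\<alpha> - 1))
     + \<bar>\<beta>1 k (- r)\<bar> + \<bar>\<beta>2 k r\<bar>)"

definition I2_Delta ::
    "real \<Rightarrow> real set \<Rightarrow> (real \<times> real \<Rightarrow> real \<Rightarrow> real) \<Rightarrow> (real \<times> real \<Rightarrow> real \<Rightarrow> real) \<Rightarrow> real \<Rightarrow> real" where
  "I2_Delta \<alpha> K \<beta>1 \<beta>2 \<Delta> = (let r = \<Delta> powr (- 1 / \<alpha>) in SUP k\<in>K \<times> K.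
     (fst k + snd k) / (\<alpha> - 1)
     + (LBINT z:{1..}. (\<bar>\<beta>1 k (- r * z)\<bar> + \<bar>\<beta>2 k (r * z)\<bar>) / z powr \<alpha>)
     + \<bar>\<beta>1 k (- r)\<bar> + \<bar>\<beta>2 k r\<bar>)"

definition I_Delta ::
    "real \<Rightarrow> real set \<Rightarrow> (real \<times> real \<Rightarrow> real \<Rightarrow> real) \<Rightarrow> (real \<times> real \<Rightarrow> real \<Rightarrow> real) \<Rightarrow> real \<Rightarrow> real" where
  "I_Delta \<alpha> K \<beta>1 \<beta>2 \<Delta> = sqrt (I1_Delta \<alpha> K \<beta>1 \<beta>2 \<Delta>) + 2 * I2_Delta \<alpha> K \<beta>1 \<beta>2 \<Delta>"

text \<open>
  \<open>c\<phi>\<close> stands for \<open>C\<^sub>\<phi>\<close>, \<open>cH\<close> for the constant of the regularity estimate of \<open>u\<close>, \<open>mX\<close> and \<open>m\<xi>\<close> for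
  \<open>M\<^sub>X\<^sup>1\<close> and \<open>M\<^sub>\<xi>\<^sup>1\<close>, \<open>m\<zeta>\<close> for \<open>M\<^sub>\<zeta>\<close>, and \<open>I\<close> for \<open>I\<^sub>\<Delta>\<close>.
\<close>

definition L_0 :: "real \<Rightarrow> real \<Rightarrow> real \<Rightarrow> real \<Rightarrow> real \<Rightarrow> real \<Rightarrow> real \<Rightarrow> real \<Rightarrow> real" where
  "L_0 c\<phi> cH mX m\<xi> m\<zeta> T M C =
     c\<phi> * (mX + m\<xi>) + 4 * cH + 2 * T * cH * m\<zeta> * (2 * (1 + m\<xi>) + 4 * M + 26 * C)"

definition U_0 :: "real \<Rightarrow> real \<Rightarrow> real \<Rightarrow> real \<Rightarrow> real \<Rightarrow> real \<Rightarrow> real \<Rightarrow> real \<Rightarrow> real" where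
  "U_0 c\<phi> I mX m\<xi> m\<zeta> T M C =
     c\<phi> * (mX + m\<xi> + 4 * (1 + I) + 2 * T * m\<zeta> * (1 + I) * (2 * (1 + m\<xi>) + 4 * M + 26 * C))"

definition rate :: "real \<Rightarrow> real \<Rightarrow> real" where
  "rate \<alpha> q = Min {1 / 4, (2 - \<alpha>) / (2 * \<alpha>), q / 2}"

end

theory Submission
  imports Defs
begin

text \<open>
  The layer cake formula computes one step of the scheme for a fixed pair \<open>k\<close> exactly: if
  \<open>G 0 = 0\<close>, then \<open>E G (\<tau>^(1/\<alpha>) W)\<close> equals \<open>\<tau>\<close> times the two-sided integral of \<open>G'\<close>
  against the tails \<open>(k/\<alpha> + \<beta>) |z|^-\<alpha>\<close>, and \<open>\<beta> = 0\<close> gives the integral of \<open>G\<close> against the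
  Levy measure. Hence the consistency error of the scheme involves only the integrals of (A3).

  For \<open>u - u\<Delta>\<close>, averages of the scheme in time and space are smooth and, by convexity of the
  supremum, supersolutions up to the consistency error; they are compared with the viscosity
  subsolution \<open>u\<close>. For \<open>u\<Delta> - u\<close> the averages of \<open>u\<close> must be shown to be supersolutions. For each
  fixed \<open>k\<close>, \<open>u\<close> lies above the iterates of the linear operator with small time step, because the
  interpolations \<open>g + \<theta> (E g - g)\<close> are smooth approximate subsolutions. Linear operators commute
  with averaging, so the averages of \<open>u\<close> inherit this and are classical supersolutions, which the
  scheme can be compared with step by step. This starts at time \<open>3 h\<close>, since \<open>u\<close> lives on \<open>[0, T]\<close>
  only and the averages look ahead.

  The averages are three-fold uniform averages over intervals of lengths \<open>h\<close> (time) and \<open>b\<close>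
  (space) rather than convolutions with \<open>\<zeta>\<close>. All that is used of \<open>\<zeta>\<close> is \<open>M\<^sub>\<zeta> \<ge> 16\<close>, which makes
  \<open>L\<^sub>0\<close> and \<open>U\<^sub>0\<close> large enough. The lower bound mixes the Lipschitz constant of \<open>\<phi>\<close> and the Hoelder
  constant of \<open>u\<close>, and closes because \<open>max L\<^sub>0 U\<^sub>0 \<ge> (L\<^sub>0 + U\<^sub>0) / 2\<close>.
\<close>

section \<open>Averaging operators\<close>

text \<open>The scales behind the rate: with \<open>e = \<Delta> powr rate \<alpha> q\<close>, time
  windows have length of order e^2 and space windows of order e. Averaging costs order e, because
  both functions are Lipschitz in space and move by order e in time e^2 (for \<open>u\<close> since
  1/\<alpha> \<ge> 1/2). A second time derivative of an average has order e / e^4, so steps \<Delta>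
  \<le> e^4 cost order e per unit of time; the error \<Delta>^q \<le> e^2 of (A3) meets a second
  space derivative of order 1/e. Hence the exponents 1/4 and q/2. Three averages are what test
  functions demand: a Lipschitz function gains three space derivatives; in time the scheme jumps, so
  one average is spent on Lipschitz continuity and two yield derivatives. The obstacle in the lower
  bound is that a viscosity inequality lives at contact points and cannot be averaged directly. An
  inequality between \<open>u\<close> at two times can, and the averages pass through a linear
  operator connecting them; letting first the step and then the distance of the two times tend to 0
  recovers a pointwise inequality.\<close>

definition sm :: "real measure \<Rightarrow> real \<Rightarrow> (real \<Rightarrow> real) \<Rightarrow> real \<Rightarrow> real" where
  "sm M h f x = (\<integral>s. f (x + h * s) \<partial>M)"

definition bm :: "(real \<Rightarrow> real) \<Rightarrow> bool" where
  "bm f \<longleftrightarrow> f \<in> borel_measurable borel \<and> (\<exists>B. \<forall>x. \<bar>f x\<bar> \<le> B)"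

definition lip :: "real \<Rightarrow> (real \<Rightarrow> real) \<Rightarrow> bool" where
  "lip L f \<longleftrightarrow> (\<forall>x y. \<bar>f x - f y\<bar> \<le> L * \<bar>x - y\<bar>)"

lemma lipD: "lip L f \<Longrightarrow> \<bar>f x - f y\<bar> \<le> L * \<bar>x - y\<bar>"
  by (auto simp: lip_def)

lemma lip_nonneg: "lip L f \<Longrightarrow> 0 \<le> L"
  using lipD[of L f 1 0] by simp

lemma lip_continuous: assumes "lip L f" shows "continuous_on S f"
proof -
  have "L-lipschitz_on S f"
    using lipD[OF assms] lip_nonneg[OF assms] by (intro lipschitz_onI) (simp_all add: dist_real_def)
  then show ?thesis by (rule lipschitz_on_continuous_on)
qed

lemma lip_measurable: "lip L f \<Longrightarrow> f \<in> borel_measurable borel"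
  by (rule borel_measurable_continuous_onI) (rule lip_continuous)

lemma lip_diff: assumes "lip L f" "lip M g" shows "lip (L + M) (\<lambda>x. f x - g x)"
  unfolding lip_def
proof (intro allI)
  fix x y
  show "\<bar>f x - g x - (f y - g y)\<bar> \<le> (L + M) * \<bar>x - y\<bar>"
    using lipD[OF assms(1), of x y] lipD[OF assms(2), of x y] by (simp add: distrib_right)
qed

lemma lip_shift: assumes "lip L f" shows "lip L (\<lambda>x. f (x + c))"
  unfolding lip_def
proof (intro allI)
  fix x y show "\<bar>f (x + c) - f (y + c)\<bar> \<le> L * \<bar>x - y\<bar>"
    using lipD[OF assms, of "x + c" "y + c"] by simp
qed

lemma bmI: "f \<in> borel_measurable borel \<Longrightarrow> (\<And>x. \<bar>f x\<bar> \<le> B) \<Longrightarrow> bm f"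
  unfolding bm_def by blast

lemma bm_measurable: "bm f \<Longrightarrow> f \<in> borel_measurable borel"
  unfolding bm_def by blast

lemma bm_bound: assumes "bm f" obtains B where "\<And>x. \<bar>f x\<bar> \<le> B"
  using assms unfolding bm_def by blast

lemma bm_shift: assumes "bm f" shows "bm (\<lambda>x. f (x + c))"
proof -
  obtain A where A: "\<And>x. \<bar>f x\<bar> \<le> A" using bm_bound[OF assms] by metis
  note [measurable] = bm_measurable[OF assms]
  show ?thesis by (rule bmI[of _ A]) (use A in simp_all)
qed

lemma bm_diff: assumes "bm f" "bm g" shows "bm (\<lambda>x. f x - g x)"
proof -
  obtain A where A: "\<And>x. \<bar>f x\<bar> \<le> A" using bm_bound[OF assms(1)] by metis
  obtain B where B: "\<And>x. \<bar>g x\<bar> \<le> B" using bm_bound[OF assms(2)] by metis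
  note [measurable] = bm_measurable[OF assms(1)] bm_measurable[OF assms(2)]
  show ?thesis
  proof (rule bmI)
    show "\<bar>f x - g x\<bar> \<le> A + B" for x using A[of x] B[of x] by linarith
  qed simp
qed

context real_distribution begin

lemma bm_integrable: assumes "bm f" shows "integrable M (\<lambda>s. f (x + h * s))"
proof -
  obtain B where B: "\<And>x. \<bar>f x\<bar> \<le> B" using bm_bound[OF assms] by metis
  note [measurable] = bm_measurable[OF assms]
  show ?thesis by (rule integrable_const_bound[of _ B]) (use B in simp_all)
qed

lemma lip_integrable:
  assumes "lip L f" "integrable M (\<lambda>s. s)" shows "integrable M (\<lambda>s. f (x + h * s))"
proof -
  note [measurable] = lip_measurable[OF assms(1)]
  show ?thesis
  proof (rule Bochner_Integration.integrable_bound)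
    show "integrable M (\<lambda>s. \<bar>f x\<bar> + L * \<bar>h\<bar> * \<bar>s\<bar>)"
      by (intro Bochner_Integration.integrable_add integrable_mult_right integrable_abs assms(2) integrable_const)
    have "\<bar>f (x + h * s)\<bar> \<le> \<bar>f x\<bar> + L * \<bar>h\<bar> * \<bar>s\<bar>" for s
      using lipD[OF assms(1), of "x + h * s" x] by (simp add: abs_mult)
    then show "AE s in M. norm (f (x + h * s)) \<le> norm (\<bar>f x\<bar> + L * \<bar>h\<bar> * \<bar>s\<bar>)"
      by (intro AE_I2) (metis abs_ge_self order_trans real_norm_def)
  qed simp
qed

lemma sm_mono:
  assumes "integrable M (\<lambda>s. f (x + h * s))" "integrable M (\<lambda>s. g (y + h' * s))"
    "\<And>s. f (x + h * s) \<le> g (y + h' * s)"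
  shows "sm M h f x \<le> sm M h' g y"
  unfolding sm_def by (rule integral_mono) (use assms in auto)

lemma sm_diff: assumes "bm f" "bm g" shows "sm M h (\<lambda>x. f x - g x) x = sm M h f x - sm M h g x"
  unfolding sm_def using bm_integrable assms by simp

lemma sm_shift: "sm M h (\<lambda>x. f (x + c)) x = sm M h f (x + c)"
  by (simp add: sm_def ac_simps)

lemma sm_lip:
  assumes "lip L f" "\<And>x. integrable M (\<lambda>s. f (x + h * s))" shows "lip L (sm M h f)"
  unfolding lip_def
proof (intro allI)
  fix x y
  have "\<bar>sm M h f x - sm M h f y\<bar> = \<bar>\<integral>s. f (x + h * s) - f (y + h * s) \<partial>M\<bar>"
    unfolding sm_def using assms(2) by simp
  also have "\<dots> \<le> (\<integral>s. \<bar>f (x + h * s) - f (y + h * s)\<bar> \<partial>M)" by (rule integral_abs_bound)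
  also have "\<dots> \<le> (\<integral>s. L * \<bar>x - y\<bar> \<partial>M)"
  proof (rule integral_mono)
    show "\<bar>f (x + h * s) - f (y + h * s)\<bar> \<le> L * \<bar>x - y\<bar>" for s
      using lipD[OF assms(1), of "x + h * s" "y + h * s"] by simp
  qed (use assms(2) in auto)
  also have "\<dots> = L * \<bar>x - y\<bar>" using prob_space by simp
  finally show "\<bar>sm M h f x - sm M h f y\<bar> \<le> L * \<bar>x - y\<bar>" .
qed

lemma sm_abs_le:
  assumes "\<And>x. \<bar>f x\<bar> \<le> B" shows "\<bar>sm M h f x\<bar> \<le> B"
proof (cases "integrable M (\<lambda>s. f (x + h * s))")
  case True
  have "\<bar>sm M h f x\<bar> \<le> (\<integral>s. \<bar>f (x + h * s)\<bar> \<partial>M)"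
    unfolding sm_def by (rule integral_abs_bound)
  also have "\<dots> \<le> (\<integral>s. B \<partial>M)" using True assms by (intro integral_mono) auto
  finally show ?thesis using prob_space by simp
next
  \<comment> \<open>The integral of a non-integrable function is 0, and \<open>0 \<le> B\<close>
    follows from the bound on \<open>f\<close>.\<close>
  case False
  then have "sm M h f x = 0" by (simp add: sm_def not_integrable_integral_eq)
  then show ?thesis using assms[of x] by simp
qed

lemma bm_sm: assumes "bm f" shows "bm (sm M h f)"
proof -
  obtain B where B: "\<And>x. \<bar>f x\<bar> \<le> B" using bm_bound[OF assms] by metis
  note [measurable] = bm_measurable[OF assms]
  have "(\<lambda>x. \<integral>s. f (x + h * s) \<partial>M) \<in> borel_measurable borel"
    by measurable
  then show ?thesis
    by (intro bmI[of _ B] sm_abs_le B) (simp add: sm_def[abs_def])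
qed

end

text \<open>Window averages (uniform law, \<open>h\<close> the window length) and the one-step
  operator (law \<open>W k\<close>, \<open>h = \<tau> powr (1 / \<alpha>)\<close>) are both of the
  form \<open>sm\<close>, so one application of Fubini covers all commutation facts in
  space.\<close>

lemma sm_commute:
  assumes "real_distribution M" "real_distribution N" "bm f"
  shows "sm M h (sm N g f) x = sm N g (sm M h f) x"
proof -
  interpret M: real_distribution M by fact
  interpret N: real_distribution N by fact
  interpret P: pair_prob_space M N ..
  obtain B where B: "\<And>x. \<bar>f x\<bar> \<le> B" using bm_bound[OF assms(3)] by metis
  note [measurable] = bm_measurable[OF assms(3)]
  have i: "integrable (M \<Otimes>\<^sub>M N) (\<lambda>(s, y). f (x + h * s + g * y))"
    by (rule P.integrable_const_bound[of _ B]) (use B in \<open>auto simp: split_beta\<close>)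
  show ?thesis unfolding sm_def
    using P.Fubini_integral[OF i] by (simp add: ac_simps)
qed

section \<open>Averages of functions of time and space\<close>

definition bm2 :: "(real \<Rightarrow> real \<Rightarrow> real) \<Rightarrow> bool" where
  "bm2 f \<longleftrightarrow> (\<lambda>p. f (fst p) (snd p)) \<in> borel_measurable (borel \<Otimes>\<^sub>M borel) \<and> (\<exists>B. \<forall>t x. \<bar>f t x\<bar> \<le> B)"

lemma bm2_bound: assumes "bm2 f" obtains B where "\<And>t x. \<bar>f t x\<bar> \<le> B"
  using assms unfolding bm2_def by blast

lemma bm2I: "(\<lambda>p. f (fst p) (snd p)) \<in> borel_measurable (borel \<Otimes>\<^sub>M borel) \<Longrightarrow> (\<And>t x. \<bar>f t x\<bar> \<le> B) \<Longrightarrow> bm2 f"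
  unfolding bm2_def by blast

definition smt :: "real measure \<Rightarrow> real \<Rightarrow> (real \<Rightarrow> real \<Rightarrow> real) \<Rightarrow> real \<Rightarrow> real \<Rightarrow> real" where
  "smt M h f t x = sm M h (\<lambda>s. f s x) t"

definition smx :: "real measure \<Rightarrow> real \<Rightarrow> (real \<Rightarrow> real \<Rightarrow> real) \<Rightarrow> real \<Rightarrow> real \<Rightarrow> real" where
  "smx M h f t x = sm M h (f t) x"

lemma bm2_measurable:
  assumes "bm2 f" "g \<in> borel_measurable M" "k \<in> borel_measurable M"
  shows "(\<lambda>w. f (g w) (k w)) \<in> borel_measurable M"
proof -
  have "(\<lambda>w. (g w, k w)) \<in> M \<rightarrow>\<^sub>M borel \<Otimes>\<^sub>M borel" using assms by simp
  then have "(\<lambda>w. (\<lambda>p. f (fst p) (snd p)) (g w, k w)) \<in> borel_measurable M"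
    by (rule measurable_compose) (use assms(1) in \<open>simp add: bm2_def\<close>)
  then show ?thesis by simp
qed

lemma bm2_slices: assumes "bm2 f" shows "bm (f t)" "bm (\<lambda>s. f s x)"
proof -
  obtain B where B: "\<And>t x. \<bar>f t x\<bar> \<le> B" using bm2_bound[OF assms] by metis
  have "(\<lambda>x. f t x) \<in> borel_measurable borel" "(\<lambda>s. f s x) \<in> borel_measurable borel"
    by (rule bm2_measurable[OF assms]; simp)+
  then show "bm (f t)" "bm (\<lambda>s. f s x)" by (auto intro: bmI B)
qed

lemma bm2_smx: assumes "real_distribution M" "bm2 f" shows "bm2 (smx M h f)"
proof -
  interpret M: real_distribution M by fact
  obtain B where B: "\<And>t x. \<bar>f t x\<bar> \<le> B" using bm2_bound[OF assms(2)] by metis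
  have [measurable]: "(\<lambda>p. f (fst (fst p)) (snd (fst p) + h * snd p)) \<in> borel_measurable ((borel \<Otimes>\<^sub>M borel) \<Otimes>\<^sub>M M)"
    by (rule bm2_measurable[OF assms(2)]) measurable
  have "(\<lambda>p. \<integral>s. f (fst p) (snd p + h * s) \<partial>M) \<in> borel_measurable (borel \<Otimes>\<^sub>M borel)"
    by (rule M.borel_measurable_lebesgue_integral) (simp add: split_beta)
  moreover have "\<bar>\<integral>s. f t (x + h * s) \<partial>M\<bar> \<le> B" for t x
    using M.sm_abs_le[of "f t" B h x] B by (auto simp: sm_def)
  ultimately show ?thesis
    by (intro bm2I[of _ B]) (simp_all add: smx_def[abs_def] sm_def)
qed

lemma bm2_smt: assumes "real_distribution M" "bm2 f" shows "bm2 (smt M h f)"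
proof -
  interpret M: real_distribution M by fact
  obtain B where B: "\<And>t x. \<bar>f t x\<bar> \<le> B" using bm2_bound[OF assms(2)] by metis
  have [measurable]: "(\<lambda>p. f (fst (fst p) + h * snd p) (snd (fst p))) \<in> borel_measurable ((borel \<Otimes>\<^sub>M borel) \<Otimes>\<^sub>M M)"
    by (rule bm2_measurable[OF assms(2)]) measurable
  have "(\<lambda>p. \<integral>s. f (fst p + h * s) (snd p) \<partial>M) \<in> borel_measurable (borel \<Otimes>\<^sub>M borel)"
    by (rule M.borel_measurable_lebesgue_integral) (simp add: split_beta)
  moreover have "\<bar>\<integral>s. f (t + h * s) x \<partial>M\<bar> \<le> B" for t x
    using M.sm_abs_le[of "\<lambda>s. f s x" B h t] B by (auto simp: sm_def)
  ultimately show ?thesis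
    by (intro bm2I[of _ B]) (simp_all add: smt_def[abs_def] sm_def)
qed

lemma smx_smx:
  assumes "real_distribution M" "real_distribution N" "bm2 f"
  shows "smx M h (smx N g f) = smx N g (smx M h f)"
  using sm_commute[OF assms(1,2) bm2_slices(1)[OF assms(3)]]
  by (intro ext) (simp add: smx_def[abs_def])

lemma smt_smx:
  assumes "real_distribution M" "real_distribution N" "bm2 f"
  shows "smt M h (smx N g f) = smx N g (smt M h f)"
proof (intro ext)
  fix t x
  interpret M: real_distribution M by fact
  interpret N: real_distribution N by fact
  interpret P: pair_prob_space M N ..
  obtain B where B: "\<And>t x. \<bar>f t x\<bar> \<le> B" using bm2_bound[OF assms(3)] by metis
  have [measurable]: "(\<lambda>p. f (t + h * fst p) (x + g * snd p)) \<in> borel_measurable (M \<Otimes>\<^sub>M N)"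
    by (rule bm2_measurable[OF assms(3)]) measurable
  have i: "integrable (M \<Otimes>\<^sub>M N) (\<lambda>(s, y). f (t + h * s) (x + g * y))"
    by (rule P.integrable_const_bound[of _ B]) (use B in \<open>auto simp: split_beta\<close>)
  show "smt M h (smx N g f) t x = smx N g (smt M h f) t x"
    unfolding smt_def smx_def sm_def using P.Fubini_integral[OF i] by simp
qed

section \<open>Uniform averages as smoothing operators\<close>

definition unif :: "real measure" where "unif = uniform_measure lborel {0..1}"

interpretation unif: real_distribution unif
proof -
  interpret prob_space unif unfolding unif_def by (rule prob_space_uniform_measure) auto
  show "real_distribution unif" by unfold_locales (auto simp: unif_def)
qed

abbreviation "av \<equiv> sm unif"

lemma av_le:
  assumes "bm f" "0 \<le> h" "\<And>s. 0 \<le> s \<Longrightarrow> s \<le> h \<Longrightarrow> f (x + s) \<le> c"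
  shows "av h f x \<le> c"
  unfolding sm_def
proof (rule unif.integral_le_const)
  show "integrable unif (\<lambda>s. f (x + h * s))" using assms unif.bm_integrable by simp
  show "AE s in unif. f (x + h * s) \<le> c" unfolding unif_def
    by (rule AE_uniform_measureI) (use assms in \<open>auto simp: mult_left_le\<close>)
qed

lemma unif_integral:
  fixes g :: "real \<Rightarrow> real"
  assumes "g \<in> borel_measurable borel"
  shows "(\<integral>s. g s \<partial>unif) = (\<integral>s. indicator {0..1} s * g s \<partial>lborel)"
proof -
  have e: "unif = density lborel (\<lambda>x. ennreal (indicator {0..1} x))"
    unfolding unif_def uniform_measure_def by (rule density_cong) (auto simp: ennreal_indicator divide_ennreal_def)
  show ?thesis unfolding e using integral_density[of g lborel "indicator {0..1}"] assms by simp
qed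

text \<open>With an antiderivative \<open>F\<close> of \<open>f\<close> the average is
  \<open>(F (x + h) - F x) / h\<close>. So each average gains one derivative, and this derivative is
  a difference quotient of \<open>f\<close>, which can be estimated without differentiating
  \<open>f\<close>.\<close>

lemma av_has_derivative:
  assumes c: "continuous_on UNIV f" and h: "0 < h"
  shows "(av h f has_real_derivative (f (x + h) - f x) / h) (at x)"
proof -
  have "\<exists>F. \<forall>x::real. -\<infinity> < ereal x \<longrightarrow> ereal x < \<infinity> \<longrightarrow> (F has_vector_derivative f x) (at x)"
    by (rule einterval_antiderivative) (use c in \<open>auto simp: continuous_on_eq_continuous_at\<close>)
  then obtain F where F: "\<And>x. (F has_real_derivative f x) (at x)"
    by (auto simp: has_real_derivative_iff_has_vector_derivative)
  have [measurable]: "f \<in> borel_measurable borel" using c by (rule borel_measurable_continuous_onI)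
  have eq: "av h f x = (F (x + h) - F x) / h" for x
  proof -
    have "((\<lambda>s. F (x + h * s) / h) has_real_derivative f (x + h * s)) (at s within A)" for s A
      using h by (auto intro!: derivative_eq_intros DERIV_subset[OF DERIV_chain'[OF _ F]])
    then have "(\<integral>s. indicator {0..1} s *\<^sub>R f (x + h * s) \<partial>lborel) = F (x + h * 1) / h - F (x + h * 0) / h"
      by (intro integral_FTC_Icc) (auto simp: has_real_derivative_iff_has_vector_derivative intro!: continuous_on_compose2[OF c] continuous_intros)
    then show ?thesis unfolding sm_def by (simp add: unif_integral diff_divide_distrib)
  qed
  have "av h f = (\<lambda>x. (F (x + h) - F x) / h)" using eq by blast
  then show ?thesis using h
    by (auto intro!: derivative_eq_intros DERIV_chain'[OF _ F])
qed

text \<open>Two windows of equal length differ in two intervals as long as the shift between them.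
  This is the gain for merely bounded functions, such as the scheme as a step function of
  time.\<close>

lemma av_lip:
  assumes "bm f" "\<And>x. \<bar>f x\<bar> \<le> B" "0 < h"
  shows "lip (2 * B / h) (av h f)"
proof -
  note [measurable] = bm_measurable[OF assms(1)]
  have B: "0 \<le> B" using assms(2)[of 0] by simp
  have eq: "av h f x = (\<integral>t. indicator {x..x+h} t * f t \<partial>lborel) / h" for x
  proof -
    have "(\<integral>t. indicator {x..x+h} t * f t \<partial>lborel) = h * (\<integral>s. indicator {x..x+h} (x + h * s) * f (x + h * s) \<partial>lborel)"
      using lborel_integral_real_affine[of h "\<lambda>t. indicator {x..x+h} t * f t" x] assms(3) by simp
    also have "(\<integral>s. indicator {x..x+h} (x + h * s) * f (x + h * s) \<partial>lborel) = (\<integral>s. indicator {0..1} s * f (x + h * s) \<partial>lborel)"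
      using assms(3) by (intro Bochner_Integration.integral_cong) (auto simp: indicator_def zero_le_mult_iff)
    finally show ?thesis using assms(3) by (simp add: sm_def unif_integral)
  qed
  have I: "integrable lborel (\<lambda>t. indicator {a..b} t * B)" for a b :: real
    by (intro integrable_mult_left integrable_real_indicator) (auto simp: emeasure_lborel_Icc_eq)
  have J: "(\<integral>t. indicator {a..b} t * B \<partial>lborel) = (b - a) * B" if "a \<le> b" for a b :: real
    using that by simp
  have int: "integrable lborel (\<lambda>t. indicator {a..b} t * f t)" for a b :: real
  proof (rule Bochner_Integration.integrable_bound)
    show "integrable lborel (\<lambda>t. indicator {a..b} t * B)" by (rule I)
    have "\<bar>indicator {a..b} t * f t\<bar> \<le> indicator {a..b} t * B" for t
      using assms(2)[of t] by (auto split: split_indicator)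
    then show "AE t in lborel. norm (indicator {a..b} t * f t) \<le> norm (indicator {a..b} t * B)"
      by (intro AE_I2) (metis abs_ge_self order_trans real_norm_def)
  qed auto
  have main: "\<bar>av h f x - av h f y\<bar> \<le> 2 * B / h * (y - x)" if "x \<le> y" for x y
  proof -
    have "\<bar>(\<integral>t. indicator {x..x+h} t * f t \<partial>lborel) - (\<integral>t. indicator {y..y+h} t * f t \<partial>lborel)\<bar>
       = \<bar>\<integral>t. indicator {x..x+h} t * f t - indicator {y..y+h} t * f t \<partial>lborel\<bar>"
      using int by simp
    also have "\<dots> \<le> (\<integral>t. \<bar>indicator {x..x+h} t * f t - indicator {y..y+h} t * f t\<bar> \<partial>lborel)"
      by (rule integral_abs_bound)
    also have "\<dots> \<le> (\<integral>t. indicator {x..y} t * B + indicator {x+h..y+h} t * B \<partial>lborel)"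
    proof (rule integral_mono)
      show "\<bar>indicator {x..x+h} t * f t - indicator {y..y+h} t * f t\<bar> \<le> indicator {x..y} t * B + indicator {x+h..y+h} t * B" for t
      proof (cases "t \<in> {x..x+h}"; cases "t \<in> {y..y+h}")
        assume "t \<in> {x..x+h}" "t \<in> {y..y+h}"
        then show ?thesis using B by simp
      next
        assume "t \<in> {x..x+h}" "t \<notin> {y..y+h}"
        moreover from this have "t \<in> {x..y}" using that by auto
        ultimately show ?thesis using B assms(2)[of t] by (simp add: add_increasing2)
      next
        assume "t \<notin> {x..x+h}" "t \<in> {y..y+h}"
        moreover from this have "t \<in> {x+h..y+h}" using that by auto
        ultimately show ?thesis using B assms(2)[of t] by (simp add: add_increasing)
      qed (use B in simp)
      show "integrable lborel (\<lambda>t. \<bar>indicator {x..x+h} t * f t - indicator {y..y+h} t * f t\<bar>)"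
        using int by (intro integrable_abs Bochner_Integration.integrable_diff)
    qed (rule Bochner_Integration.integrable_add[OF I I])
    also have "\<dots> = 2 * B * (y - x)"
      unfolding Bochner_Integration.integral_add[OF I I] using J[of x y] J[of "x+h" "y+h"] that by simp
    finally show ?thesis unfolding eq using assms(3)
      by (simp add: divide_simps flip: diff_divide_distrib)
  qed
  show ?thesis unfolding lip_def
  proof (intro allI)
    fix x y show "\<bar>av h f x - av h f y\<bar> \<le> 2 * B / h * \<bar>x - y\<bar>"
      using main[of x y] main[of y x] by (cases "x \<le> y") (auto simp: abs_minus_commute)
  qed
qed

section \<open>Layer cake representation\<close>

text \<open>The flag \<open>cl\<close> chooses between closed and open tails: the tails of a distribution function are
closed on the negative side and open on the positive side, and the law may have an atom at 0.\<close>

lemma layer_cake: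
  fixes \<mu> :: "real measure" and G g Tl :: "real \<Rightarrow> real" and cl :: bool
  assumes sf: "sigma_finite_measure \<mu>" and sets[measurable_cong, simp]: "sets \<mu> = sets borel"
    and G: "\<And>z. (G has_real_derivative g z) (at z)" "continuous_on UNIV g" "G 0 = 0"
    and Tl: "\<And>z. 0 < z \<Longrightarrow> emeasure \<mu> {w. z < w \<or> (cl \<and> z = w)} = ennreal (Tl z)" "\<And>z. 0 < z \<Longrightarrow> 0 \<le> Tl z"
    and int: "set_integrable lborel {0<..} (\<lambda>z. g z * Tl z)"
  shows "set_integrable \<mu> {0<..} G"
    and "(LINT w:{0<..}|\<mu>. G w) = (LBINT z:{0<..}. g z * Tl z)"
proof -
  interpret sigma_finite_measure \<mu> by fact
  interpret P: pair_sigma_finite lborel \<mu> ..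
  have [measurable]: "g \<in> borel_measurable borel" using G(2) by (rule borel_measurable_continuous_onI)
  define D where "D z = {w. z < w \<or> (cl \<and> z = w)}" for z :: real
  define E where "E w = {z. 0 < z \<and> (z < w \<or> (cl \<and> z = w))}" for w :: real
  \<comment> \<open>Fubini for this function: integrating in \<open>w\<close> produces
    \<open>g\<close> times the tail, integrating in \<open>z\<close> produces \<open>G w\<close> by
    the fundamental theorem of calculus.\<close>
  define h where "h = (\<lambda>(z, w). if 0 < z \<and> (z < w \<or> (cl \<and> z = w)) then g z else 0)"
  have h1: "h (z, w) = indicator {0<..} z * g z * indicator (D z) w" for z w
    by (auto simp: h_def D_def split: split_indicator)
  have h2: "h (z, w) = indicator (E w) z * g z" for z w
    by (auto simp: h_def E_def split: split_indicator)
  have hm [measurable]: "h \<in> borel_measurable (lborel \<Otimes>\<^sub>M \<mu>)" unfolding h_def by measurable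
  have Dm [measurable]: "D z \<in> sets borel" for z unfolding D_def by measurable
  have mD: "measure \<mu> (D z) = Tl z" if "0 < z" for z
    using Tl that by (simp add: measure_def D_def)
  have iD: "integrable \<mu> (indicator (D z) :: real \<Rightarrow> real)" if "0 < z" for z
    using Tl(1)[OF that] by (simp add: D_def)
  have ih: "integrable \<mu> (\<lambda>w. h (z, w))" for z
    unfolding h1 by (cases "0 < z") (auto intro!: integrable_mult_right iD)
  have Inh: "(\<integral>w. h (z, w) \<partial>\<mu>) = indicator {0<..} z *\<^sub>R (g z * Tl z)" for z
    unfolding h1 by (cases "0 < z") (auto simp: mD)
  have Inh': "(\<integral>w. norm (h (z, w)) \<partial>\<mu>) = norm (indicator {0<..} z *\<^sub>R (g z * Tl z))" for z
    unfolding h1 by (cases "0 < z") (auto simp: mD abs_mult Tl(2))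
  have "integrable lborel (\<lambda>z. \<integral>w. norm (h (z, w)) \<partial>\<mu>)"
    unfolding Inh' using int unfolding set_integrable_def by (rule integrable_norm)
  then have H: "integrable (lborel \<Otimes>\<^sub>M \<mu>) (\<lambda>(z, w). h (z, w))"
    using P.Fubini_integrable[OF hm] ih by simp
  have FTC: "(\<integral>z. h (z, w) \<partial>lborel) = indicator {0<..} w *\<^sub>R G w" for w
  proof (cases "0 < w")
    case True
    \<comment> \<open>Only at 0 and \<open>w\<close> can \<open>h\<close> differ from
      \<open>g\<close> cut off to the closed interval.\<close>
    have "AE z in lborel. z \<notin> {0, w}" by (rule AE_not_in) (auto intro: finite_imp_null_set_lborel)
    then have ae: "AE z in lborel. h (z, w) = indicator {0..w} z *\<^sub>R g z"
      by eventually_elim (auto simp: h_def split: split_indicator)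
    have [measurable]: "E w \<in> sets borel" unfolding E_def by measurable
    have "(\<lambda>z. h (z, w)) \<in> borel_measurable lborel" unfolding h2 by measurable
    then have "(\<integral>z. h (z, w) \<partial>lborel) = (\<integral>z. indicator {0..w} z *\<^sub>R g z \<partial>lborel)"
      by (intro integral_cong_AE ae) auto
    also have "\<dots> = G w - G 0"
      by (rule integral_FTC_Icc) (use True G in \<open>auto simp: has_real_derivative_iff_has_vector_derivative[symmetric] intro: has_field_derivative_at_within continuous_on_subset\<close>)
    finally show ?thesis using True G by simp
  next
    case False
    then have "h (z, w) = 0" for z by (auto simp: h_def)
    then show ?thesis using False by simp
  qed
  have "integrable \<mu> (\<lambda>w. \<integral>z. h (z, w) \<partial>lborel)" using P.integrable_snd[OF H] by simp
  then show "set_integrable \<mu> {0<..} G" unfolding FTC set_integrable_def .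
  show "(LINT w:{0<..}|\<mu>. G w) = (LBINT z:{0<..}. g z * Tl z)"
    using P.Fubini_integral[OF H] unfolding FTC Inh set_lebesgue_integral_def by simp
qed

text \<open>The negative half line is the positive one for the reflected measure. The closed tail
  \<open>{..-z}\<close> reflects to \<open>{z..}\<close>, so the flag \<open>cl\<close> is
  \<open>True\<close> there and \<open>False\<close> on the other side; differentiating
  \<open>G (- z)\<close> causes the minus sign. The origin contributes nothing because
  \<open>G 0 = 0\<close>.\<close>

lemma layer_cake_two_sided:
  fixes \<mu> :: "real measure" and G g T1 T2 :: "real \<Rightarrow> real"
  assumes sf: "sigma_finite_measure \<mu>" and sets[measurable_cong, simp]: "sets \<mu> = sets borel"
    and G: "\<And>z. (G has_real_derivative g z) (at z)" "continuous_on UNIV g" "G 0 = 0"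
    and T1: "\<And>z. 0 < z \<Longrightarrow> emeasure \<mu> {..-z} = ennreal (T1 z)" "\<And>z. 0 < z \<Longrightarrow> 0 \<le> T1 z"
    and T2: "\<And>z. 0 < z \<Longrightarrow> emeasure \<mu> {z<..} = ennreal (T2 z)" "\<And>z. 0 < z \<Longrightarrow> 0 \<le> T2 z"
    and i1: "set_integrable lborel {0<..} (\<lambda>z. g (- z) * T1 z)"
    and i2: "set_integrable lborel {0<..} (\<lambda>z. g z * T2 z)"
  shows "integrable \<mu> G"
    and "(\<integral>w. G w \<partial>\<mu>) = (LBINT z:{0<..}. g z * T2 z) - (LBINT z:{0<..}. g (- z) * T1 z)"
proof -
  interpret sigma_finite_measure \<mu> by fact
  let ?\<nu> = "distr \<mu> borel uminus"
  have sf': "sigma_finite_measure ?\<nu>"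
  proof (rule sigma_finite_measure_distr[where f = uminus and N = borel])
    have "distr ?\<nu> borel uminus = distr \<mu> borel (\<lambda>x. x)" by (subst distr_distr) (auto simp: o_def)
    also have "\<dots> = \<mu>" by (rule distr_id2) simp
    finally show "sigma_finite_measure (distr ?\<nu> borel uminus)" using sf by simp
  qed simp
  have [measurable]: "G \<in> borel_measurable borel"
    using G(1) by (intro borel_measurable_continuous_onI) (auto intro: DERIV_isCont simp: continuous_on_eq_continuous_at)
  have cg: "continuous_on UNIV (\<lambda>z. - g (- z))"
    by (intro continuous_intros continuous_on_compose2[OF G(2)]) auto
  have em: "emeasure ?\<nu> {w. z < w \<or> (True \<and> z = w)} = ennreal (T1 z)" if "0 < z" for z
  proof -
    have "emeasure ?\<nu> {z..} = emeasure \<mu> (uminus -` {z..} \<inter> space \<mu>)" by (rule emeasure_distr) auto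
    also have "uminus -` {z..} \<inter> space \<mu> = {..-z}" using sets_eq_imp_space_eq[OF sets] by auto
    finally show ?thesis using T1(1)[OF that] by (simp add: le_less[symmetric] atLeast_def)
  qed
  have i1': "set_integrable lborel {0<..} (\<lambda>z. - g (- z) * T1 z)"
    using i1 by (simp add: set_integrable_def)
  have dG: "((\<lambda>z. G (- z)) has_real_derivative - g (- z)) (at z)" for z
    by (rule DERIV_cong[OF DERIV_chain'[OF DERIV_minus[OF DERIV_ident] G(1)]]) simp
  note A = layer_cake[OF sf' _ dG cg _ em T1(2) i1']
  note B = layer_cake[OF sf sets G, where cl = False, OF _ T2(2) i2]
  have A1: "set_integrable ?\<nu> {0<..} (\<lambda>z. G (- z))"
    and A2: "(LINT w:{0<..}|?\<nu>. G (- w)) = (LBINT z:{0<..}. - g (- z) * T1 z)"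
    using A G(3) by auto
  have B1: "set_integrable \<mu> {0<..} G" and B2: "(LINT w:{0<..}|\<mu>. G w) = (LBINT z:{0<..}. g z * T2 z)"
    using B T2(1) by (auto simp: greaterThan_def)
  have A1': "set_integrable \<mu> {..<0} G"
    using A1 unfolding set_integrable_def by (subst (asm) integrable_distr_eq) (auto simp: indicator_def if_distrib cong: if_cong)
  have A2': "(LINT w:{..<0}|\<mu>. G w) = (LBINT z:{0<..}. - g (- z) * T1 z)"
    unfolding A2[symmetric] unfolding set_lebesgue_integral_def
    by (subst integral_distr) (auto simp: indicator_def)
  have eq: "G w = indicator {..<0} w *\<^sub>R G w + indicator {0<..} w *\<^sub>R G w" for w
    using G(3) by (auto split: split_indicator)
  have "integrable \<mu> (\<lambda>w. indicator {..<0} w *\<^sub>R G w + indicator {0<..} w *\<^sub>R G w)"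
    using A1' B1 unfolding set_integrable_def by (rule Bochner_Integration.integrable_add)
  then show "integrable \<mu> G" unfolding eq[symmetric] .
  have "(\<integral>w. G w \<partial>\<mu>) = (\<integral>w. indicator {..<0} w *\<^sub>R G w + indicator {0<..} w *\<^sub>R G w \<partial>\<mu>)"
    using eq by simp
  also have "\<dots> = (LINT w:{..<0}|\<mu>. G w) + (LINT w:{0<..}|\<mu>. G w)"
    using A1' B1 unfolding set_integrable_def set_lebesgue_integral_def by (rule Bochner_Integration.integral_add)
  finally show "(\<integral>w. G w \<partial>\<mu>) = (LBINT z:{0<..}. g z * T2 z) - (LBINT z:{0<..}. g (- z) * T1 z)"
    unfolding A2' B2 by (simp add: set_lebesgue_integral_def)
qed

text \<open>Integrability of densities of the order of the tails of a Levy measure: near 0 they are tested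
against \<open>z\<close>, away from 0 against 1.\<close>

definition J1 :: "(real \<Rightarrow> real) \<Rightarrow> real" where "J1 p = (LBINT z:{0<..1}. z * \<bar>p z\<bar>)"
definition J2 :: "(real \<Rightarrow> real) \<Rightarrow> real" where "J2 p = (LBINT z:{1<..}. \<bar>p z\<bar>)"
definition wint :: "(real \<Rightarrow> real) \<Rightarrow> bool" where
  "wint p \<longleftrightarrow> set_borel_measurable borel {0<..} p \<and> set_integrable lborel {0<..1} (\<lambda>z. z * \<bar>p z\<bar>) \<and>
     set_integrable lborel {1<..} (\<lambda>z. \<bar>p z\<bar>)"

text \<open>The derivative of a Taylor remainder is of size min(A z, B): small for small jumps,
  bounded for large ones. Splitting the half line at 1 pairs \<open>A\<close> with \<open>J1\<close>
  and \<open>B\<close> with \<open>J2\<close>.\<close>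

lemma wint_bound:
  fixes g :: "real \<Rightarrow> real"
  assumes w: "wint p" and [measurable]: "g \<in> borel_measurable borel"
    and gA: "\<And>z. 0 < z \<Longrightarrow> \<bar>g z\<bar> \<le> A * z" and gB: "\<And>z. 0 < z \<Longrightarrow> \<bar>g z\<bar> \<le> B"
  shows "set_integrable lborel {0<..} (\<lambda>z. g z * p z)"
    and "\<bar>LBINT z:{0<..}. g z * p z\<bar> \<le> A * J1 p + B * J2 p"
proof -
  let ?b = "\<lambda>z. A * (indicator {0<..1} z *\<^sub>R (z * \<bar>p z\<bar>)) + B * (indicator {1<..} z *\<^sub>R \<bar>p z\<bar>)"
  have ib: "integrable lborel ?b"
    using w unfolding wint_def set_integrable_def
    by (intro Bochner_Integration.integrable_add integrable_mult_right) auto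
  have le: "\<bar>indicator {0<..} z *\<^sub>R (g z * p z)\<bar> \<le> ?b z" for z
    using gA[of z] gB[of z]
    by (auto simp: abs_mult mult.assoc[symmetric] intro!: mult_right_mono split: split_indicator)
  have [measurable]: "(\<lambda>z. indicator {0<..} z *\<^sub>R p z) \<in> borel_measurable borel"
    using w by (simp add: wint_def set_borel_measurable_def)
  have m: "(\<lambda>z. indicator {0<..} z *\<^sub>R (g z * p z)) \<in> borel_measurable lborel"
  proof -
    have "(\<lambda>z. g z * (indicator {0<..} z *\<^sub>R p z)) \<in> borel_measurable lborel" by measurable
    then show ?thesis by (simp add: mult.left_commute)
  qed
  show i: "set_integrable lborel {0<..} (\<lambda>z. g z * p z)" unfolding set_integrable_def
    by (rule Bochner_Integration.integrable_bound[OF ib m])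
       (use le in \<open>auto intro!: AE_I2 intro: order_trans[OF _ abs_ge_self]\<close>)
  have "\<bar>LBINT z:{0<..}. g z * p z\<bar> \<le> (\<integral>z. \<bar>indicator {0<..} z *\<^sub>R (g z * p z)\<bar> \<partial>lborel)"
    unfolding set_lebesgue_integral_def by (rule integral_abs_bound)
  also have "\<dots> \<le> (\<integral>z. ?b z \<partial>lborel)"
    by (rule integral_mono) (use i ib le in \<open>auto simp: set_integrable_def\<close>)
  also have "\<dots> = A * J1 p + B * J2 p"
    unfolding J1_def J2_def set_lebesgue_integral_def using w[unfolded wint_def set_integrable_def]
    by (subst Bochner_Integration.integral_add) (auto intro!: integrable_mult_right)
  finally show "\<bar>LBINT z:{0<..}. g z * p z\<bar> \<le> A * J1 p + B * J2 p" .
qed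

lemma wint_measurable:
  fixes p :: "real \<Rightarrow> real"
  assumes "set_borel_measurable borel {0<..} p"
  shows "(\<lambda>z. indicator {0<..1} z *\<^sub>R (z * \<bar>p z\<bar>)) \<in> borel_measurable lborel"
    "(\<lambda>z. indicator {1<..} z *\<^sub>R \<bar>p z\<bar>) \<in> borel_measurable lborel"
proof -
  have m: "(\<lambda>z. indicator {0<..} z *\<^sub>R p z) \<in> borel_measurable borel"
    using assms by (simp add: set_borel_measurable_def)
  have "(\<lambda>z. indicator {0<..1} z * (z * \<bar>indicator {0<..} z *\<^sub>R p z\<bar>)) \<in> borel_measurable borel"
    using m by measurable
  also have "(\<lambda>z. indicator {0<..1} z * (z * \<bar>indicator {0<..} z *\<^sub>R p z\<bar>)) = (\<lambda>z. indicator {0<..1} z *\<^sub>R (z * \<bar>p z\<bar>))"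
    by (auto split: split_indicator)
  finally show "(\<lambda>z. indicator {0<..1} z *\<^sub>R (z * \<bar>p z\<bar>)) \<in> borel_measurable lborel" by simp
  have "(\<lambda>z. indicator {1<..} z * \<bar>indicator {0<..} z *\<^sub>R p z\<bar>) \<in> borel_measurable borel"
    using m by measurable
  also have "(\<lambda>z. indicator {1<..} z * \<bar>indicator {0<..} z *\<^sub>R p z\<bar>) = (\<lambda>z. indicator {1<..} z *\<^sub>R \<bar>p z\<bar>)"
    by (auto split: split_indicator)
  finally show "(\<lambda>z. indicator {1<..} z *\<^sub>R \<bar>p z\<bar>) \<in> borel_measurable lborel" by simp
qed

lemma wint_dominated:
  assumes "wint p" "wint r" "set_borel_measurable borel {0<..} s" "\<And>z. 0 < z \<Longrightarrow> \<bar>s z\<bar> \<le> \<bar>p z\<bar> + \<bar>r z\<bar>"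
  shows "wint s" "J1 s \<le> J1 p + J1 r" "J2 s \<le> J2 p + J2 r"
proof -
  note m1 = wint_measurable(1)[OF assms(3)] and m2 = wint_measurable(2)[OF assms(3)]
  have i1: "integrable lborel (\<lambda>z. indicator {0<..1} z *\<^sub>R (z * \<bar>p z\<bar>) + indicator {0<..1} z *\<^sub>R (z * \<bar>r z\<bar>))"
    and i2: "integrable lborel (\<lambda>z. indicator {1<..} z *\<^sub>R \<bar>p z\<bar> + indicator {1<..} z *\<^sub>R \<bar>r z\<bar>)"
    using assms(1,2) unfolding wint_def set_integrable_def by (auto intro!: Bochner_Integration.integrable_add)
  have l1: "indicator {0<..1} z *\<^sub>R (z * \<bar>s z\<bar>) \<le> indicator {0<..1} z *\<^sub>R (z * \<bar>p z\<bar>) + indicator {0<..1} z *\<^sub>R (z * \<bar>r z\<bar>)" for z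
    using assms(4)[of z] by (auto split: split_indicator simp flip: distrib_left intro!: mult_left_mono)
  have l2: "indicator {1<..} z *\<^sub>R \<bar>s z\<bar> \<le> indicator {1<..} z *\<^sub>R \<bar>p z\<bar> + indicator {1<..} z *\<^sub>R \<bar>r z\<bar>" for z
    using assms(4)[of z] by (auto split: split_indicator)
  have j1: "set_integrable lborel {0<..1} (\<lambda>z. z * \<bar>s z\<bar>)" unfolding set_integrable_def
    by (rule Bochner_Integration.integrable_bound[OF i1 m1], rule AE_I2)
       (use l1 in \<open>auto intro!: order_trans[OF _ abs_ge_self] split: split_indicator\<close>)
  have j2: "set_integrable lborel {1<..} (\<lambda>z. \<bar>s z\<bar>)" unfolding set_integrable_def
    by (rule Bochner_Integration.integrable_bound[OF i2 m2], rule AE_I2)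
       (use l2 in \<open>auto intro!: order_trans[OF _ abs_ge_self] split: split_indicator\<close>)
  show "wint s" using assms(3) j1 j2 by (simp add: wint_def)
  have "J1 s \<le> (\<integral>z. indicator {0<..1} z *\<^sub>R (z * \<bar>p z\<bar>) + indicator {0<..1} z *\<^sub>R (z * \<bar>r z\<bar>) \<partial>lborel)"
    unfolding J1_def set_lebesgue_integral_def
    by (rule integral_mono[OF j1[unfolded set_integrable_def] i1 l1])
  also have "\<dots> = J1 p + J1 r" using assms(1,2) unfolding J1_def set_lebesgue_integral_def wint_def set_integrable_def
    by (intro Bochner_Integration.integral_add) auto
  finally show "J1 s \<le> J1 p + J1 r" .
  have "J2 s \<le> (\<integral>z. indicator {1<..} z *\<^sub>R \<bar>p z\<bar> + indicator {1<..} z *\<^sub>R \<bar>r z\<bar> \<partial>lborel)"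
    unfolding J2_def set_lebesgue_integral_def
    by (rule integral_mono[OF j2[unfolded set_integrable_def] i2 l2])
  also have "\<dots> = J2 p + J2 r" using assms(1,2) unfolding J2_def set_lebesgue_integral_def wint_def set_integrable_def
    by (intro Bochner_Integration.integral_add) auto
  finally show "J2 s \<le> J2 p + J2 r" .
qed

lemma wint_add: assumes "wint p" "wint r"
  shows "wint (\<lambda>z. p z + r z)" "J1 (\<lambda>z. p z + r z) \<le> J1 p + J1 r" "J2 (\<lambda>z. p z + r z) \<le> J2 p + J2 r"
proof -
  have "set_borel_measurable borel {0<..} (\<lambda>z. p z + r z)"
    using assms unfolding wint_def set_borel_measurable_def by (auto simp: distrib_left)
  from wint_dominated[OF assms this] show "wint (\<lambda>z. p z + r z)" "J1 (\<lambda>z. p z + r z) \<le> J1 p + J1 r" "J2 (\<lambda>z. p z + r z) \<le> J2 p + J2 r"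
    by auto
qed

lemma wint_cmult: assumes "wint p"
  shows "wint (\<lambda>z. c * p z)" "J1 (\<lambda>z. c * p z) = \<bar>c\<bar> * J1 p" "J2 (\<lambda>z. c * p z) = \<bar>c\<bar> * J2 p"
proof -
  have "set_borel_measurable borel {0<..} (\<lambda>z. c * p z)"
    using assms unfolding wint_def set_borel_measurable_def
    by (auto simp: mult.left_commute[of _ c] intro!: borel_measurable_times)
  then show "wint (\<lambda>z. c * p z)" using assms unfolding wint_def
    by (simp add: abs_mult mult.left_commute[of _ "\<bar>c\<bar>"])
  show "J1 (\<lambda>z. c * p z) = \<bar>c\<bar> * J1 p" "J2 (\<lambda>z. c * p z) = \<bar>c\<bar> * J2 p"
    unfolding J1_def J2_def by (simp_all add: abs_mult mult.left_commute[of _ "\<bar>c\<bar>"])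
qed

lemma nonneg_has_integral_set_integral:
  assumes "(f has_integral I) A" "A \<in> sets borel" "set_borel_measurable borel A f" "\<And>x. x \<in> A \<Longrightarrow> 0 \<le> f x"
  shows "set_integrable lborel A f" "(LBINT x:A. f x) = (I::real)"
proof -
  have "f absolutely_integrable_on A"
    using assms by (intro nonnegative_absolutely_integrable_1) (auto simp: has_integral_iff)
  then show *: "set_integrable lborel A f"
    using assms(3) integrable_completion[of "\<lambda>x. indicator A x *\<^sub>R f x" lborel]
    by (simp add: set_integrable_def set_borel_measurable_def)
  show "(LBINT x:A. f x) = I"
    using set_borel_integral_eq_integral(2)[OF *] assms(1) by (simp add: has_integral_iff)
qed

text \<open>Here both restrictions on \<alpha> enter: \<alpha> < 2 for integrability of
  z^(1-\<alpha>) at 0, and 1 < \<alpha> for integrability of z^-\<alpha> at infinity. The two values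
  are the weights of the sum of \<open>k\<close> in \<open>I1_Delta\<close> and
  \<open>I2_Delta\<close>.\<close>

lemma wint_powr: assumes "1 < \<alpha>" "\<alpha> < 2"
  shows "wint (\<lambda>z. z powr - \<alpha>)" "J1 (\<lambda>z. z powr - \<alpha>) = 1 / (2 - \<alpha>)" "J2 (\<lambda>z. z powr - \<alpha>) = 1 / (\<alpha> - 1)"
proof -
  have m: "set_borel_measurable borel A (\<lambda>z. z * \<bar>z powr - \<alpha>\<bar>)" "set_borel_measurable borel A (\<lambda>z. \<bar>z powr - \<alpha>\<bar>)"
    if "A \<in> sets borel" for A
    using that unfolding set_borel_measurable_def by measurable
  have "((\<lambda>x::real. x powr (1 - \<alpha>)) has_integral (1 powr ((1 - \<alpha>)+1) / ((1 - \<alpha>)+1))) {0..1}"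
    by (rule has_integral_powr_from_0) (use assms in auto)
  then have "((\<lambda>x::real. x powr (1 - \<alpha>)) has_integral 1 / (2 - \<alpha>)) {0..1}" by simp
  moreover have "x powr (1 - \<alpha>) = x * \<bar>x powr - \<alpha>\<bar>" if "x \<in> {0..1}" for x
    using that by (cases "x = 0") (simp_all add: powr_mult_base)
  ultimately have "((\<lambda>x. x * \<bar>x powr - \<alpha>\<bar>) has_integral 1 / (2 - \<alpha>)) {0..1}"
    by (rule has_integral_eq[rotated])
  then have "((\<lambda>x. x * \<bar>x powr - \<alpha>\<bar>) has_integral 1 / (2 - \<alpha>)) {0<..1}"
    by (rule has_integral_spike_set_eq[THEN iffD1, rotated 2]) (rule negligible_subset[of "{0}"]; auto)+
  note a = nonneg_has_integral_set_integral[OF this _ m(1)]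
  have "((\<lambda>x::real. x powr - \<alpha>) has_integral -(1 powr (- \<alpha> + 1)) / (- \<alpha> + 1)) {1..}"
    by (rule has_integral_powr_to_inf) (use assms in auto)
  then have "((\<lambda>x. \<bar>x powr - \<alpha>\<bar>) has_integral -1 / (- \<alpha> + 1)) {1..}"
    by simp
  moreover have "-1 / (- \<alpha> + 1) = 1 / (\<alpha> - 1)" using assms by (simp add: divide_simps)
  ultimately have "((\<lambda>x. \<bar>x powr - \<alpha>\<bar>) has_integral 1 / (\<alpha> - 1)) {1..}" by simp
  then have "((\<lambda>x. \<bar>x powr - \<alpha>\<bar>) has_integral 1 / (\<alpha> - 1)) {1<..}"
    by (rule has_integral_spike_set_eq[THEN iffD1, rotated 2]) (rule negligible_subset[of "{1}"]; auto)+
  note b = nonneg_has_integral_set_integral[OF this _ m(2)]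
  have "set_borel_measurable borel {0<..} (\<lambda>z. z powr - \<alpha>)"
    unfolding set_borel_measurable_def by measurable
  then show "wint (\<lambda>z. z powr - \<alpha>)" "J1 (\<lambda>z. z powr - \<alpha>) = 1 / (2 - \<alpha>)" "J2 (\<lambda>z. z powr - \<alpha>) = 1 / (\<alpha> - 1)"
    using a b by (simp_all add: wint_def J1_def J2_def)
qed

section \<open>The one-step operator and the generator\<close>

text \<open>The two constants stay separate because \<open>L1\<close> controls large jumps and
  \<open>L2\<close> small ones, and they scale differently with the width of the average.\<close>

definition c11 :: "real \<Rightarrow> real \<Rightarrow> (real \<Rightarrow> real) \<Rightarrow> (real \<Rightarrow> real) \<Rightarrow> bool" where
  "c11 L1 L2 f f' \<longleftrightarrow> (\<forall>x. (f has_real_derivative f' x) (at x)) \<and> (\<forall>x. \<bar>f' x\<bar> \<le> L1) \<and> lip L2 f'"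

text \<open>The derivative \<open>f'\<close> is a parameter, so that the generator can be estimated without \<open>deriv\<close>.\<close>

definition gen :: "real \<Rightarrow> real \<times> real \<Rightarrow> (real \<Rightarrow> real) \<Rightarrow> (real \<Rightarrow> real) \<Rightarrow> real \<Rightarrow> real" where
  "gen \<alpha> k f f' x = (\<integral>z. f (x + z) - f x - f' x * z \<partial>stable_levy_measure \<alpha> k)"

lemma c11_lip: assumes "c11 L1 L2 f f'" shows "lip L1 f"
  unfolding lip_def
proof (intro allI)
  fix x y
  have "norm (f x - f y) \<le> L1 * norm (x - y)"
    by (rule field_differentiable_bound[of UNIV f f' L1]) (use assms in \<open>auto simp: c11_def\<close>)
  then show "\<bar>f x - f y\<bar> \<le> L1 * \<bar>x - y\<bar>" by simp
qed

lemma sigma_finite_stable_levy: "sigma_finite_measure (stable_levy_measure \<alpha> k)"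
  unfolding stable_levy_measure_def
  by (subst sigma_finite_measure.sigma_finite_iff_density_finite[OF sigma_finite_lborel]) auto

lemma stable_tail_ge:
  assumes "1 < \<alpha>" "0 \<le> c" "0 < z"
  shows "(\<integral>\<^sup>+ x. ennreal (c / x powr (\<alpha> + 1)) * indicator {z..} x \<partial>lborel) = ennreal (c / \<alpha> * z powr - \<alpha>)"
proof -
  have "(\<integral>\<^sup>+ x. ennreal (c / x powr (\<alpha> + 1)) * indicator {z..} x \<partial>lborel) = ennreal (0 - (- (c / \<alpha> * z powr - \<alpha>)))"
  proof (rule nn_integral_FTC_atLeast)
    show "((\<lambda>x. - (c / \<alpha> * x powr - \<alpha>)) has_real_derivative c / x powr (\<alpha> + 1)) (at x)" if "z \<le> x" for x
      using that assms by (auto intro!: derivative_eq_intros simp: powr_minus powr_diff divide_simps powr_add)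
    have "((\<lambda>x::real. x powr - \<alpha>) \<longlongrightarrow> 0) at_top"
      by (rule tendsto_neg_powr) (use assms in \<open>auto simp: filterlim_ident\<close>)
    then show "((\<lambda>x. - (c / \<alpha> * x powr - \<alpha>)) \<longlongrightarrow> 0) at_top"
      using tendsto_minus[OF tendsto_mult_left[of "\<lambda>x. x powr - \<alpha>" 0 at_top "c / \<alpha>"]] by simp
  qed (use assms in auto)
  then show ?thesis by simp
qed

lemma stable_tails:
  assumes "1 < \<alpha>" "0 \<le> fst k" "0 \<le> snd k" "0 < z"
  shows "emeasure (stable_levy_measure \<alpha> k) {z<..} = ennreal (snd k / \<alpha> * z powr - \<alpha>)"
    "emeasure (stable_levy_measure \<alpha> k) {..-z} = ennreal (fst k / \<alpha> * z powr - \<alpha>)"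
proof -
  have ae: "AE x in lborel. x \<noteq> (z::real)" by (rule AE_lborel_singleton)
  have "emeasure (stable_levy_measure \<alpha> k) {z<..} = (\<integral>\<^sup>+ x. ennreal (snd k / x powr (\<alpha> + 1)) * indicator {z..} x \<partial>lborel)"
    unfolding stable_levy_measure_def using ae assms(4)
    by (subst emeasure_density) (auto intro!: nn_integral_cong_AE elim!: eventually_mono split: split_indicator)
  then show "emeasure (stable_levy_measure \<alpha> k) {z<..} = ennreal (snd k / \<alpha> * z powr - \<alpha>)"
    using stable_tail_ge[OF assms(1,3,4)] by simp
  have "emeasure (stable_levy_measure \<alpha> k) {..-z} = (\<integral>\<^sup>+ x. ennreal (fst k / \<bar>x\<bar> powr (\<alpha> + 1)) * indicator {..-z} x \<partial>lborel)"
    unfolding stable_levy_measure_def using assms(4)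
    by (subst emeasure_density) (auto intro!: nn_integral_cong split: split_indicator)
  also have "\<dots> = (\<integral>\<^sup>+ x. ennreal (fst k / x powr (\<alpha> + 1)) * indicator {z..} x \<partial>lborel)"
    using nn_integral_real_affine[of "\<lambda>x. ennreal (fst k / \<bar>x\<bar> powr (\<alpha> + 1)) * indicator {..-z} x" "-1" 0] assms(4)
    by (auto intro!: nn_integral_cong split: split_indicator)
  finally show "emeasure (stable_levy_measure \<alpha> k) {..-z} = ennreal (fst k / \<alpha> * z powr - \<alpha>)"
    using stable_tail_ge[OF assms(1,2,4)] by simp
qed

lemma c11_remainder:
  fixes x :: real
  assumes "c11 L1 L2 f f'"
  defines "g \<equiv> \<lambda>z. f' (x + z) - f' x"
  shows "((\<lambda>z. f (x + z) - f x - f' x * z) has_real_derivative g z) (at z)" "continuous_on UNIV g"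
    "\<bar>g z\<bar> \<le> L2 * \<bar>z\<bar>" "\<bar>g z\<bar> \<le> 2 * L1"
proof -
  have d: "(f has_real_derivative f' y) (at y)" for y using assms(1) by (simp add: c11_def)
  have l: "lip L2 f'" using assms(1) by (simp add: c11_def)
  have b: "\<bar>f' y\<bar> \<le> L1" for y using assms(1) by (simp add: c11_def)
  have "((\<lambda>z. f (x + z)) has_real_derivative f' (x + z)) (at z)"
    using DERIV_shift[of f "f' (x + z)" z x] d[of "x + z"] by (simp add: add.commute)
  then show "((\<lambda>z. f (x + z) - f x - f' x * z) has_real_derivative g z) (at z)"
    unfolding g_def by (auto intro!: derivative_eq_intros)
  have "continuous_on UNIV f'" using l by (rule lip_continuous)
  then have "continuous_on UNIV (\<lambda>z. f' (x + z))"
    by (rule continuous_on_compose2) (auto intro: continuous_intros)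
  then show "continuous_on UNIV g" unfolding g_def by (intro continuous_on_diff continuous_on_const)
  show "\<bar>g z\<bar> \<le> L2 * \<bar>z\<bar>" using lipD[OF l, of "x + z" x] by (simp add: g_def)
  show "\<bar>g z\<bar> \<le> 2 * L1" using b[of "x + z"] b[of x] by (simp add: g_def)
qed

text \<open>The layer cake formula sees the measure only through its tails, so the Levy measure,
  infinite near 0, and the scaled law of one step are treated by the same lemma. It sees the
  remainder only through its derivative \<open>g\<close>, bounded by
  \<open>L2 * \<bar>z\<bar>\<close> and by \<open>2 * L1\<close>; hence the pairing with
  \<open>J1\<close> and \<open>J2\<close>.\<close>

lemma c11_remainder_integral:
  fixes \<mu> :: "real measure" and x :: real
  assumes c: "c11 L1 L2 f f'" and \<mu>: "sigma_finite_measure \<mu>" "sets \<mu> = sets borel"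
    and T1: "\<And>z. 0 < z \<Longrightarrow> emeasure \<mu> {..-z} = ennreal (T1 z)" "\<And>z. 0 < z \<Longrightarrow> 0 \<le> T1 z"
    and T2: "\<And>z. 0 < z \<Longrightarrow> emeasure \<mu> {z<..} = ennreal (T2 z)" "\<And>z. 0 < z \<Longrightarrow> 0 \<le> T2 z"
    and w: "wint T1" "wint T2"
  defines "G \<equiv> \<lambda>z. f (x + z) - f x - f' x * z"
  defines "g \<equiv> \<lambda>z. f' (x + z) - f' x"
  shows "integrable \<mu> G"
    "(\<integral>z. G z \<partial>\<mu>) = (LBINT z:{0<..}. g z * T2 z) - (LBINT z:{0<..}. g (- z) * T1 z)"
    "\<bar>\<integral>z. G z \<partial>\<mu>\<bar> \<le> L2 * (J1 T1 + J1 T2) + 2 * L1 * (J2 T1 + J2 T2)"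
proof -
  have r: "(G has_real_derivative g z) (at z)" "continuous_on UNIV g" "\<bar>g z\<bar> \<le> L2 * \<bar>z\<bar>" "\<bar>g z\<bar> \<le> 2 * L1" for z
    unfolding G_def g_def using c11_remainder[OF c, of x] by blast+
  have [measurable]: "g \<in> borel_measurable borel" using r(2) by (rule borel_measurable_continuous_onI)
  note b2 = wint_bound[OF w(2), of g L2 "2 * L1"]
  note b1 = wint_bound[OF w(1), of "\<lambda>z. g (- z)" L2 "2 * L1"]
  have g: "\<bar>g z\<bar> \<le> L2 * z" "\<bar>g z\<bar> \<le> 2 * L1" "\<bar>g (-z)\<bar> \<le> L2 * z" "\<bar>g (-z)\<bar> \<le> 2 * L1" if "0 < z" for z
    using r(3)[of z] r(3)[of "-z"] r(4)[of z] r(4)[of "-z"] that by auto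
  have i: "set_integrable lborel {0<..} (\<lambda>z. g z * T2 z)" "set_integrable lborel {0<..} (\<lambda>z. g (-z) * T1 z)"
    using b1 b2 g by auto
  have bd: "\<bar>LBINT z:{0<..}. g z * T2 z\<bar> \<le> L2 * J1 T2 + 2 * L1 * J2 T2"
    "\<bar>LBINT z:{0<..}. g (-z) * T1 z\<bar> \<le> L2 * J1 T1 + 2 * L1 * J2 T1"
    using b1 b2 g by auto
  have G0: "G 0 = 0" by (simp add: G_def)
  note lc = layer_cake_two_sided[OF \<mu> r(1,2) G0 T1 T2 i(2,1)]
  show "integrable \<mu> G" by (rule lc(1))
  show eq: "(\<integral>z. G z \<partial>\<mu>) = (LBINT z:{0<..}. g z * T2 z) - (LBINT z:{0<..}. g (- z) * T1 z)"
    by (rule lc(2))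
  show "\<bar>\<integral>z. G z \<partial>\<mu>\<bar> \<le> L2 * (J1 T1 + J1 T2) + 2 * L1 * (J2 T1 + J2 T2)"
    unfolding eq using bd by (simp add: algebra_simps)
qed

lemma nn_integral_lborel_uminus:
  fixes f :: "real \<Rightarrow> ennreal"
  assumes "f \<in> borel_measurable borel"
  shows "(\<integral>\<^sup>+ x. f x \<partial>lborel) = (\<integral>\<^sup>+ x. f (- x) \<partial>lborel)"
proof -
  have "(\<integral>\<^sup>+ x. f x \<partial>lborel) = ennreal \<bar>-1\<bar> * (\<integral>\<^sup>+ x. f (0 + -1 * x) \<partial>lborel)"
    by (rule nn_integral_real_affine[OF assms]) simp
  also have "\<dots> = (\<integral>\<^sup>+ x. f (- x) \<partial>lborel)" by simp
  finally show ?thesis .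
qed

section \<open>Tails of the scaled laws and consistency of one step\<close>

locale stable_scheme =
  fixes \<alpha> \<Lambda> q C :: real and K :: "real set" and W :: "real \<times> real \<Rightarrow> real measure"
    and \<beta>1 \<beta>2 :: "real \<times> real \<Rightarrow> real \<Rightarrow> real"
  assumes alpha: "1 < \<alpha>" "\<alpha> < 2"
    and K: "\<And>k. k \<in> K \<Longrightarrow> 0 < k" "\<And>k. k \<in> K \<Longrightarrow> k < \<Lambda>" "K \<noteq> {}"
    and xi: "xi_laws \<alpha> K W \<beta>1 \<beta>2" and A1: "assumption_A1 K W \<beta>1 \<beta>2"
    and q: "0 < q" and C: "0 < C" and A3: "assumption_A3 \<alpha> K \<beta>1 \<beta>2 q C"
begin

lemma K_bounds: assumes "k \<in> K \<times> K" shows "0 < fst k" "fst k < \<Lambda>" "0 < snd k" "snd k < \<Lambda>"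
  using assms K by auto

lemma W_dist: "k \<in> K \<times> K \<Longrightarrow> real_distribution (W k)"
  using xi by (auto simp: xi_laws_def)

lemma W_int: "k \<in> K \<times> K \<Longrightarrow> integrable (W k) (\<lambda>z. z)" and W_mean: "k \<in> K \<times> K \<Longrightarrow> (\<integral>z. z \<partial>W k) = 0"
  using A1 by (auto simp: assumption_A1_def)

text \<open>The perturbation of the stable tails after scaling the law by \<open>\<tau>^(1/\<alpha>)\<close>.\<close>

definition B1 :: "real \<Rightarrow> real \<times> real \<Rightarrow> real \<Rightarrow> real" where
  "B1 \<tau> k z = \<beta>1 k (- (\<tau> powr (- 1 / \<alpha>) * z)) * z powr - \<alpha>"
definition B2 :: "real \<Rightarrow> real \<times> real \<Rightarrow> real \<Rightarrow> real" where
  "B2 \<tau> k z = \<beta>2 k (\<tau> powr (- 1 / \<alpha>) * z) * z powr - \<alpha>"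

lemma beta_cont: assumes "k \<in> K \<times> K"
  shows "continuous_on {..0} (\<beta>1 k)" "continuous_on {0..} (\<beta>2 k)"
proof -
  have "C1_on {..0} (\<beta>1 k)" "C1_on {0..} (\<beta>2 k)" using A1 assms by (auto simp: assumption_A1_def)
  then show "continuous_on {..0} (\<beta>1 k)" "continuous_on {0..} (\<beta>2 k)"
    unfolding C1_on_def by (meson DERIV_continuous_on)+
qed

text \<open>The continuity of \<open>\<beta>1 k\<close> and \<open>\<beta>2 k\<close> is known on
  one half line each, which is why measurability is claimed on \<open>{0<..}\<close> only and
  \<open>wint\<close> is phrased with \<open>set_borel_measurable\<close>.\<close>

lemma B_measurable: assumes "k \<in> K \<times> K"
  shows "set_borel_measurable borel {0<..} (B1 \<tau> k)" "set_borel_measurable borel {0<..} (B2 \<tau> k)"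
proof -
  have "continuous_on {0<..} (\<lambda>z. \<beta>1 k (- (\<tau> powr (- 1 / \<alpha>) * z)) * z powr - \<alpha>)"
    by (intro continuous_intros continuous_on_compose2[OF beta_cont(1)[OF assms]]) auto
  then show "set_borel_measurable borel {0<..} (B1 \<tau> k)" unfolding B1_def[abs_def] set_borel_measurable_def
    by (rule borel_measurable_continuous_on_indicator[rotated]) auto
  have "continuous_on {0<..} (\<lambda>z. \<beta>2 k ((\<tau> powr (- 1 / \<alpha>) * z)) * z powr - \<alpha>)"
    by (intro continuous_intros continuous_on_compose2[OF beta_cont(2)[OF assms]]) auto
  then show "set_borel_measurable borel {0<..} (B2 \<tau> k)" unfolding B2_def[abs_def] set_borel_measurable_def
    by (rule borel_measurable_continuous_on_indicator[rotated]) auto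
qed

lemma wintI:
  assumes m: "set_borel_measurable borel {0<..} p" and b: "0 < b"
    and "(\<integral>\<^sup>+ z\<in>{0..1}. ennreal (z * \<bar>p z\<bar>) \<partial>lborel) < ennreal b"
    and "(\<integral>\<^sup>+ z\<in>{1..}. ennreal \<bar>p z\<bar> \<partial>lborel) < ennreal b"
  shows "wint p" "J1 p \<le> b" "J2 p \<le> b"
proof -
  note m1 = wint_measurable(1)[OF m] and m2 = wint_measurable(2)[OF m]
  have n1: "(\<integral>\<^sup>+ z. ennreal (indicator {0<..1} z *\<^sub>R (z * \<bar>p z\<bar>)) \<partial>lborel) \<le> ennreal b"
    by (rule order_trans[OF nn_integral_mono less_imp_le[OF assms(3)]]) (auto split: split_indicator)
  have n2: "(\<integral>\<^sup>+ z. ennreal (indicator {1<..} z *\<^sub>R \<bar>p z\<bar>) \<partial>lborel) \<le> ennreal b"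
    by (rule order_trans[OF nn_integral_mono less_imp_le[OF assms(4)]]) (auto split: split_indicator)
  have i1: "set_integrable lborel {0<..1} (\<lambda>z. z * \<bar>p z\<bar>)" unfolding set_integrable_def
    by (rule integrableI_nonneg[OF m1])
       (use n1 in \<open>auto intro!: AE_I2 le_less_trans[OF n1[simplified]] split: split_indicator\<close>)
  have i2: "set_integrable lborel {1<..} (\<lambda>z. \<bar>p z\<bar>)" unfolding set_integrable_def
    by (rule integrableI_nonneg[OF m2])
       (use n2 in \<open>auto intro!: AE_I2 le_less_trans[OF n2[simplified]] split: split_indicator\<close>)
  show "wint p" using m i1 i2 by (simp add: wint_def)
  have "J1 p = enn2real (\<integral>\<^sup>+ z. ennreal (indicator {0<..1} z *\<^sub>R (z * \<bar>p z\<bar>)) \<partial>lborel)"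
    unfolding J1_def set_lebesgue_integral_def
    by (rule integral_eq_nn_integral[OF m1]) (auto intro!: AE_I2 split: split_indicator)
  also have "\<dots> \<le> enn2real (ennreal b)" by (rule enn2real_mono[OF n1]) simp
  finally show "J1 p \<le> b" using b by simp
  have "J2 p = enn2real (\<integral>\<^sup>+ z. ennreal (indicator {1<..} z *\<^sub>R \<bar>p z\<bar>) \<partial>lborel)"
    unfolding J2_def set_lebesgue_integral_def
    by (rule integral_eq_nn_integral[OF m2]) (auto intro!: AE_I2 split: split_indicator)
  also have "\<dots> \<le> enn2real (ennreal b)" by (rule enn2real_mono[OF n2]) simp
  finally show "J2 p \<le> b" using b by simp
qed

text \<open>This is (A3) for the step \<tau>, carried over to the positive half line: the integrals
  of \<open>\<beta>1\<close> by reflection, and the weights by z z^-\<alpha> =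
  z^(1-\<alpha>).\<close>

lemma B_small: assumes "k \<in> K \<times> K" "0 < \<tau>" "\<tau> < 1"
  shows "(\<integral>\<^sup>+ z\<in>{0..1}. ennreal (z * \<bar>B1 \<tau> k z\<bar>) \<partial>lborel) < ennreal (C * \<tau> powr q)"
    "(\<integral>\<^sup>+ z\<in>{1..}. ennreal (\<bar>B1 \<tau> k z\<bar>) \<partial>lborel) < ennreal (C * \<tau> powr q)"
    "(\<integral>\<^sup>+ z\<in>{0..1}. ennreal (z * \<bar>B2 \<tau> k z\<bar>) \<partial>lborel) < ennreal (C * \<tau> powr q)"
    "(\<integral>\<^sup>+ z\<in>{1..}. ennreal (\<bar>B2 \<tau> k z\<bar>) \<partial>lborel) < ennreal (C * \<tau> powr q)"
    "\<bar>\<beta>1 k (- (\<tau> powr (- 1 / \<alpha>)))\<bar> < C * \<tau> powr q" "\<bar>\<beta>2 k (\<tau> powr (- 1 / \<alpha>))\<bar> < C * \<tau> powr q"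
proof -
  define r where "r = \<tau> powr (- 1 / \<alpha>)"
  have t: "\<tau> \<in> {0<..<1}" using assms by simp
  note A = A3[unfolded assumption_A3_def Let_def, rule_format, OF assms(1) t, folded r_def]
  show "\<bar>\<beta>1 k (- (\<tau> powr (- 1 / \<alpha>)))\<bar> < C * \<tau> powr q" "\<bar>\<beta>2 k (\<tau> powr (- 1 / \<alpha>))\<bar> < C * \<tau> powr q"
    using A by (auto simp: r_def)
  have p: "z * z powr - \<alpha> = z powr (1 - \<alpha>)" if "0 \<le> z" for z
    using powr_mult_base[OF that, of "- \<alpha>"] by simp
  have z1: "z * \<bar>x * z powr - \<alpha>\<bar> = \<bar>x\<bar> * z powr (1 - \<alpha>)" if "0 \<le> z" for x z :: real
    unfolding p[OF that, symmetric] by (simp add: abs_mult)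
  show "(\<integral>\<^sup>+ z\<in>{0..1}. ennreal (z * \<bar>B2 \<tau> k z\<bar>) \<partial>lborel) < ennreal (C * \<tau> powr q)"
  proof -
    have "(\<integral>\<^sup>+ z\<in>{0..1}. ennreal (z * \<bar>B2 \<tau> k z\<bar>) \<partial>lborel) = (\<integral>\<^sup>+ z\<in>{0..1}. ennreal (\<bar>\<beta>2 k (r * z)\<bar> * z powr (1 - \<alpha>)) \<partial>lborel)"
      by (intro nn_integral_cong) (auto simp: B2_def r_def z1 split: split_indicator)
    then show ?thesis using A by simp
  qed
  show "(\<integral>\<^sup>+ z\<in>{1..}. ennreal (\<bar>B2 \<tau> k z\<bar>) \<partial>lborel) < ennreal (C * \<tau> powr q)"
  proof -
    have "(\<integral>\<^sup>+ z\<in>{1..}. ennreal (\<bar>B2 \<tau> k z\<bar>) \<partial>lborel) = (\<integral>\<^sup>+ z\<in>{1..}. ennreal (\<bar>\<beta>2 k (r * z)\<bar> * z powr (- \<alpha>)) \<partial>lborel)"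
      by (intro nn_integral_cong) (auto simp: B2_def r_def abs_mult split: split_indicator)
    then show ?thesis using A by simp
  qed
  \<comment> \<open>Reflecting the integral requires a function measurable on the whole line, so
    \<open>\<beta>1 k\<close> is first cut off to the half line where it is continuous.\<close>
  have m: "(\<lambda>z. ennreal (\<bar>\<beta>1 k (r * z)\<bar> * \<bar>z\<bar> powr a) * indicator A z) \<in> borel_measurable borel" if A: "A \<in> sets borel" "A \<subseteq> {..0}" for a A
  proof -
    have "continuous_on {..0} (\<lambda>z. \<beta>1 k (r * z))"
      by (intro continuous_intros continuous_on_compose2[OF beta_cont(1)[OF assms(1)]]) (auto simp: r_def mult_nonneg_nonpos)
    then have [measurable]: "(\<lambda>z. indicator {..0} z *\<^sub>R \<beta>1 k (r * z)) \<in> borel_measurable borel"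
      by (rule borel_measurable_continuous_on_indicator[rotated]) auto
    have "(\<lambda>z. ennreal (\<bar>indicator {..0} z *\<^sub>R \<beta>1 k (r * z)\<bar> * \<bar>z\<bar> powr a) * indicator A z) \<in> borel_measurable borel"
      using A(1) by measurable
    also have "(\<lambda>z. ennreal (\<bar>indicator {..0} z *\<^sub>R \<beta>1 k (r * z)\<bar> * \<bar>z\<bar> powr a) * indicator A z) = (\<lambda>z. ennreal (\<bar>\<beta>1 k (r * z)\<bar> * \<bar>z\<bar> powr a) * indicator A z)"
    proof (rule ext)
      show "ennreal (\<bar>indicator {..0} z *\<^sub>R \<beta>1 k (r * z)\<bar> * \<bar>z\<bar> powr a) * indicator A z = ennreal (\<bar>\<beta>1 k (r * z)\<bar> * \<bar>z\<bar> powr a) * indicator A z" for z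
        using A(2) by (cases "z \<in> A") auto
    qed
    finally show ?thesis .
  qed
  show "(\<integral>\<^sup>+ z\<in>{0..1}. ennreal (z * \<bar>B1 \<tau> k z\<bar>) \<partial>lborel) < ennreal (C * \<tau> powr q)"
  proof -
    have "(\<integral>\<^sup>+ z\<in>{-1..0}. ennreal (\<bar>\<beta>1 k (r * z)\<bar> * \<bar>z\<bar> powr (1 - \<alpha>)) \<partial>lborel) = (\<integral>\<^sup>+ z\<in>{0..1}. ennreal (z * \<bar>B1 \<tau> k z\<bar>) \<partial>lborel)"
      by (subst nn_integral_lborel_uminus, rule m) (auto simp: B1_def r_def z1 intro!: nn_integral_cong split: split_indicator)
    then show ?thesis using A by simp
  qed
  show "(\<integral>\<^sup>+ z\<in>{1..}. ennreal (\<bar>B1 \<tau> k z\<bar>) \<partial>lborel) < ennreal (C * \<tau> powr q)"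
  proof -
    have "(\<integral>\<^sup>+ z\<in>{..-1}. ennreal (\<bar>\<beta>1 k (r * z)\<bar> * \<bar>z\<bar> powr (- \<alpha>)) \<partial>lborel) = (\<integral>\<^sup>+ z\<in>{1..}. ennreal (\<bar>B1 \<tau> k z\<bar>) \<partial>lborel)"
      by (subst nn_integral_lborel_uminus, rule m) (auto simp: B1_def r_def abs_mult intro!: nn_integral_cong split: split_indicator)
    then show ?thesis using A by simp
  qed
qed

lemma B_wint: assumes "k \<in> K \<times> K" "0 < \<tau>" "\<tau> < 1"
  shows "wint (B1 \<tau> k)" "J1 (B1 \<tau> k) \<le> C * \<tau> powr q" "J2 (B1 \<tau> k) \<le> C * \<tau> powr q"
    "wint (B2 \<tau> k)" "J1 (B2 \<tau> k) \<le> C * \<tau> powr q" "J2 (B2 \<tau> k) \<le> C * \<tau> powr q"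
  using wintI[OF B_measurable(1)[OF assms(1)] _ B_small(1,2)[OF assms]] wintI[OF B_measurable(2)[OF assms(1)] _ B_small(3,4)[OF assms]] C assms(2)
  by auto

definition E :: "real \<Rightarrow> real \<times> real \<Rightarrow> (real \<Rightarrow> real) \<Rightarrow> real \<Rightarrow> real" where
  "E \<tau> k = sm (W k) (\<tau> powr (1 / \<alpha>))"

text \<open>Each side of the Levy measure has \<open>J1\<close> at most \<Lambda> / (2 - \<alpha>)
  and \<open>J2\<close> at most \<Lambda> / (\<alpha> - 1), as k / \<alpha> \<le> \<Lambda>. There
  are two sides, and \<open>J2\<close> comes with the factor \<open>2 * L1\<close>.\<close>

definition gen_const :: real where "gen_const = 2 * \<Lambda> / (2 - \<alpha>) + 4 * \<Lambda> / (\<alpha> - 1)"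

lemma gen_props:
  assumes c: "c11 L1 L2 f f'" and k: "k \<in> K \<times> K"
  shows "integrable (stable_levy_measure \<alpha> k) (\<lambda>z. f (x + z) - f x - f' x * z)"
    "gen \<alpha> k f f' x = (LBINT z:{0<..}. (f' (x + z) - f' x) * (snd k / \<alpha> * z powr - \<alpha>)) - (LBINT z:{0<..}. (f' (x + - z) - f' x) * (fst k / \<alpha> * z powr - \<alpha>))"
    "\<bar>gen \<alpha> k f f' x\<bar> \<le> gen_const * (L1 + L2)"
proof -
  note kk = K_bounds[OF k]
  have w: "wint (\<lambda>z. c / \<alpha> * z powr - \<alpha>)" "J1 (\<lambda>z. c / \<alpha> * z powr - \<alpha>) \<le> \<Lambda> / (2 - \<alpha>)"
    "J2 (\<lambda>z. c / \<alpha> * z powr - \<alpha>) \<le> \<Lambda> / (\<alpha> - 1)" if "0 < c" "c < \<Lambda>" for c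
  proof -
    have "c * 1 \<le> \<Lambda> * \<alpha>" using that alpha by (intro mult_mono) auto
    then have c: "\<bar>c / \<alpha>\<bar> \<le> \<Lambda>" using that alpha by (simp add: divide_simps)
    show "wint (\<lambda>z. c / \<alpha> * z powr - \<alpha>)" by (rule wint_cmult(1)[OF wint_powr(1)[OF alpha]])
    show "J1 (\<lambda>z. c / \<alpha> * z powr - \<alpha>) \<le> \<Lambda> / (2 - \<alpha>)" "J2 (\<lambda>z. c / \<alpha> * z powr - \<alpha>) \<le> \<Lambda> / (\<alpha> - 1)"
      unfolding wint_cmult(2,3)[OF wint_powr(1)[OF alpha]] wint_powr(2,3)[OF alpha]
      using mult_right_mono[OF c, of "1 / (2 - \<alpha>)"] mult_right_mono[OF c, of "1 / (\<alpha> - 1)"] alpha by simp_all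
  qed
  note R = c11_remainder_integral[OF c sigma_finite_stable_levy[of \<alpha> k] _ stable_tails(2)[OF alpha(1)] _ stable_tails(1)[OF alpha(1)] _ w(1)[OF kk(1,2)] w(1)[OF kk(3,4)], of x]
  have s: "sets (stable_levy_measure \<alpha> k) = sets borel" by (simp add: stable_levy_measure_def)
  have nn: "0 \<le> fst k" "0 \<le> snd k" "\<And>z. 0 < z \<Longrightarrow> 0 \<le> fst k / \<alpha> * z powr - \<alpha>" "\<And>z. 0 < z \<Longrightarrow> 0 \<le> snd k / \<alpha> * z powr - \<alpha>"
    using kk alpha by auto
  show "integrable (stable_levy_measure \<alpha> k) (\<lambda>z. f (x + z) - f x - f' x * z)"
    using R(1) s nn by blast
  show "gen \<alpha> k f f' x = (LBINT z:{0<..}. (f' (x + z) - f' x) * (snd k / \<alpha> * z powr - \<alpha>)) - (LBINT z:{0<..}. (f' (x + - z) - f' x) * (fst k / \<alpha> * z powr - \<alpha>))"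
    unfolding gen_def using R(2) s nn by blast
  have L: "0 \<le> L1" "0 \<le> L2" using c lip_nonneg c11_lip[OF c] by (auto simp: c11_def)
  have "\<bar>gen \<alpha> k f f' x\<bar> \<le> L2 * (J1 (\<lambda>z. fst k / \<alpha> * z powr - \<alpha>) + J1 (\<lambda>z. snd k / \<alpha> * z powr - \<alpha>)) + 2 * L1 * (J2 (\<lambda>z. fst k / \<alpha> * z powr - \<alpha>) + J2 (\<lambda>z. snd k / \<alpha> * z powr - \<alpha>))"
    unfolding gen_def using R(3) s nn by blast
  also have "\<dots> \<le> L2 * (\<Lambda> / (2 - \<alpha>) + \<Lambda> / (2 - \<alpha>)) + 2 * L1 * (\<Lambda> / (\<alpha> - 1) + \<Lambda> / (\<alpha> - 1))"
    using w[OF kk(1,2)] w[OF kk(3,4)] L by (intro add_mono mult_left_mono) auto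
  also have "\<dots> = L2 * (2 * \<Lambda> / (2 - \<alpha>)) + L1 * (4 * \<Lambda> / (\<alpha> - 1))" by simp
  also have "\<dots> \<le> gen_const * (L1 + L2)"
  proof -
    have "L2 * a + L1 * b \<le> (a + b) * (L1 + L2)" if "0 \<le> a" "0 \<le> b" for a b
      using that L by (simp add: algebra_simps)
    moreover have "0 \<le> 2 * \<Lambda> / (2 - \<alpha>)" "0 \<le> 4 * \<Lambda> / (\<alpha> - 1)" using kk alpha by auto
    ultimately show ?thesis unfolding gen_const_def by blast
  qed
  finally show "\<bar>gen \<alpha> k f f' x\<bar> \<le> gen_const * (L1 + L2)" .
qed

text \<open>Stable scaling: with \<open>d = \<tau> powr (1 / \<alpha>)\<close> one has
  (z/d)^-\<alpha> = \<tau> z^-\<alpha>. The tails are therefore exactly \<tau> times the Levy tail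
  plus \<tau> times the perturbation, so that a step of the scheme is an Euler step of size \<tau>
  for the generator.\<close>

lemma scaled_tails:
  assumes k: "k \<in> K \<times> K" and t: "0 < \<tau>" "\<tau> < 1" and z: "0 < z"
  shows "emeasure (distr (W k) borel (\<lambda>w. \<tau> powr (1 / \<alpha>) * w)) {..-z} = ennreal (\<tau> * (fst k / \<alpha> * z powr - \<alpha> + B1 \<tau> k z))"
    "0 \<le> \<tau> * (fst k / \<alpha> * z powr - \<alpha> + B1 \<tau> k z)"
    "emeasure (distr (W k) borel (\<lambda>w. \<tau> powr (1 / \<alpha>) * w)) {z<..} = ennreal (\<tau> * (snd k / \<alpha> * z powr - \<alpha> + B2 \<tau> k z))"
    "0 \<le> \<tau> * (snd k / \<alpha> * z powr - \<alpha> + B2 \<tau> k z)"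
proof -
  interpret W: real_distribution "W k" using W_dist[OF k] .
  define d where "d = \<tau> powr (1 / \<alpha>)"
  define r where "r = \<tau> powr (- 1 / \<alpha>)"
  have d: "0 < d" using t by (simp add: d_def)
  have rd: "r * z = z / d" by (simp add: r_def d_def powr_minus divide_inverse)
  have dp: "(z / d) powr - \<alpha> = \<tau> * z powr - \<alpha>"
  proof -
    have "d powr \<alpha> = \<tau>" using t alpha by (simp add: d_def powr_powr)
    then show ?thesis using d z t by (simp add: powr_divide powr_minus divide_simps)
  qed
  have zd: "0 < z / d" using z d by simp
  have c1: "cdf (W k) (- (z / d)) = \<tau> * (fst k / \<alpha> * z powr - \<alpha> + B1 \<tau> k z)"
  proof -
    have "\<forall>z<0. cdf (W k) z = (fst k / \<alpha> + \<beta>1 k z) * \<bar>z\<bar> powr - \<alpha>"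
      using xi k unfolding xi_laws_def by blast
    then have "cdf (W k) (- (z / d)) = (fst k / \<alpha> + \<beta>1 k (- (z / d))) * \<bar>- (z / d)\<bar> powr - \<alpha>"
      using zd by (metis neg_less_0_iff_less)
    then show ?thesis unfolding B1_def r_def[symmetric] rd abs_minus_cancel abs_of_pos[OF zd] dp
      by (simp add: algebra_simps)
  qed
  have c2: "1 - cdf (W k) (z / d) = \<tau> * (snd k / \<alpha> * z powr - \<alpha> + B2 \<tau> k z)"
  proof -
    have "cdf (W k) (z / d) = 1 - (snd k / \<alpha> + \<beta>2 k (z / d)) * (z / d) powr - \<alpha>"
      using xi k zd by (auto simp: xi_laws_def)
    then show ?thesis unfolding B2_def r_def[symmetric] rd by (simp add: dp algebra_simps)
  qed
  have "emeasure (distr (W k) borel (\<lambda>w. d * w)) {..-z} = emeasure (W k) ((\<lambda>w. d * w) -` {..-z} \<inter> space (W k))"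
    by (rule emeasure_distr) auto
  also have "(\<lambda>w. d * w) -` {..-z} \<inter> space (W k) = {..- (z / d)}"
    using d by (auto simp: field_simps)
  also have "emeasure (W k) {..- (z / d)} = ennreal (cdf (W k) (- (z / d)))"
    by (simp add: cdf_def W.emeasure_eq_measure)
  finally show "emeasure (distr (W k) borel (\<lambda>w. \<tau> powr (1 / \<alpha>) * w)) {..-z} = ennreal (\<tau> * (fst k / \<alpha> * z powr - \<alpha> + B1 \<tau> k z))"
    unfolding c1 unfolding d_def .
  show "0 \<le> \<tau> * (fst k / \<alpha> * z powr - \<alpha> + B1 \<tau> k z)" using c1 W.cdf_nonneg[of "- (z / d)"] by simp
  have "emeasure (distr (W k) borel (\<lambda>w. d * w)) {z<..} = emeasure (W k) ((\<lambda>w. d * w) -` {z<..} \<inter> space (W k))"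
    by (rule emeasure_distr) auto
  also have "(\<lambda>w. d * w) -` {z<..} \<inter> space (W k) = space (W k) - {..z / d}"
    using d by (auto simp: field_simps)
  also have "emeasure (W k) (space (W k) - {..z / d}) = ennreal (1 - cdf (W k) (z / d))"
    using W.prob_compl[of "{..z / d}"] by (simp add: cdf_def W.emeasure_eq_measure)
  finally show "emeasure (distr (W k) borel (\<lambda>w. \<tau> powr (1 / \<alpha>) * w)) {z<..} = ennreal (\<tau> * (snd k / \<alpha> * z powr - \<alpha> + B2 \<tau> k z))"
    unfolding c2 unfolding d_def .
  show "0 \<le> \<tau> * (snd k / \<alpha> * z powr - \<alpha> + B2 \<tau> k z)" using c2 W.cdf_bounded_prob[of "z / d"] by simp
qed

text \<open>Bounds for \<open>I1\<close> and \<open>I2\<close> that hold for every step size, as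
  required when the step tends to 0. In \<open>IB1\<close>, 4 C stems from the doubled integrals and
  2 C from the endpoint values; in \<open>IB2\<close> both contribute 2 C.\<close>

definition IB1 :: real where "IB1 = 2 * \<Lambda> / (2 - \<alpha>) + 6 * C"
definition IB2 :: real where "IB2 = 2 * \<Lambda> / (\<alpha> - 1) + 4 * C"

abbreviation "I1 \<tau> \<equiv> I1_Delta \<alpha> K \<beta>1 \<beta>2 \<tau>"
abbreviation "I2 \<tau> \<equiv> I2_Delta \<alpha> K \<beta>1 \<beta>2 \<tau>"

lemma tau_q: assumes "0 < \<tau>" "\<tau> < 1" shows "C * \<tau> powr q \<le> C" "0 < C * \<tau> powr q"
  using assms C q powr_le1[of q \<tau>] by (auto simp: mult_left_le)

text \<open>After substitution the integrals in \<open>I1_Delta\<close> and \<open>I2_Delta\<close>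
  are \<open>J1\<close> and \<open>J2\<close> of the perturbations. The suprema are real, so a bound
  uniform in \<open>k\<close> must come first; only then does each member lie below its
  supremum.\<close>

lemma I_bounds:
  assumes t: "0 < \<tau>" "\<tau> < 1"
  shows "I1 \<tau> \<le> IB1" "I2 \<tau> \<le> IB2" "0 < I1 \<tau>" "0 < I2 \<tau>"
    "k \<in> K \<times> K \<Longrightarrow> (fst k + snd k) / (2 - \<alpha>) + J1 (B1 \<tau> k) + J1 (B2 \<tau> k) \<le> I1 \<tau>"
    "k \<in> K \<times> K \<Longrightarrow> (fst k + snd k) / (\<alpha> - 1) + J2 (B1 \<tau> k) + J2 (B2 \<tau> k) \<le> I2 \<tau>"
proof -
  define r where "r = \<tau> powr (- 1 / \<alpha>)"
  define j1 where "j1 k = (LBINT z:{0..1}. (\<bar>\<beta>1 k (- r * z)\<bar> + \<bar>\<beta>2 k (r * z)\<bar>) / z powr (\<alpha> - 1))" for k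
  define j2 where "j2 k = (LBINT z:{1..}. (\<bar>\<beta>1 k (- r * z)\<bar> + \<bar>\<beta>2 k (r * z)\<bar>) / z powr \<alpha>)" for k
  define b where "b k = \<bar>\<beta>1 k (- r)\<bar> + \<bar>\<beta>2 k r\<bar>" for k
  have I1: "I1 \<tau> = (SUP k\<in>K \<times> K. (fst k + snd k) / (2 - \<alpha>) + 2 * j1 k + b k)"
    unfolding I1_Delta_def Let_def r_def[symmetric] j1_def b_def by (simp add: add.assoc)
  have I2: "I2 \<tau> = (SUP k\<in>K \<times> K. (fst k + snd k) / (\<alpha> - 1) + j2 k + b k)"
    unfolding I2_Delta_def Let_def r_def[symmetric] j2_def b_def by (simp add: add.assoc)
  have j: "j1 k = J1 (B1 \<tau> k) + J1 (B2 \<tau> k)" "j2 k = J2 (B1 \<tau> k) + J2 (B2 \<tau> k)" if k: "k \<in> K \<times> K" for k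
  proof -
    note B = B_wint[OF k t, unfolded wint_def]
    have e1: "(\<bar>\<beta>1 k (- r * z)\<bar> + \<bar>\<beta>2 k (r * z)\<bar>) / z powr (\<alpha> - 1) = z * \<bar>B1 \<tau> k z\<bar> + z * \<bar>B2 \<tau> k z\<bar>" if "0 \<le> z" for z
    \<comment> \<open>At 0 the left side is a division by \<open>0 powr (\<alpha> - 1) = 0\<close>,
      hence 0 by convention, like the right side.\<close>
    proof (cases "z = 0")
      case False
      have w: "inverse (z powr (\<alpha> - 1)) = z * z powr - \<alpha>"
        using that by (simp add: powr_minus[symmetric] powr_mult_base)
      show ?thesis unfolding divide_inverse[of _ "z powr (\<alpha> - 1)"] w B1_def B2_def r_def[symmetric]
        by (simp add: abs_mult algebra_simps)
    qed simp
    have e2: "(\<bar>\<beta>1 k (- r * z)\<bar> + \<bar>\<beta>2 k (r * z)\<bar>) / z powr \<alpha> = \<bar>B1 \<tau> k z\<bar> + \<bar>B2 \<tau> k z\<bar>" for z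
      unfolding B1_def B2_def r_def[symmetric] by (simp add: abs_mult powr_minus divide_simps algebra_simps)
    have "j1 k = (LBINT z:{0<..1}. z * \<bar>B1 \<tau> k z\<bar> + z * \<bar>B2 \<tau> k z\<bar>)"
      unfolding j1_def set_lebesgue_integral_def
      by (intro Bochner_Integration.integral_cong refl) (use e1 in \<open>auto split: split_indicator\<close>)
    also have "\<dots> = J1 (B1 \<tau> k) + J1 (B2 \<tau> k)" unfolding J1_def using B by (intro set_integral_add) auto
    finally show "j1 k = J1 (B1 \<tau> k) + J1 (B2 \<tau> k)" .
    have i: "set_integrable lborel {1<..} (\<lambda>z. \<bar>B1 \<tau> k z\<bar> + \<bar>B2 \<tau> k z\<bar>)" using B by (intro set_integral_add) auto
    have ae: "AE z in lborel. z \<noteq> (1::real)" by (rule AE_lborel_singleton)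
    have m: "(\<lambda>z. indicator {1..} z *\<^sub>R (\<bar>B1 \<tau> k z\<bar> + \<bar>B2 \<tau> k z\<bar>)) \<in> borel_measurable lborel"
    proof -
      have [measurable]: "(\<lambda>z. indicator {0<..} z *\<^sub>R B1 \<tau> k z) \<in> borel_measurable borel" "(\<lambda>z. indicator {0<..} z *\<^sub>R B2 \<tau> k z) \<in> borel_measurable borel"
        using B by (auto simp: set_borel_measurable_def)
      have "(\<lambda>z. indicator {1..} z *\<^sub>R (\<bar>indicator {0<..} z *\<^sub>R B1 \<tau> k z\<bar> + \<bar>indicator {0<..} z *\<^sub>R B2 \<tau> k z\<bar>)) \<in> borel_measurable lborel"
        by measurable
      also have "(\<lambda>z. indicator {1..} z *\<^sub>R (\<bar>indicator {0<..} z *\<^sub>R B1 \<tau> k z\<bar> + \<bar>indicator {0<..} z *\<^sub>R B2 \<tau> k z\<bar>)) = (\<lambda>z. indicator {1..} z *\<^sub>R (\<bar>B1 \<tau> k z\<bar> + \<bar>B2 \<tau> k z\<bar>))"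
        by (auto split: split_indicator)
      finally show ?thesis .
    qed
    have "j2 k = (LBINT z:{1<..}. \<bar>B1 \<tau> k z\<bar> + \<bar>B2 \<tau> k z\<bar>)"
      unfolding j2_def e2 set_lebesgue_integral_def
    proof (rule integral_cong_AE[OF m])
      show "AE z in lborel. indicator {1..} z *\<^sub>R (\<bar>B1 \<tau> k z\<bar> + \<bar>B2 \<tau> k z\<bar>) = indicator {1<..} z *\<^sub>R (\<bar>B1 \<tau> k z\<bar> + \<bar>B2 \<tau> k z\<bar>)"
        using ae by eventually_elim (auto split: split_indicator)
    qed (use i in \<open>auto simp: set_integrable_def\<close>)
    also have "\<dots> = J2 (B1 \<tau> k) + J2 (B2 \<tau> k)" unfolding J2_def using B by (intro set_integral_add) auto
    finally show "j2 k = J2 (B1 \<tau> k) + J2 (B2 \<tau> k)" .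
  qed
  have J0: "0 \<le> J1 p" "0 \<le> J2 p" for p
    unfolding J1_def J2_def set_lebesgue_integral_def by (intro integral_nonneg_AE AE_I2; auto split: split_indicator)+
  have bb: "0 \<le> b k" "b k \<le> 2 * C" if k: "k \<in> K \<times> K" for k
    using B_small(5,6)[OF k t] tau_q(1)[OF t] by (auto simp: b_def r_def)
  have jj: "0 \<le> j1 k" "j1 k \<le> 2 * C" "0 \<le> j2 k" "j2 k \<le> 2 * C" if k: "k \<in> K \<times> K" for k
    using j[OF k] J0[of "B1 \<tau> k"] J0[of "B2 \<tau> k"] B_wint[OF k t] tau_q(1)[OF t] by auto
  have fr: "0 < (fst k + snd k) / (2 - \<alpha>)" "(fst k + snd k) / (2 - \<alpha>) \<le> 2 * \<Lambda> / (2 - \<alpha>)"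
    "0 < (fst k + snd k) / (\<alpha> - 1)" "(fst k + snd k) / (\<alpha> - 1) \<le> 2 * \<Lambda> / (\<alpha> - 1)" if k: "k \<in> K \<times> K" for k
    using K_bounds[OF k] alpha by (auto intro!: divide_right_mono divide_pos_pos)
  have le1: "(fst k + snd k) / (2 - \<alpha>) + 2 * j1 k + b k \<le> IB1" if "k \<in> K \<times> K" for k
    using bb[OF that] jj[OF that] fr[OF that] by (simp add: IB1_def)
  have le2: "(fst k + snd k) / (\<alpha> - 1) + j2 k + b k \<le> IB2" if "k \<in> K \<times> K" for k
    using bb[OF that] jj[OF that] fr[OF that] by (simp add: IB2_def)
  have ne: "K \<times> K \<noteq> {}" using K by auto
  show "I1 \<tau> \<le> IB1" unfolding I1 by (rule cSUP_least[OF ne le1])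
  show "I2 \<tau> \<le> IB2" unfolding I2 by (rule cSUP_least[OF ne le2])
  have up1: "(fst k + snd k) / (2 - \<alpha>) + 2 * j1 k + b k \<le> I1 \<tau>" if "k \<in> K \<times> K" for k
    unfolding I1 by (rule cSUP_upper[OF that]) (use le1 in \<open>auto intro!: bdd_aboveI2\<close>)
  have up2: "(fst k + snd k) / (\<alpha> - 1) + j2 k + b k \<le> I2 \<tau>" if "k \<in> K \<times> K" for k
    unfolding I2 by (rule cSUP_upper[OF that]) (use le2 in \<open>auto intro!: bdd_aboveI2\<close>)
  obtain k0 where k0: "k0 \<in> K \<times> K" using ne by blast
  show "0 < I1 \<tau>" "0 < I2 \<tau>" using up1[OF k0] up2[OF k0] bb[OF k0] jj[OF k0] fr[OF k0] by linarith+
  show "(fst k + snd k) / (2 - \<alpha>) + J1 (B1 \<tau> k) + J1 (B2 \<tau> k) \<le> I1 \<tau>" if k: "k \<in> K \<times> K" for k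
    using up1[OF k] bb[OF k] jj[OF k] j[OF k] by linarith
  show "(fst k + snd k) / (\<alpha> - 1) + J2 (B1 \<tau> k) + J2 (B2 \<tau> k) \<le> I2 \<tau>" if k: "k \<in> K \<times> K" for k
    using up2[OF k] bb[OF k] jj[OF k] j[OF k] by linarith
qed

text \<open>Since \<open>W k\<close> has mean 0, the linear term can be subtracted at no cost, and
  \<open>E \<tau> k f x - f x\<close> becomes the integral of the same remainder that defines
  \<open>gen\<close>, now against the scaled law. The Levy part of its tails reproduces \<tau> times
  the generator. What remains is the perturbation, contributing \<open>L2 + 2 * L1\<close> times
  \<open>C * \<tau> powr q\<close> on each half line. The second claim estimates both parts together
  and is where \<open>I1\<close> and \<open>I2\<close> arise.\<close>

lemma E_props:
  assumes c: "c11 L1 L2 f f'" and k: "k \<in> K \<times> K" and t: "0 < \<tau>" "\<tau> < 1"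
  shows "\<bar>E \<tau> k f x - f x - \<tau> * gen \<alpha> k f f' x\<bar> \<le> \<tau> * (C * \<tau> powr q * (2 * L2 + 4 * L1))"
    "\<bar>E \<tau> k f x - f x\<bar> \<le> \<tau> * (L2 * I1 \<tau> + 2 * L1 * I2 \<tau>)"
proof -
  interpret W: real_distribution "W k" using W_dist[OF k] .
  define d where "d = \<tau> powr (1 / \<alpha>)"
  define G where "G z = f (x + z) - f x - f' x * z" for z
  define g where "g z = f' (x + z) - f' x" for z
  define T1 where "T1 z = fst k / \<alpha> * z powr - \<alpha>" for z
  define T2 where "T2 z = snd k / \<alpha> * z powr - \<alpha>" for z
  let ?\<mu> = "distr (W k) borel (\<lambda>w. d * w)"
  interpret mu: prob_space ?\<mu> by (rule W.prob_space_distr) simp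
  note B = B_wint[OF k t]
  note wp = wint_powr[OF alpha]
  have wT: "wint T1" "wint T2" "J1 T1 \<le> fst k / (2 - \<alpha>)" "J1 T2 \<le> snd k / (2 - \<alpha>)" "J2 T1 \<le> fst k / (\<alpha> - 1)" "J2 T2 \<le> snd k / (\<alpha> - 1)"
  proof -
    have p: "wint (\<lambda>z. c / \<alpha> * z powr - \<alpha>)" "J1 (\<lambda>z. c / \<alpha> * z powr - \<alpha>) \<le> c / (2 - \<alpha>)" "J2 (\<lambda>z. c / \<alpha> * z powr - \<alpha>) \<le> c / (\<alpha> - 1)" if "0 < c" for c
    proof -
      have "c * 1 \<le> c * \<alpha>" using that alpha by (intro mult_mono) auto
      then have cc: "\<bar>c / \<alpha>\<bar> \<le> c" using that alpha by (simp add: divide_simps)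
      show "wint (\<lambda>z. c / \<alpha> * z powr - \<alpha>)" by (rule wint_cmult(1)[OF wp(1)])
      show "J1 (\<lambda>z. c / \<alpha> * z powr - \<alpha>) \<le> c / (2 - \<alpha>)" "J2 (\<lambda>z. c / \<alpha> * z powr - \<alpha>) \<le> c / (\<alpha> - 1)"
        unfolding wint_cmult(2,3)[OF wp(1)] wp(2,3)
        using mult_right_mono[OF cc, of "1 / (2 - \<alpha>)"] mult_right_mono[OF cc, of "1 / (\<alpha> - 1)"] alpha by simp_all
    qed
    show "wint T1" "wint T2" "J1 T1 \<le> fst k / (2 - \<alpha>)" "J1 T2 \<le> snd k / (2 - \<alpha>)" "J2 T1 \<le> fst k / (\<alpha> - 1)" "J2 T2 \<le> snd k / (\<alpha> - 1)"
      unfolding T1_def[abs_def] T2_def[abs_def] using p K_bounds[OF k] by auto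
  qed
  have L: "0 \<le> L1" "0 \<le> L2" using c lip_nonneg c11_lip[OF c] by (auto simp: c11_def)
  have wTB: "wint (\<lambda>z. \<tau> * (T1 z + B1 \<tau> k z))" "wint (\<lambda>z. \<tau> * (T2 z + B2 \<tau> k z))"
    by (intro wint_cmult wint_add wT B)+
  note r = c11_remainder[OF c, of x, folded g_def G_def]
  have [measurable]: "g \<in> borel_measurable borel" using r(2) by (rule borel_measurable_continuous_onI)
  note st = scaled_tails[OF k t, folded d_def T1_def T2_def]
  have sb: "sets ?\<mu> = sets borel" by simp
  note R = c11_remainder_integral[OF c mu.sigma_finite_measure_axioms sb st(1,2,3,4) wTB, of x, folded g_def G_def]
  have "E \<tau> k f x - f x = (\<integral>w. G (d * w) \<partial>W k)"
  proof -
    have "integrable (W k) (\<lambda>w. f (x + d * w))" by (rule W.lip_integrable[OF c11_lip[OF c] W_int[OF k]])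
    then show ?thesis unfolding G_def E_def sm_def d_def[symmetric]
      using W_int[OF k] W_mean[OF k] W.prob_space by simp
  qed
  also have "\<dots> = (\<integral>z. G z \<partial>?\<mu>)"
  proof (rule integral_distr[symmetric])
    show "G \<in> borel_measurable borel"
      using r(1) by (intro borel_measurable_continuous_onI) (auto intro: DERIV_isCont simp: continuous_on_eq_continuous_at)
  qed simp
  finally have eq: "E \<tau> k f x - f x = (\<integral>z. G z \<partial>?\<mu>)" .
  have "\<bar>E \<tau> k f x - f x\<bar> \<le> L2 * (J1 (\<lambda>z. \<tau> * (T1 z + B1 \<tau> k z)) + J1 (\<lambda>z. \<tau> * (T2 z + B2 \<tau> k z))) + 2 * L1 * (J2 (\<lambda>z. \<tau> * (T1 z + B1 \<tau> k z)) + J2 (\<lambda>z. \<tau> * (T2 z + B2 \<tau> k z)))"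
    unfolding eq by (rule R(3))
  also have "\<dots> \<le> L2 * (\<tau> * I1 \<tau>) + 2 * L1 * (\<tau> * I2 \<tau>)"
  proof -
    have "J1 (\<lambda>z. T1 z + B1 \<tau> k z) + J1 (\<lambda>z. T2 z + B2 \<tau> k z) \<le> I1 \<tau>"
      using wint_add(2)[OF wT(1) B(1)] wint_add(2)[OF wT(2) B(4)] wT I_bounds(5)[OF t k] by (simp add: add_divide_distrib)
    moreover have "J2 (\<lambda>z. T1 z + B1 \<tau> k z) + J2 (\<lambda>z. T2 z + B2 \<tau> k z) \<le> I2 \<tau>"
      using wint_add(3)[OF wT(1) B(1)] wint_add(3)[OF wT(2) B(4)] wT I_bounds(6)[OF t k] by (simp add: add_divide_distrib)
    ultimately show ?thesis using L t wint_add(1)[OF wT(1) B(1)] wint_add(1)[OF wT(2) B(4)]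
      by (intro add_mono mult_left_mono) (simp_all add: wint_cmult(2,3) flip: distrib_left)
  qed
  finally show "\<bar>E \<tau> k f x - f x\<bar> \<le> \<tau> * (L2 * I1 \<tau> + 2 * L1 * I2 \<tau>)" by (simp add: algebra_simps)
  have gb: "\<bar>g z\<bar> \<le> L2 * z" "\<bar>g z\<bar> \<le> 2 * L1" "\<bar>g (-z)\<bar> \<le> L2 * z" "\<bar>g (-z)\<bar> \<le> 2 * L1" if "0 < z" for z
    using r(3)[of z] r(3)[of "-z"] r(4)[of z] r(4)[of "-z"] that by auto
  have sp: "set_integrable lborel {0<..} (\<lambda>z. h z * T z)" "set_integrable lborel {0<..} (\<lambda>z. h z * Bz z)"
    "(LBINT z:{0<..}. h z * (\<tau> * (T z + Bz z))) = \<tau> * (LBINT z:{0<..}. h z * T z) + \<tau> * (LBINT z:{0<..}. h z * Bz z)"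
    "\<bar>LBINT z:{0<..}. h z * Bz z\<bar> \<le> L2 * J1 Bz + 2 * L1 * J2 Bz"
    if "wint T" "wint Bz" "h \<in> borel_measurable borel" "\<And>z. 0 < z \<Longrightarrow> \<bar>h z\<bar> \<le> L2 * z" "\<And>z. 0 < z \<Longrightarrow> \<bar>h z\<bar> \<le> 2 * L1" for h T Bz
  proof -
    show i: "set_integrable lborel {0<..} (\<lambda>z. h z * T z)" "set_integrable lborel {0<..} (\<lambda>z. h z * Bz z)"
      using wint_bound(1)[OF that(1,3-5)] wint_bound(1)[OF that(2-5)] by auto
    show "\<bar>LBINT z:{0<..}. h z * Bz z\<bar> \<le> L2 * J1 Bz + 2 * L1 * J2 Bz"
      using wint_bound(2)[OF that(2-5)] .
    have "(LBINT z:{0<..}. h z * (\<tau> * (T z + Bz z))) = (LBINT z:{0<..}. \<tau> * (h z * T z + h z * Bz z))"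
      by (simp add: algebra_simps)
    also have "\<dots> = \<tau> * ((LBINT z:{0<..}. h z * T z) + (LBINT z:{0<..}. h z * Bz z))"
      using i by (simp add: set_integral_add)
    finally show "(LBINT z:{0<..}. h z * (\<tau> * (T z + Bz z))) = \<tau> * (LBINT z:{0<..}. h z * T z) + \<tau> * (LBINT z:{0<..}. h z * Bz z)"
      by (simp add: distrib_left)
  qed
  have gm: "(\<lambda>z. g (- z)) \<in> borel_measurable borel" by measurable
  note s2 = sp[OF wT(2) B(4) \<open>g \<in> borel_measurable borel\<close> gb(1,2)]
  note s1 = sp[OF wT(1) B(1) gm gb(3,4)]
  have "gen \<alpha> k f f' x = (LBINT z:{0<..}. g z * T2 z) - (LBINT z:{0<..}. g (- z) * T1 z)"
    unfolding gen_props(2)[OF c k] g_def T1_def T2_def by simp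
  moreover have eq2: "E \<tau> k f x - f x = (LBINT z:{0<..}. g z * (\<tau> * (T2 z + B2 \<tau> k z))) - (LBINT z:{0<..}. g (- z) * (\<tau> * (T1 z + B1 \<tau> k z)))"
    unfolding eq by (rule R(2))
  ultimately have "E \<tau> k f x - f x - \<tau> * gen \<alpha> k f f' x = \<tau> * ((LBINT z:{0<..}. g z * B2 \<tau> k z) - (LBINT z:{0<..}. g (- z) * B1 \<tau> k z))"
    using s1(3) s2(3) unfolding eq2 by (simp only: right_diff_distrib)
  then have "\<bar>E \<tau> k f x - f x - \<tau> * gen \<alpha> k f f' x\<bar> = \<tau> * \<bar>(LBINT z:{0<..}. g z * B2 \<tau> k z) - (LBINT z:{0<..}. g (- z) * B1 \<tau> k z)\<bar>"
    using t by (simp add: abs_mult)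
  also have "\<dots> \<le> \<tau> * ((L2 * J1 (B2 \<tau> k) + 2 * L1 * J2 (B2 \<tau> k)) + (L2 * J1 (B1 \<tau> k) + 2 * L1 * J2 (B1 \<tau> k)))"
    using t s1(4) s2(4) by (intro mult_left_mono) linarith+
  also have "\<dots> \<le> \<tau> * ((L2 * (C * \<tau> powr q) + 2 * L1 * (C * \<tau> powr q)) + (L2 * (C * \<tau> powr q) + 2 * L1 * (C * \<tau> powr q)))"
    using t L B by (intro mult_left_mono add_mono) auto
  finally show "\<bar>E \<tau> k f x - f x - \<tau> * gen \<alpha> k f f' x\<bar> \<le> \<tau> * (C * \<tau> powr q * (2 * L2 + 4 * L1))"
    by (simp add: algebra_simps)
qed

end

section \<open>Regularity of the scheme in time\<close>

definition dq :: "real \<Rightarrow> (real \<Rightarrow> real) \<Rightarrow> real \<Rightarrow> real" where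
  "dq b f x = (f (x + b) - f x) / b"

lemma dq_bound: assumes "lip L f" "0 < b" shows "\<bar>dq b f x\<bar> \<le> L"
  using lipD[OF assms(1), of "x + b" x] assms(2) by (simp add: dq_def field_simps)

lemma dq_lip: assumes "lip L f" "0 < b" shows "lip (2 * L / b) (dq b f)"
  unfolding lip_def
proof (intro allI)
  fix x y
  have "\<bar>(f (x + b) - f x) - (f (y + b) - f y)\<bar> \<le> 2 * L * \<bar>x - y\<bar>"
    using lipD[OF assms(1), of "x + b" "y + b"] lipD[OF assms(1), of x y] by simp
  then show "\<bar>dq b f x - dq b f y\<bar> \<le> 2 * L / b * \<bar>x - y\<bar>"
    unfolding dq_def using assms(2) by (simp add: diff_divide_distrib[symmetric] divide_right_mono)
qed

lemma bm_dq: assumes "bm f" shows "bm (dq b f)"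
  unfolding dq_def[abs_def] divide_inverse mult.commute[of _ "inverse b"]
proof -
  obtain B where B: "\<And>x. \<bar>f (x + b) - f x\<bar> \<le> B" using bm_bound[OF bm_diff[OF bm_shift[OF assms] assms]] by metis
  show "bm (\<lambda>x. inverse b * (f (x + b) - f x))"
  proof (rule bmI)
    show "(\<lambda>x. inverse b * (f (x + b) - f x)) \<in> borel_measurable borel"
      using bm_measurable[OF bm_diff[OF bm_shift[OF assms] assms]] by measurable
    show "\<bar>inverse b * (f (x + b) - f x)\<bar> \<le> \<bar>inverse b\<bar> * B" for x
      unfolding abs_mult by (rule mult_left_mono[OF B]) simp
  qed
qed

lemma dq_has_derivative:
  assumes "\<And>x. (f has_real_derivative f' x) (at x)"
  shows "(dq b f has_real_derivative dq b f' x) (at x)"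
proof -
  have "((\<lambda>x. f (x + b)) has_real_derivative f' (x + b)) (at x)"
    using assms[of "x + b"] DERIV_shift[of f "f' (x + b)" x b] by simp
  then show ?thesis unfolding dq_def[abs_def]
    by (intro DERIV_cdivide DERIV_diff assms)
qed

lemma av_dq: assumes "continuous_on UNIV f" "0 < b" shows "(av b f has_real_derivative dq b f x) (at x)"
  unfolding dq_def by (rule av_has_derivative[OF assms])

lemma av_lip_lip: assumes "bm f" "lip L f" shows "lip L (av b f)"
  by (rule unif.sm_lip[OF assms(2)]) (rule unif.bm_integrable[OF assms(1)])

definition av3 :: "real \<Rightarrow> (real \<Rightarrow> real) \<Rightarrow> real \<Rightarrow> real" where
  "av3 b f = av b (av b (av b f))"
definition av3_1 :: "real \<Rightarrow> (real \<Rightarrow> real) \<Rightarrow> real \<Rightarrow> real" where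
  "av3_1 b f = dq b (av b (av b f))"
definition av3_2 :: "real \<Rightarrow> (real \<Rightarrow> real) \<Rightarrow> real \<Rightarrow> real" where
  "av3_2 b f = dq b (dq b (av b f))"
definition av3_3 :: "real \<Rightarrow> (real \<Rightarrow> real) \<Rightarrow> real \<Rightarrow> real" where
  "av3_3 b f = dq b (dq b (dq b f))"

text \<open>Each differentiation turns one average into \<open>dq\<close>. The first bound is
  \<open>L\<close>, because difference quotients of Lipschitz functions are bounded by the Lipschitz
  constant; every further one costs a factor 2 / b. The third derivative is bounded by the Lipschitz
  constant of the second.\<close>

lemma av3_c11:
  assumes bm: "bm f" and lip: "lip L f" and b: "0 < b"
  shows "c11 L (2 * L / b) (av3 b f) (av3_1 b f)"
    and "c11 (2 * L / b) (4 * L / b\<^sup>2) (av3_1 b f) (av3_2 b f)"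
    and "(av3_2 b f has_real_derivative av3_3 b f x) (at x)"
    and "\<bar>av3_3 b f x\<bar> \<le> 4 * L / b\<^sup>2" "continuous_on A (av3_3 b f)"
proof -
  note bs = bm unif.bm_sm[OF bm, of b] unif.bm_sm[OF unif.bm_sm[OF bm, of b], of b]
  note l1 = av_lip_lip[OF bm lip, of b]
  note l2 = av_lip_lip[OF bs(2) l1, of b]
  note l3 = av_lip_lip[OF bs(3) l2, of b]
  note c = lip_continuous[OF lip, of UNIV] lip_continuous[OF l1, of UNIV] lip_continuous[OF l2, of UNIV]
  note q1 = dq_lip[OF lip b] and q2 = dq_lip[OF dq_lip[OF lip b] b]
  show "c11 L (2 * L / b) (av3 b f) (av3_1 b f)"
    unfolding c11_def av3_def av3_1_def using av_dq[OF c(3) b] dq_bound[OF l2 b] dq_lip[OF l2 b] by blast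
  have e: "2 * (2 * L / b) / b = 4 * L / b\<^sup>2" by (simp add: power2_eq_square)
  show "c11 (2 * L / b) (4 * L / b\<^sup>2) (av3_1 b f) (av3_2 b f)"
    unfolding c11_def av3_1_def av3_2_def
    using dq_has_derivative[OF av_dq[OF c(2) b]] dq_bound[OF dq_lip[OF l1 b] b] dq_lip[OF dq_lip[OF l1 b] b]
    unfolding e by blast
  show "(av3_2 b f has_real_derivative av3_3 b f x) (at x)"
    unfolding av3_2_def av3_3_def by (intro dq_has_derivative av_dq[OF c(1) b])
  show "\<bar>av3_3 b f x\<bar> \<le> 4 * L / b\<^sup>2"
    unfolding av3_3_def using dq_bound[OF q2 b] unfolding e .
  show "continuous_on A (av3_3 b f)"
    unfolding av3_3_def by (rule lip_continuous[OF dq_lip[OF q2 b]])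
qed

lemma c11_D: assumes "c11 L1 L2 f f'"
  shows "(f has_real_derivative f' x) (at x)" "\<bar>f' x\<bar> \<le> L1" "lip L2 f'" "0 \<le> L1" "0 \<le> L2"
  using assms lip_nonneg c11_lip[OF assms] by (auto simp: c11_def)

lemma c11_shift: assumes "c11 L1 L2 f f'" shows "c11 L1 L2 (\<lambda>x. f (x + c)) (\<lambda>x. f' (x + c))"
  unfolding c11_def
proof (intro conjI allI)
  fix x
  show "((\<lambda>x. f (x + c)) has_real_derivative f' (x + c)) (at x)"
    using c11_D(1)[OF assms, of "x + c"] DERIV_shift[of f "f' (x + c)" x c] by simp
qed (use c11_D[OF assms] lip_shift in auto)

lemma c11_diff: assumes "c11 L1 L2 f f'" "c11 M1 M2 g g'"
  shows "c11 (L1 + M1) (L2 + M2) (\<lambda>x. f x - g x) (\<lambda>x. f' x - g' x)"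
  unfolding c11_def
proof (intro conjI allI)
  fix x
  show "((\<lambda>x. f x - g x) has_real_derivative f' x - g' x) (at x)"
    by (intro DERIV_diff c11_D(1)[OF assms(1)] c11_D(1)[OF assms(2)])
  show "\<bar>f' x - g' x\<bar> \<le> L1 + M1" using c11_D(2)[OF assms(1), of x] c11_D(2)[OF assms(2), of x] by linarith
qed (intro lip_diff c11_D(3)[OF assms(1)] c11_D(3)[OF assms(2)])

lemma c11_sharpen:
  assumes "c11 L1 L2 f f'" "\<And>x. \<bar>f' x\<bar> \<le> M1" "lip M2 f'" shows "c11 M1 M2 f f'"
  using assms by (auto simp: c11_def)

text \<open>The Huber function, that is, the average of \<open>|x|\<close> over intervals of length \<open>2 d\<close>. It is smooth enough for
the generator, and translates of it bound Lipschitz functions from both sides; their growth under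
the scheme yields the regularity in time.\<close>

definition huber :: "real \<Rightarrow> real \<Rightarrow> real" where
  "huber d z = ((z + d) * \<bar>z + d\<bar> - (z - d) * \<bar>z - d\<bar>) / (4 * d)"
definition huber' :: "real \<Rightarrow> real \<Rightarrow> real" where
  "huber' d z = (\<bar>z + d\<bar> - \<bar>z - d\<bar>) / (2 * d)"

lemma DERIV_mult_abs: "((\<lambda>x::real. x * \<bar>x\<bar>) has_real_derivative 2 * \<bar>x\<bar>) (at x)"
proof -
  consider "x < 0" | "x = 0" | "0 < x" by linarith
  then show ?thesis
  proof cases
    case 1
    have "((\<lambda>x. - (x * x)) has_real_derivative 2 * \<bar>x\<bar>) (at x)"
      using 1 by (auto intro!: derivative_eq_intros)
    then show ?thesis
      by (rule has_field_derivative_transform_within_open[of _ _ _ "{..<0}"]) (use 1 in auto)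
  next
    case 2
    have "(\<lambda>h::real. (h * \<bar>h\<bar>) / h) \<midarrow>0\<rightarrow> 0"
    proof (rule Lim_transform_eventually)
      show "(\<lambda>h::real. \<bar>h\<bar>) \<midarrow>0\<rightarrow> 0" by (auto intro!: tendsto_eq_intros)
      show "\<forall>\<^sub>F h in at (0::real). \<bar>h\<bar> = h * \<bar>h\<bar> / h" by (auto simp: eventually_at_filter)
    qed
    then show ?thesis using 2 by (simp add: DERIV_def)
  next
    case 3
    have "((\<lambda>x. x * x) has_real_derivative 2 * \<bar>x\<bar>) (at x)"
      using 3 by (auto intro!: derivative_eq_intros)
    then show ?thesis
      by (rule has_field_derivative_transform_within_open[of _ _ _ "{0<..}"]) (use 3 in auto)
  qed
qed

lemma huber_ge: assumes "0 < d" shows "\<bar>z\<bar> \<le> huber d z"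
proof -
  consider "d \<le> z" | "z \<le> - d" | "- d < z" "z < d" by linarith
  then show ?thesis
  proof cases
    case 3
    \<comment> \<open>Between -d and d the function equals (z^2 + d^2) / (2 d), so the claim is this
      square.\<close>
    have "0 \<le> (\<bar>z\<bar> - d)\<^sup>2" by simp
    then have "\<bar>z\<bar> * (4 * d) \<le> (z + d) * \<bar>z + d\<bar> - (z - d) * \<bar>z - d\<bar>"
      using 3 by (simp add: power2_eq_square algebra_simps)
    then show ?thesis unfolding huber_def using assms by (subst pos_le_divide_eq) auto
  qed (use assms in \<open>auto simp: huber_def field_simps\<close>)
qed

lemma huber_0: "0 < d \<Longrightarrow> huber d 0 = d / 2"
  by (simp add: huber_def field_simps)

lemma huber_c11: assumes d: "0 < d" shows "c11 1 (1 / d) (huber d) (huber' d)"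
  unfolding c11_def
proof (intro conjI allI)
  fix x
  have "((\<lambda>z. (z + d) * \<bar>z + d\<bar>) has_real_derivative 2 * \<bar>x + d\<bar>) (at x)"
    using DERIV_mult_abs[of "x + d"] DERIV_shift[of "\<lambda>x. x * \<bar>x\<bar>" "2 * \<bar>x + d\<bar>" x d] by simp
  moreover have "((\<lambda>z. (z - d) * \<bar>z - d\<bar>) has_real_derivative 2 * \<bar>x - d\<bar>) (at x)"
    using DERIV_mult_abs[of "x - d"] DERIV_shift[of "\<lambda>x. x * \<bar>x\<bar>" "2 * \<bar>x - d\<bar>" x "- d"] by simp
  ultimately have "(huber d has_real_derivative (2 * \<bar>x + d\<bar> - 2 * \<bar>x - d\<bar>) / (4 * d)) (at x)"
    unfolding huber_def[abs_def] by (intro DERIV_cdivide DERIV_diff)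
  then show "(huber d has_real_derivative huber' d x) (at x)"
    by (rule DERIV_cong) (simp add: huber'_def diff_divide_distrib)
  show "\<bar>huber' d x\<bar> \<le> 1" using d by (simp add: huber'_def divide_simps)
next
  show "lip (1 / d) (huber' d)" unfolding lip_def
  proof (intro allI)
    fix x y
    have "\<bar>(\<bar>x + d\<bar> - \<bar>x - d\<bar>) - (\<bar>y + d\<bar> - \<bar>y - d\<bar>)\<bar> \<le> 2 * \<bar>x - y\<bar>"
    proof -
      have "\<bar>(a - b) - (a' - b')\<bar> \<le> 2 * m" if "\<bar>a - a'\<bar> \<le> m" "\<bar>b - b'\<bar> \<le> m" for a b a' b' m :: real
        using that by linarith
      then show ?thesis
        using abs_triangle_ineq3[of "x + d" "y + d"] abs_triangle_ineq3[of "x - d" "y - d"] by simp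
    qed
    then show "\<bar>huber' d x - huber' d y\<bar> \<le> 1 / d * \<bar>x - y\<bar>"
      unfolding huber'_def diff_divide_distrib[symmetric] abs_divide using d by (simp add: field_simps)
  qed
qed

section \<open>Growth of iterated steps and the modulus of continuity in time\<close>

context stable_scheme begin

lemma E_int: assumes "k \<in> K \<times> K" "lip L f" shows "integrable (W k) (\<lambda>s. f (x + h * s))"
  by (rule real_distribution.lip_integrable[OF W_dist[OF assms(1)] assms(2) W_int[OF assms(1)]])

lemma E_lip: assumes "k \<in> K \<times> K" "lip L f" shows "lip L (E \<tau> k f)"
  unfolding E_def by (rule real_distribution.sm_lip[OF W_dist[OF assms(1)] assms(2)]) (rule E_int[OF assms])

lemma E_mono: assumes "k \<in> K \<times> K" "lip L f" "lip M g" "\<And>x. f x \<le> g x" shows "E \<tau> k f x \<le> E \<tau> k g x"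
  unfolding E_def by (rule real_distribution.sm_mono[OF W_dist[OF assms(1)] E_int[OF assms(1,2)] E_int[OF assms(1,3)]]) (rule assms(4))

lemma E_uminus: "E \<tau> k (\<lambda>x. - f x) x = - E \<tau> k f x"
  by (simp add: E_def sm_def)

lemma E_affine: assumes "k \<in> K \<times> K" "lip L f" shows "E \<tau> k (\<lambda>z. a + c * f (z + d)) x = a + c * E \<tau> k f (x + d)"
proof -
  interpret W: real_distribution "W k" using W_dist[OF assms(1)] .
  have "integrable (W k) (\<lambda>s. f (x + \<tau> powr (1/\<alpha>) * s + d))"
    using E_int[OF assms, of "x + d" "\<tau> powr (1/\<alpha>)"] by (simp add: ac_simps)
  then show ?thesis using W.prob_space by (simp add: E_def sm_def ac_simps)
qed

lemma E_abs_le: assumes "k \<in> K \<times> K" "\<And>x. \<bar>f x\<bar> \<le> B" shows "\<bar>E \<tau> k f x\<bar> \<le> B"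
  unfolding E_def by (rule real_distribution.sm_abs_le[OF W_dist[OF assms(1)] assms(2)])

definition huber_growth :: "real \<Rightarrow> real \<Rightarrow> real" where
  "huber_growth d \<tau> = I1 \<tau> / d + 2 * I2 \<tau>"

lemma huber_growth_nonneg: assumes "0 < \<tau>" "\<tau> < 1" "0 < d" shows "0 \<le> huber_growth d \<tau>"
  unfolding huber_growth_def using I_bounds(3,4)[OF assms(1,2)] assms(3) by (intro add_nonneg_nonneg) auto

text \<open>A Huber majorant survives a step with the same shape and a larger additive constant,
  which makes the estimate iterable. The growth rate is the second claim of \<open>E_props\<close>
  for the constants 1 and 1 / d of the Huber function.\<close>

lemma E_huber_upper:
  assumes k: "k \<in> K \<times> K" and t: "0 < \<tau>" "\<tau> < 1" and d: "0 < d" and f: "lip M f" and L: "0 \<le> L"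
    and le: "\<And>z. f z \<le> a + L * huber d (z + c)"
  shows "E \<tau> k f y \<le> a + L * (huber d (y + c) + \<tau> * huber_growth d \<tau>)"
proof -
  have hl: "lip 1 (huber d)" by (rule c11_lip[OF huber_c11[OF d]])
  have "lip (L * 1) (\<lambda>z. a + L * huber d (z + c))"
    unfolding lip_def
  proof (intro allI)
    fix x y
    have "\<bar>L * huber d (x + c) - L * huber d (y + c)\<bar> = L * \<bar>huber d (x + c) - huber d (y + c)\<bar>"
      using L by (simp add: abs_mult flip: right_diff_distrib)
    also have "\<dots> \<le> L * (1 * \<bar>(x + c) - (y + c)\<bar>)" by (intro mult_left_mono lipD[OF hl] L)
    finally show "\<bar>a + L * huber d (x + c) - (a + L * huber d (y + c))\<bar> \<le> L * 1 * \<bar>x - y\<bar>" by simp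
  qed
  then have "E \<tau> k f y \<le> E \<tau> k (\<lambda>z. a + L * huber d (z + c)) y" by (rule E_mono[OF k f _ le])
  also have "\<dots> = a + L * E \<tau> k (huber d) (y + c)" by (rule E_affine[OF k hl])
  also have "E \<tau> k (huber d) (y + c) \<le> huber d (y + c) + \<tau> * huber_growth d \<tau>"
    using E_props(2)[OF huber_c11[OF d] k t, of "y + c"] by (simp add: huber_growth_def)
  finally show ?thesis using L by (simp add: mult_left_mono)
qed

lemma E_huber_lower:
  assumes k: "k \<in> K \<times> K" and t: "0 < \<tau>" "\<tau> < 1" and d: "0 < d" and f: "lip M f" and L: "0 \<le> L"
    and le: "\<And>z. a - L * huber d (z + c) \<le> f z"
  shows "a - L * (huber d (y + c) + \<tau> * huber_growth d \<tau>) \<le> E \<tau> k f y"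
proof -
  have "lip M (\<lambda>x. - f x)" using f by (simp add: lip_def abs_minus_commute)
  moreover have "- f z \<le> - a + L * huber d (z + c)" for z using le[of z] by simp
  ultimately have "E \<tau> k (\<lambda>x. - f x) y \<le> - a + L * (huber d (y + c) + \<tau> * huber_growth d \<tau>)"
    using E_huber_upper[OF k t d _ L] by blast
  then show ?thesis by (simp add: E_uminus)
qed

text \<open>The index set is a parameter so that the same growth estimates serve the scheme, with
  all of \<open>K \<times> K\<close>, and a single linear operator, with one pair.\<close>

definition S :: "(real \<times> real) set \<Rightarrow> real \<Rightarrow> (real \<Rightarrow> real) \<Rightarrow> real \<Rightarrow> real" where
  "S A \<tau> f x = (SUP k\<in>A. E \<tau> k f x)"

lemma lip_huber_le: assumes "lip L f" "0 < d" shows "f z \<le> f x + L * huber d (z + - x)" "f x - L * huber d (z + - x) \<le> f z"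
proof -
  have "\<bar>f z - f x\<bar> \<le> L * huber d (z + - x)"
    using lipD[OF assms(1), of z x] mult_left_mono[OF huber_ge[OF assms(2), of "z + - x"] lip_nonneg[OF assms(1)]] by simp
  then show "f z \<le> f x + L * huber d (z + - x)" "f x - L * huber d (z + - x) \<le> f z" by linarith+
qed

lemma S_bdd: assumes "A \<subseteq> K \<times> K" "lip L f" "0 < \<tau>" "\<tau> < 1" shows "bdd_above ((\<lambda>k. E \<tau> k f x) ` A)"
proof (rule bdd_aboveI2)
  fix k assume "k \<in> A" then have k: "k \<in> K \<times> K" using assms by auto
  show "E \<tau> k f x \<le> f x + L * (huber 1 (x + - x) + \<tau> * huber_growth 1 \<tau>)"
    by (rule E_huber_upper[OF k assms(3,4) _ assms(2) lip_nonneg[OF assms(2)] lip_huber_le(1)[OF assms(2)]]) auto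
qed

lemma S_ge: assumes "A \<subseteq> K \<times> K" "lip L f" "0 < \<tau>" "\<tau> < 1" "k \<in> A" shows "E \<tau> k f x \<le> S A \<tau> f x"
  unfolding S_def by (rule cSUP_upper[OF assms(5) S_bdd[OF assms(1-4), of x]])

lemma S_le: assumes "A \<noteq> {}" "\<And>k. k \<in> A \<Longrightarrow> E \<tau> k f x \<le> c" shows "S A \<tau> f x \<le> c"
  unfolding S_def by (rule cSUP_least[OF assms])

lemma S_lip: assumes "A \<subseteq> K \<times> K" "A \<noteq> {}" "lip L f" "0 < \<tau>" "\<tau> < 1" shows "lip L (S A \<tau> f)"
proof -
  have "S A \<tau> f x \<le> S A \<tau> f y + L * \<bar>x - y\<bar>" for x y
  proof (rule S_le[OF assms(2)])
    fix k assume k: "k \<in> A"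
    then have "k \<in> K \<times> K" using assms by auto
    from lipD[OF E_lip[OF this assms(3), of \<tau>], of x y] S_ge[OF assms(1,3-5) k, of y]
    show "E \<tau> k f x \<le> S A \<tau> f y + L * \<bar>x - y\<bar>" by linarith
  qed
  from this show ?thesis unfolding lip_def by (smt (verit) abs_minus_commute)
qed

lemma S_abs_le: assumes "A \<subseteq> K \<times> K" "A \<noteq> {}" "lip L f" "0 < \<tau>" "\<tau> < 1" "\<And>x. \<bar>f x\<bar> \<le> B" shows "\<bar>S A \<tau> f x\<bar> \<le> B"
proof -
  obtain k where k: "k \<in> A" using assms(2) by blast
  have E: "\<bar>E \<tau> k f x\<bar> \<le> B" if "k \<in> A" for k using E_abs_le[of k f B] assms(1,6) that by blast
  have "S A \<tau> f x \<le> B" by (rule S_le[OF assms(2)]) (use E in \<open>simp add: abs_le_iff\<close>)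
  moreover have "- B \<le> S A \<tau> f x" using S_ge[OF assms(1,3-5) k, of x] E[OF k] by linarith
  ultimately show ?thesis by (simp add: abs_le_iff)
qed

lemma S_pow_lip: assumes "A \<subseteq> K \<times> K" "A \<noteq> {}" "lip L f" "0 < \<tau>" "\<tau> < 1" shows "lip L ((S A \<tau> ^^ n) f)"
  by (induction n) (simp_all add: assms S_lip)

lemma S_pow_abs_le: assumes "A \<subseteq> K \<times> K" "A \<noteq> {}" "lip L f" "0 < \<tau>" "\<tau> < 1" "\<And>x. \<bar>f x\<bar> \<le> B"
  shows "\<bar>(S A \<tau> ^^ n) f x\<bar> \<le> B"
proof (induction n arbitrary: x)
  case (Suc n)
  show ?case using S_abs_le[OF assms(1,2) S_pow_lip[OF assms(1-5)] assms(4,5) Suc.IH] by simp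
qed (use assms in simp)

text \<open>For a fixed centre \<open>x\<close> the function is enclosed between two Huber functions
  of slope \<open>L\<close> around \<open>f x\<close>. Each step moves the enclosure by \<tau> times
  the growth rate, and at the centre itself its width is only d / 2.\<close>

lemma S_pow_near:
  assumes A: "A \<subseteq> K \<times> K" "A \<noteq> {}" and f: "lip L f" and t: "0 < \<tau>" "\<tau> < 1" and d: "0 < d"
  shows "\<bar>(S A \<tau> ^^ n) f x - f x\<bar> \<le> L * (d / 2 + real n * \<tau> * huber_growth d \<tau>)"
proof -
  have L: "0 \<le> L" using f by (rule lip_nonneg)
  have "(S A \<tau> ^^ n) f y \<le> (f x + L * (real n * \<tau> * huber_growth d \<tau>)) + L * huber d (y + - x) \<and>
     (f x - L * (real n * \<tau> * huber_growth d \<tau>)) - L * huber d (y + - x) \<le> (S A \<tau> ^^ n) f y" for y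
  proof (induction n arbitrary: y)
    case 0
    then show ?case using lip_huber_le[OF f d] by simp
  next
    case (Suc n)
    let ?g = "(S A \<tau> ^^ n) f" and ?c = "L * (real n * \<tau> * huber_growth d \<tau>)"
    have g: "lip L ?g" by (rule S_pow_lip[OF A f t])
    have e: "?c + L * (\<tau> * huber_growth d \<tau>) = L * (real (Suc n) * \<tau> * huber_growth d \<tau>)" by (simp add: algebra_simps)
    have "S A \<tau> ?g y \<le> (f x + ?c) + L * (huber d (y + - x) + \<tau> * huber_growth d \<tau>)"
    proof (rule S_le[OF A(2)])
      fix k assume "k \<in> A" then have k: "k \<in> K \<times> K" using A by auto
      show "E \<tau> k ?g y \<le> (f x + ?c) + L * (huber d (y + - x) + \<tau> * huber_growth d \<tau>)"
        by (rule E_huber_upper[OF k t d g L]) (use Suc in blast)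
    qed
    moreover obtain k0 where k0: "k0 \<in> A" using A by blast
    then have k: "k0 \<in> K \<times> K" using A by auto
    have "(f x - ?c) - L * (huber d (y + - x) + \<tau> * huber_growth d \<tau>) \<le> E \<tau> k0 ?g y"
      by (rule E_huber_lower[OF k t d g L]) (use Suc in blast)
    moreover have "E \<tau> k0 ?g y \<le> S A \<tau> ?g y" by (rule S_ge[OF A(1) g t k0])
    ultimately show ?case using e by (simp add: algebra_simps)
  qed
  from this[of x] show ?thesis using huber_0[OF d] by (simp add: algebra_simps abs_le_iff)
qed

lemma S_pow_near_sqrt:
  assumes A: "A \<subseteq> K \<times> K" "A \<noteq> {}" and f: "lip L f" and t: "0 < \<tau>" "\<tau> < 1" and s: "0 < s" "real n * \<tau> \<le> s"
  shows "\<bar>(S A \<tau> ^^ n) f x - f x\<bar> \<le> L * (sqrt (2 * I1 \<tau> * s) + 2 * I2 \<tau> * s)"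
proof -
  \<comment> \<open>Minimizes d / 2 + s I1 / d: both summands become equal, and their sum is
    \<open>d\<close>.\<close>
  define d where "d = sqrt (2 * I1 \<tau> * s)"
  have d: "0 < d" unfolding d_def using I_bounds(3)[OF t] s by simp
  have dd: "d * d = 2 * I1 \<tau> * s" unfolding d_def using I_bounds(3)[OF t] s by simp
  have "\<bar>(S A \<tau> ^^ n) f x - f x\<bar> \<le> L * (d / 2 + real n * \<tau> * huber_growth d \<tau>)" by (rule S_pow_near[OF A f t d])
  also have "\<dots> \<le> L * (d / 2 + s * huber_growth d \<tau>)"
    using lip_nonneg[OF f] s huber_growth_nonneg[OF t d] by (intro mult_left_mono add_left_mono mult_right_mono) auto
  also have "s * huber_growth d \<tau> = d / 2 + 2 * I2 \<tau> * s"
  proof -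
    have "s * (I1 \<tau> / d) = d / 2" using dd d by (simp add: field_simps)
    then show ?thesis by (simp add: huber_growth_def algebra_simps)
  qed
  finally show ?thesis by (simp add: d_def)
qed

lemma S_singleton: "S {k} \<tau> = E \<tau> k"
  by (intro ext) (simp add: S_def)

end

section \<open>Comparison with viscosity solutions\<close>

text \<open>Gluing with a constant is differentiable where the derivative vanishes. Applied to a
  function and again to its derivative, this gives the twice differentiable cut-offs in time:
  \<open>clamp\<close> and the cubes of positive parts.\<close>

lemma DERIV_pos_part:
  assumes f: "\<And>x. (f has_real_derivative f' x) (at x)" and f0: "f' 0 = 0"
  shows "((\<lambda>x. f (max 0 x)) has_real_derivative f' (max 0 x)) (at x)"
proof -
  consider "x < 0" | "x = 0" | "0 < x" by linarith
  then show ?thesis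
  proof cases
    case 1
    have "((\<lambda>x. f 0) has_real_derivative f' (max 0 x)) (at x)" using 1 f0 by simp
    then show ?thesis
      by (rule has_field_derivative_transform_within_open[of _ _ _ "{..<0}"]) (use 1 in auto)
  next
    case 2
    have lim: "(\<lambda>h. (f (0 + h) - f 0) / h) \<midarrow>0\<rightarrow> 0" using f[of 0] f0 by (simp add: DERIV_def)
    have "(\<lambda>h. (f (max 0 h) - f 0) / h) \<midarrow>0\<rightarrow> 0"
    proof (rule Lim_null_comparison)
      show "(\<lambda>h. \<bar>(f (0 + h) - f 0) / h\<bar>) \<midarrow>0\<rightarrow> 0" using tendsto_rabs_zero[OF lim] .
      show "\<forall>\<^sub>F h in at 0. norm ((f (max 0 h) - f 0) / h) \<le> \<bar>(f (0 + h) - f 0) / h\<bar>"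
      proof (intro always_eventually allI)
        show "norm ((f (max 0 h) - f 0) / h) \<le> \<bar>(f (0 + h) - f 0) / h\<bar>" for h
          by (cases "0 \<le> h") (simp_all add: max_def del: abs_divide)
      qed
    qed
    then show ?thesis using 2 f0 by (simp add: DERIV_def)
  next
    case 3
    have "(f has_real_derivative f' (max 0 x)) (at x)" using f[of x] 3 by simp
    then show ?thesis
      by (rule has_field_derivative_transform_within_open[of _ _ _ "{0<..}"]) (use 3 in auto)
  qed
qed

text \<open>The regularity of \<open>test_function\<close> with the derivatives named, so that
  corrections can be added to them. Boundedness is asked on a time interval only, since the
  corrections grow in time; composition with \<open>clamp\<close> makes them bounded
  afterwards.\<close>

definition smooth23 :: "real \<Rightarrow> real \<Rightarrow> (real \<Rightarrow> real \<Rightarrow> real) \<Rightarrow> (real \<Rightarrow> real \<Rightarrow> real) \<Rightarrow> (real \<Rightarrow> real \<Rightarrow> real) \<Rightarrow>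
    (real \<Rightarrow> real \<Rightarrow> real) \<Rightarrow> (real \<Rightarrow> real \<Rightarrow> real) \<Rightarrow> (real \<Rightarrow> real \<Rightarrow> real) \<Rightarrow> bool" where
  "smooth23 a b \<psi> \<psi>t \<psi>tt \<psi>x \<psi>xx \<psi>xxx \<longleftrightarrow>
     (\<forall>g\<in>{\<psi>, \<psi>t, \<psi>tt, \<psi>x, \<psi>xx, \<psi>xxx}.
        continuous_on UNIV (\<lambda>p. g (fst p) (snd p)) \<and> (\<exists>B. \<forall>t\<in>{a..b}. \<forall>x. \<bar>g t x\<bar> \<le> B)) \<and>
     (\<forall>t x. ((\<lambda>s. \<psi> s x) has_real_derivative \<psi>t t x) (at t) \<and>
        ((\<lambda>s. \<psi>t s x) has_real_derivative \<psi>tt t x) (at t) \<and>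
        (\<psi> t has_real_derivative \<psi>x t x) (at x) \<and>
        (\<psi>x t has_real_derivative \<psi>xx t x) (at x) \<and>
        (\<psi>xx t has_real_derivative \<psi>xxx t x) (at x))"

lemma smooth23_D:
  assumes "smooth23 a b \<psi> \<psi>t \<psi>tt \<psi>x \<psi>xx \<psi>xxx"
  shows "((\<lambda>s. \<psi> s x) has_real_derivative \<psi>t t x) (at t)" "((\<lambda>s. \<psi>t s x) has_real_derivative \<psi>tt t x) (at t)"
    "(\<psi> t has_real_derivative \<psi>x t x) (at x)" "(\<psi>x t has_real_derivative \<psi>xx t x) (at x)"
    "(\<psi>xx t has_real_derivative \<psi>xxx t x) (at x)"
  using assms unfolding smooth23_def by blast+

lemma smooth23_cont:
  assumes "smooth23 a b \<psi> \<psi>t \<psi>tt \<psi>x \<psi>xx \<psi>xxx" "g \<in> {\<psi>, \<psi>t, \<psi>tt, \<psi>x, \<psi>xx, \<psi>xxx}"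
  shows "continuous_on UNIV (\<lambda>p. g (fst p) (snd p))" "\<exists>B. \<forall>t\<in>{a..b}. \<forall>x. \<bar>g t x\<bar> \<le> B"
  using assms unfolding smooth23_def by blast+

lemma smooth23_c11:
  assumes "smooth23 a b \<psi> \<psi>t \<psi>tt \<psi>x \<psi>xx \<psi>xxx" "a \<le> t" "t \<le> b"
  shows "\<exists>L1 L2. c11 L1 L2 (\<psi> t) (\<psi>x t)"
proof -
  obtain L1 where L1: "\<forall>t\<in>{a..b}. \<forall>x. \<bar>\<psi>x t x\<bar> \<le> L1" using smooth23_cont(2)[OF assms(1), of \<psi>x] by blast
  obtain L2 where L2: "\<forall>t\<in>{a..b}. \<forall>x. \<bar>\<psi>xx t x\<bar> \<le> L2" using smooth23_cont(2)[OF assms(1), of \<psi>xx] by blast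
  have "lip L2 (\<psi>x t)" unfolding lip_def
  proof (intro allI)
    fix x y
    have "norm (\<psi>x t x - \<psi>x t y) \<le> L2 * norm (x - y)"
      by (rule field_differentiable_bound[of UNIV "\<psi>x t" "\<psi>xx t" L2])
         (use smooth23_D(4)[OF assms(1)] L2 assms(2,3) in auto)
    then show "\<bar>\<psi>x t x - \<psi>x t y\<bar> \<le> L2 * \<bar>x - y\<bar>" by simp
  qed
  then have "c11 L1 L2 (\<psi> t) (\<psi>x t)"
    unfolding c11_def using smooth23_D(3)[OF assms(1)] L1 assms(2,3) by auto
  then show ?thesis by blast
qed

lemma continuous_fst_snd:
  fixes f :: "real \<Rightarrow> real"
  assumes "continuous_on UNIV f"
  shows "continuous_on UNIV (\<lambda>p::real\<times>real. f (fst p))" "continuous_on UNIV (\<lambda>p::real\<times>real. f (snd p))"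
  by (rule continuous_on_compose2[OF assms]; auto intro: continuous_intros)+

lemma compact_bound:
  fixes p :: "real \<Rightarrow> real"
  assumes "continuous_on UNIV p" shows "\<exists>B. \<forall>t\<in>{a..b}. \<bar>p t\<bar> \<le> B"
proof -
  have "bounded (p ` {a..b})"
    by (intro compact_imp_bounded compact_continuous_image continuous_on_subset[OF assms]) auto
  then show ?thesis by (auto simp: bounded_iff)
qed

text \<open>All corrections of later test functions are products of a function of time and one of
  space: the penalty, the interpolation between two profiles, and pure time terms.\<close>

lemma smooth23_add_mult:
  assumes s: "smooth23 a b \<psi> \<psi>t \<psi>tt \<psi>x \<psi>xx \<psi>xxx"
    and p: "\<And>t. (p has_real_derivative p1 t) (at t)" "\<And>t. (p1 has_real_derivative p2 t) (at t)" "continuous_on UNIV p2"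
    and g: "\<And>x. (g has_real_derivative g1 x) (at x)" "\<And>x. (g1 has_real_derivative g2 x) (at x)"
      "\<And>x. (g2 has_real_derivative g3 x) (at x)" "continuous_on UNIV g3"
    and bd: "\<And>x. \<bar>g x\<bar> \<le> G" "\<And>x. \<bar>g1 x\<bar> \<le> G" "\<And>x. \<bar>g2 x\<bar> \<le> G" "\<And>x. \<bar>g3 x\<bar> \<le> G"
  shows "smooth23 a b (\<lambda>t x. \<psi> t x + p t * g x) (\<lambda>t x. \<psi>t t x + p1 t * g x) (\<lambda>t x. \<psi>tt t x + p2 t * g x)
    (\<lambda>t x. \<psi>x t x + p t * g1 x) (\<lambda>t x. \<psi>xx t x + p t * g2 x) (\<lambda>t x. \<psi>xxx t x + p t * g3 x)"
proof -
  have c: "continuous_on UNIV p" "continuous_on UNIV p1" "continuous_on UNIV g" "continuous_on UNIV g1" "continuous_on UNIV g2"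
    using p(1,2) g(1,2,3) by (meson DERIV_continuous_on has_field_derivative_at_within)+
  have key: "continuous_on UNIV (\<lambda>z. h (fst z) (snd z) + r (fst z) * w (snd z))" "\<exists>B. \<forall>t\<in>{a..b}. \<forall>x. \<bar>h t x + r t * w x\<bar> \<le> B"
    if h: "h \<in> {\<psi>, \<psi>t, \<psi>tt, \<psi>x, \<psi>xx, \<psi>xxx}" and r: "continuous_on UNIV r" and w: "continuous_on UNIV w" "\<And>x. \<bar>w x\<bar> \<le> G" for h r w
  proof -
    show "continuous_on UNIV (\<lambda>z. h (fst z) (snd z) + r (fst z) * w (snd z))"
      by (intro continuous_on_add continuous_on_mult continuous_fst_snd smooth23_cont(1)[OF s h] r w)
    obtain B1 where B1: "\<forall>t\<in>{a..b}. \<forall>x. \<bar>h t x\<bar> \<le> B1" using smooth23_cont(2)[OF s h] by blast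
    obtain B2 where B2: "\<forall>t\<in>{a..b}. \<bar>r t\<bar> \<le> B2" using compact_bound[OF r] by blast
    have "\<bar>h t x + r t * w x\<bar> \<le> B1 + B2 * G" if "t \<in> {a..b}" for t x
    proof -
      have r: "\<bar>r t\<bar> \<le> B2" using B2 that by blast
      have "\<bar>r t * w x\<bar> \<le> B2 * G" unfolding abs_mult
        by (rule mult_mono[OF r w(2)]) (use r in linarith)+
      moreover have "\<bar>h t x\<bar> \<le> B1" using B1 that by blast
      ultimately show ?thesis by linarith
    qed
    then show "\<exists>B. \<forall>t\<in>{a..b}. \<forall>x. \<bar>h t x + r t * w x\<bar> \<le> B" by blast
  qed
  note keys = key[of \<psi> p g, OF _ c(1) c(3) bd(1)] key[of \<psi>t p1 g, OF _ c(2) c(3) bd(1)] key[of \<psi>tt p2 g, OF _ p(3) c(3) bd(1)]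
    key[of \<psi>x p g1, OF _ c(1) c(4) bd(2)] key[of \<psi>xx p g2, OF _ c(1) c(5) bd(3)] key[of \<psi>xxx p g3, OF _ c(1) g(4) bd(4)]
  show ?thesis unfolding smooth23_def ball_simps
  proof (intro conjI allI)
    fix t x
    show "((\<lambda>s. \<psi> s x + p s * g x) has_real_derivative \<psi>t t x + p1 t * g x) (at t)"
      by (intro DERIV_add smooth23_D[OF s] DERIV_cmult_right p)
    show "((\<lambda>s. \<psi>t s x + p1 s * g x) has_real_derivative \<psi>tt t x + p2 t * g x) (at t)"
      by (intro DERIV_add smooth23_D[OF s] DERIV_cmult_right p)
    show "((\<lambda>x. \<psi> t x + p t * g x) has_real_derivative \<psi>x t x + p t * g1 x) (at x)"
      by (intro DERIV_add smooth23_D[OF s] DERIV_cmult g)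
    show "((\<lambda>x. \<psi>x t x + p t * g1 x) has_real_derivative \<psi>xx t x + p t * g2 x) (at x)"
      by (intro DERIV_add smooth23_D[OF s] DERIV_cmult g)
    show "((\<lambda>x. \<psi>xx t x + p t * g2 x) has_real_derivative \<psi>xxx t x + p t * g3 x) (at x)"
      by (intro DERIV_add smooth23_D[OF s] DERIV_cmult g)
  qed (use keys in simp_all)
qed

lemma smooth23_add_time:
  assumes "smooth23 a b \<psi> \<psi>t \<psi>tt \<psi>x \<psi>xx \<psi>xxx"
    and "\<And>t. (p has_real_derivative p1 t) (at t)" "\<And>t. (p1 has_real_derivative p2 t) (at t)" "continuous_on UNIV p2"
  shows "smooth23 a b (\<lambda>t x. \<psi> t x + p t) (\<lambda>t x. \<psi>t t x + p1 t) (\<lambda>t x. \<psi>tt t x + p2 t) \<psi>x \<psi>xx \<psi>xxx"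
  using smooth23_add_mult[OF assms, of "\<lambda>_. 1" "\<lambda>_. 0" "\<lambda>_. 0" "\<lambda>_. 0" 1] by simp

lemma smooth23_zero: "smooth23 a b (\<lambda>t x. 0) (\<lambda>t x. 0) (\<lambda>t x. 0) (\<lambda>t x. 0) (\<lambda>t x. 0) (\<lambda>t x. 0)"
  unfolding smooth23_def by (auto intro!: continuous_intros exI[of _ 0])

lemma smooth23_uminus:
  assumes "smooth23 a b \<psi> \<psi>t \<psi>tt \<psi>x \<psi>xx \<psi>xxx"
  shows "smooth23 a b (\<lambda>t x. - \<psi> t x) (\<lambda>t x. - \<psi>t t x) (\<lambda>t x. - \<psi>tt t x) (\<lambda>t x. - \<psi>x t x) (\<lambda>t x. - \<psi>xx t x) (\<lambda>t x. - \<psi>xxx t x)"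
proof -
  show ?thesis unfolding smooth23_def ball_simps
    by (intro conjI allI DERIV_minus smooth23_D[OF assms])
       (use smooth23_cont[OF assms] in \<open>simp_all add: continuous_on_minus\<close>)
qed

text \<open>Test functions must be bounded for all positive times. The map \<open>clamp T\<close> is twice
continuously differentiable, the identity on times up to \<open>T\<close>, and has bounded range on \<open>t > 0\<close>.\<close>

definition clamp :: "real \<Rightarrow> real \<Rightarrow> real" where
  "clamp T t = t - (max 0 (t - T) - sin (max 0 (t - T)))"
definition clamp1 :: "real \<Rightarrow> real \<Rightarrow> real" where
  "clamp1 T t = 1 - (1 - cos (max 0 (t - T)))"
definition clamp2 :: "real \<Rightarrow> real \<Rightarrow> real" where
  "clamp2 T t = - sin (max 0 (t - T))"

lemma clamp_id: "t \<le> T \<Longrightarrow> clamp T t = t" "t \<le> T \<Longrightarrow> clamp1 T t = 1"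
  by (simp_all add: clamp_def clamp1_def)

text \<open>Beyond \<open>T\<close> the value is \<open>T + sin (t - T)\<close>. This range is the
  reason for the time interval from -1 to T + 1 in all uses of \<open>smooth23\<close> as a test
  function.\<close>

lemma clamp_range: assumes "0 < t" "0 < T" shows "clamp T t \<in> {-1..T+1}"
proof (cases "t \<le> T")
  case True then show ?thesis using assms by (simp add: clamp_id)
next
  case False
  then have "clamp T t = T + sin (t - T)" by (simp add: clamp_def)
  then show ?thesis using sin_ge_minus_one[of "t - T"] sin_le_one[of "t - T"] assms by (simp only: atLeastAtMost_iff) linarith
qed

lemma clamp_deriv:
  "(clamp T has_real_derivative clamp1 T t) (at t)" "(clamp1 T has_real_derivative clamp2 T t) (at t)"
proof -
  have a: "((\<lambda>x. x - sin x) has_real_derivative 1 - cos x) (at x)" for x :: real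
    by (auto intro!: derivative_eq_intros)
  have b: "((\<lambda>x. 1 - cos x) has_real_derivative sin x) (at x)" for x :: real
    by (auto intro!: derivative_eq_intros)
  have "((\<lambda>t. max 0 (t - T) - sin (max 0 (t - T))) has_real_derivative 1 - cos (max 0 (t - T))) (at t)"
    using DERIV_pos_part[OF a, of "t - T"] DERIV_shift[of "\<lambda>x. max 0 x - sin (max 0 x)" _ t "- T"] by simp
  then show "(clamp T has_real_derivative clamp1 T t) (at t)"
    unfolding clamp_def[abs_def] clamp1_def by (rule DERIV_diff[OF DERIV_ident])
  have "((\<lambda>t. 1 - cos (max 0 (t - T))) has_real_derivative sin (max 0 (t - T))) (at t)"
    using DERIV_pos_part[OF b, of "t - T"] DERIV_shift[of "\<lambda>x. 1 - cos (max 0 x)" _ t "- T"] by simp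
  then show "(clamp1 T has_real_derivative clamp2 T t) (at t)"
    unfolding clamp1_def[abs_def] clamp2_def using DERIV_diff[OF DERIV_const[of 1]] by fastforce
qed

lemma clamp_cont: "continuous_on A (clamp T)" "continuous_on A (clamp1 T)" "continuous_on A (clamp2 T)"
  unfolding clamp_def[abs_def] clamp1_def[abs_def] clamp2_def[abs_def] by (intro continuous_intros)+

lemma clamp_bounds: "\<bar>clamp1 T t\<bar> \<le> 1" "\<bar>clamp2 T t\<bar> \<le> 1"
  unfolding clamp1_def clamp2_def using abs_cos_le_one abs_sin_le_one by simp_all

lemma test_function_clamp:
  assumes s: "smooth23 (-1) (T + 1) \<psi> \<psi>t \<psi>tt \<psi>x \<psi>xx \<psi>xxx" and T: "0 < T"
  shows "test_function (\<lambda>t x. \<psi> (clamp T t) x)"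
proof -
  define \<chi>t where "\<chi>t t x = \<psi>t (clamp T t) x * clamp1 T t" for t x
  define \<chi>tt where "\<chi>tt t x = \<psi>tt (clamp T t) x * clamp1 T t * clamp1 T t + \<psi>t (clamp T t) x * clamp2 T t" for t x
  have c: "continuous_on ({0<..} \<times> UNIV) (\<lambda>p. h (clamp T (fst p)) (snd p))"
    and b: "\<exists>B. \<forall>t>0. \<forall>x. \<bar>h (clamp T t) x\<bar> \<le> B"
    if h: "h \<in> {\<psi>, \<psi>t, \<psi>tt, \<psi>x, \<psi>xx, \<psi>xxx}" for h
  proof -
    have "continuous_on ({0<..} \<times> UNIV) (\<lambda>p. (\<lambda>p. h (fst p) (snd p)) (clamp T (fst p), snd p))"
      by (rule continuous_on_compose2[OF smooth23_cont(1)[OF s h]])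
         (auto intro!: continuous_intros continuous_on_compose2[OF clamp_cont(1)[of UNIV]])
    then show "continuous_on ({0<..} \<times> UNIV) (\<lambda>p. h (clamp T (fst p)) (snd p))" by simp
    show "\<exists>B. \<forall>t>0. \<forall>x. \<bar>h (clamp T t) x\<bar> \<le> B"
      using smooth23_cont(2)[OF s h] clamp_range[OF _ T] by blast
  qed
  have cc: "continuous_on ({0<..} \<times> UNIV) (\<lambda>p. clamp1 T (fst p))" "continuous_on ({0<..} \<times> UNIV) (\<lambda>p. clamp2 T (fst p))"
    by (auto intro!: continuous_intros continuous_on_compose2[OF clamp_cont(2)[of UNIV]] continuous_on_compose2[OF clamp_cont(3)[of UNIV]])
  have bddI: "bounded ((\<lambda>(t, x). g t x) ` ({0<..} \<times> UNIV))" if "\<forall>t>0. \<forall>x. \<bar>g t x\<bar> \<le> B" for g :: "real \<Rightarrow> real \<Rightarrow> real" and B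
    using that by (auto simp: bounded_iff intro!: exI[of _ B])
  obtain Bt where Bt: "\<forall>t>0. \<forall>x. \<bar>\<psi>t (clamp T t) x\<bar> \<le> Bt" using b[of \<psi>t] by blast
  obtain Btt where Btt: "\<forall>t>0. \<forall>x. \<bar>\<psi>tt (clamp T t) x\<bar> \<le> Btt" using b[of \<psi>tt] by blast
  have bt: "\<forall>t>0. \<forall>x. \<bar>\<chi>t t x\<bar> \<le> Bt * 1"
  proof (intro allI impI)
    fix t x :: real assume t: "0 < t"
    show "\<bar>\<chi>t t x\<bar> \<le> Bt * 1" unfolding abs_mult \<chi>t_def
      using Bt t clamp_bounds(1) by (intro mult_mono) (auto intro: order_trans[OF abs_ge_zero])
  qed
  have btt: "\<forall>t>0. \<forall>x. \<bar>\<chi>tt t x\<bar> \<le> Btt * 1 * 1 + Bt * 1"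
  proof (intro allI impI)
    fix t x :: real assume t: "0 < t"
    have "\<bar>\<psi>tt (clamp T t) x * clamp1 T t * clamp1 T t\<bar> \<le> Btt * 1 * 1" unfolding abs_mult
      using Btt t clamp_bounds(1) by (intro mult_mono) (auto intro: order_trans[OF abs_ge_zero])
    moreover have "\<bar>\<psi>t (clamp T t) x * clamp2 T t\<bar> \<le> Bt * 1" unfolding abs_mult
      using Bt t clamp_bounds(2) by (intro mult_mono) (auto intro: order_trans[OF abs_ge_zero])
    ultimately show "\<bar>\<chi>tt t x\<bar> \<le> Btt * 1 * 1 + Bt * 1" unfolding \<chi>tt_def by linarith
  qed
  have key: "continuous_on ({0<..} \<times> UNIV) (\<lambda>(t, x). h (clamp T t) x) \<and> bounded ((\<lambda>(t, x). h (clamp T t) x) ` ({0<..} \<times> UNIV))"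
    if h: "h \<in> {\<psi>, \<psi>t, \<psi>tt, \<psi>x, \<psi>xx, \<psi>xxx}" for h
  proof
    show "continuous_on ({0<..} \<times> UNIV) (\<lambda>(t, x). h (clamp T t) x)" using c[OF h] by (simp add: split_beta)
    obtain B where "\<forall>t>0. \<forall>x. \<bar>h (clamp T t) x\<bar> \<le> B" using b[OF h] by blast
    then show "bounded ((\<lambda>(t, x). h (clamp T t) x) ` ({0<..} \<times> UNIV))" by (rule bddI)
  qed
  have kt: "continuous_on ({0<..} \<times> UNIV) (\<lambda>(t, x). \<chi>t t x) \<and> bounded ((\<lambda>(t, x). \<chi>t t x) ` ({0<..} \<times> UNIV))"
    using bddI[OF bt] c[of \<psi>t] cc by (auto simp: \<chi>t_def split_beta intro!: continuous_on_mult)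
  have ktt: "continuous_on ({0<..} \<times> UNIV) (\<lambda>(t, x). \<chi>tt t x) \<and> bounded ((\<lambda>(t, x). \<chi>tt t x) ` ({0<..} \<times> UNIV))"
    using bddI[OF btt] c[of \<psi>t] c[of \<psi>tt] cc by (auto simp: \<chi>tt_def split_beta intro!: continuous_on_mult continuous_on_add)
  show ?thesis unfolding test_function_def ball_simps
  proof (intro exI conjI allI impI)
    fix t x :: real
    show d1: "((\<lambda>s. \<psi> (clamp T s) x) has_real_derivative \<chi>t t x) (at t)"
      unfolding \<chi>t_def by (rule DERIV_chain2[OF smooth23_D(1)[OF s] clamp_deriv(1)])
    have "((\<lambda>s. \<psi>t (clamp T s) x) has_real_derivative \<psi>tt (clamp T t) x * clamp1 T t) (at t)"
      by (rule DERIV_chain2[OF smooth23_D(2)[OF s] clamp_deriv(1)])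
    from DERIV_mult[OF this clamp_deriv(2)]
    show "((\<lambda>s. \<chi>t s x) has_real_derivative \<chi>tt t x) (at t)"
      unfolding \<chi>t_def \<chi>tt_def by (rule DERIV_cong) (simp add: algebra_simps)
    show "(\<psi> (clamp T t) has_real_derivative \<psi>x (clamp T t) x) (at x)" by (rule smooth23_D(3)[OF s])
    show "(\<psi>x (clamp T t) has_real_derivative \<psi>xx (clamp T t) x) (at x)" by (rule smooth23_D(4)[OF s])
    show "(\<psi>xx (clamp T t) has_real_derivative \<psi>xxx (clamp T t) x) (at x)" by (rule smooth23_D(5)[OF s])
  qed (use key kt ktt in auto)
qed

lemma c11_cmult: assumes "c11 L1 L2 f f'" "0 \<le> c" shows "c11 (c * L1) (c * L2) (\<lambda>x. c * f x) (\<lambda>x. c * f' x)"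
  unfolding c11_def
proof (intro conjI allI)
  fix x
  show "((\<lambda>x. c * f x) has_real_derivative c * f' x) (at x)" by (intro DERIV_cmult c11_D(1)[OF assms(1)])
  show "\<bar>c * f' x\<bar> \<le> c * L1" using c11_D(2)[OF assms(1), of x] assms(2) by (simp add: abs_mult mult_left_mono)
next
  show "lip (c * L2) (\<lambda>x. c * f' x)" unfolding lip_def
  proof (intro allI)
    fix x y
    have "\<bar>c * f' x - c * f' y\<bar> = c * \<bar>f' x - f' y\<bar>"
      using assms(2) by (simp add: abs_mult flip: right_diff_distrib)
    also have "\<dots> \<le> c * (L2 * \<bar>x - y\<bar>)" by (intro mult_left_mono lipD[OF c11_D(3)[OF assms(1)]] assms(2))
    finally show "\<bar>c * f' x - c * f' y\<bar> \<le> c * L2 * \<bar>x - y\<bar>" by simp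
  qed
qed

lemma av3_le:
  assumes "bm f" "0 \<le> b" "\<And>y. x \<le> y \<Longrightarrow> y \<le> x + 3 * b \<Longrightarrow> f y \<le> c"
  shows "av3 b f x \<le> c"
  unfolding av3_def
proof (rule av_le)
  fix s1 assume s1: "0 \<le> s1" "s1 \<le> b"
  show "av b (av b f) (x + s1) \<le> c"
  proof (rule av_le)
    fix s2 assume s2: "0 \<le> s2" "s2 \<le> b"
    show "av b f (x + s1 + s2) \<le> c"
      by (rule av_le) (use assms s1 s2 in auto)
  qed (use assms unif.bm_sm in auto)
qed (use assms unif.bm_sm in auto)

lemma av_uminus: "av b (\<lambda>x. - f x) = (\<lambda>x. - av b f x)"
  by (intro ext) (simp add: sm_def)

lemma av3_uminus: "av3 b (\<lambda>x. - f x) = (\<lambda>x. - av3 b f x)"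
  unfolding av3_def av_uminus ..

lemma bm_uminus: assumes "bm f" shows "bm (\<lambda>x. - f x)"
proof -
  obtain B where B: "\<And>x. \<bar>f x\<bar> \<le> B" using bm_bound[OF assms] by metis
  note [measurable] = bm_measurable[OF assms]
  show ?thesis by (rule bmI[of _ B]) (use B in simp_all)
qed

lemma av3_ge:
  assumes "bm f" "0 \<le> b" "\<And>y. x \<le> y \<Longrightarrow> y \<le> x + 3 * b \<Longrightarrow> c \<le> f y"
  shows "c \<le> av3 b f x"
proof -
  have "av3 b (\<lambda>x. - f x) x \<le> - c"
    by (rule av3_le[OF bm_uminus[OF assms(1)] assms(2)]) (use assms(3) in auto)
  then show ?thesis by (simp add: av3_uminus)
qed

context stable_scheme begin

lemma gen_diff:
  assumes f: "c11 L1 L2 f f'" and g: "c11 M1 M2 g g'" and k: "k \<in> K \<times> K"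
  shows "gen \<alpha> k (\<lambda>x. f x - g x + e) (\<lambda>x. f' x - g' x) x = gen \<alpha> k f f' x - gen \<alpha> k g g' x"
proof -
  have "gen \<alpha> k (\<lambda>x. f x - g x + e) (\<lambda>x. f' x - g' x) x
      = (\<integral>z. (f (x + z) - f x - f' x * z) - (g (x + z) - g x - g' x * z) \<partial>stable_levy_measure \<alpha> k)"
    unfolding gen_def by (intro Bochner_Integration.integral_cong refl) (simp add: algebra_simps)
  also have "\<dots> = gen \<alpha> k f f' x - gen \<alpha> k g g' x"
    unfolding gen_def by (rule Bochner_Integration.integral_diff[OF gen_props(1)[OF f k] gen_props(1)[OF g k]])
  finally show ?thesis .
qed

lemma gen_const_pos: "0 < gen_const"
proof -
  obtain k where "k \<in> K" using K by blast
  then have "0 < \<Lambda>" using K by force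
  then show ?thesis using alpha unfolding gen_const_def by (intro add_pos_pos divide_pos_pos) auto
qed

text \<open>The function min(1, |x| / R) averaged three times over windows of length 1, which look
  ahead by 3; hence the two shifts by 3. Its slopes are of order 1 / R, so its generator is as small
  as desired, while it still reaches height 1 far out.\<close>

lemma penalty:
  assumes "0 < R"
  shows "\<exists>\<kappa> \<kappa>1 \<kappa>2 \<kappa>3 G. (\<forall>x. (\<kappa> has_real_derivative \<kappa>1 x) (at x) \<and> (\<kappa>1 has_real_derivative \<kappa>2 x) (at x) \<and> (\<kappa>2 has_real_derivative \<kappa>3 x) (at x))
    \<and> continuous_on UNIV \<kappa>3 \<and> (\<forall>x. \<bar>\<kappa> x\<bar> \<le> G \<and> \<bar>\<kappa>1 x\<bar> \<le> G \<and> \<bar>\<kappa>2 x\<bar> \<le> G \<and> \<bar>\<kappa>3 x\<bar> \<le> G)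
    \<and> c11 (1 / R) (2 / R) \<kappa> \<kappa>1 \<and> (\<forall>x. 0 \<le> \<kappa> x) \<and> (\<forall>x. \<kappa> x \<le> (\<bar>x\<bar> + 3) / R) \<and> (\<forall>x. R + 3 \<le> \<bar>x\<bar> \<longrightarrow> 1 \<le> \<kappa> x)"
proof -
  define f where "f x = min 1 (\<bar>x\<bar> / R)" for x
  have fl: "lip (1 / R) f" unfolding lip_def
  proof (intro allI)
    fix x y :: real
    have "\<bar>min 1 a - min 1 b\<bar> \<le> \<bar>a - b\<bar>" for a b :: real by linarith
    then have "\<bar>f x - f y\<bar> \<le> \<bar>\<bar>x\<bar> / R - \<bar>y\<bar> / R\<bar>" unfolding f_def .
    also have "\<dots> = \<bar>\<bar>x\<bar> - \<bar>y\<bar>\<bar> / R" using assms by (simp flip: diff_divide_distrib)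
    also have "\<dots> \<le> \<bar>x - y\<bar> / R" using assms by (intro divide_right_mono abs_triangle_ineq3) auto
    finally show "\<bar>f x - f y\<bar> \<le> 1 / R * \<bar>x - y\<bar>" by simp
  qed
  have fb: "0 \<le> f x" "f x \<le> 1" for x using assms by (auto simp: f_def)
  have bm: "bm f" by (rule bmI[OF lip_measurable[OF fl], of 1]) (use fb in auto)
  note c = av3_c11[OF bm fl, of 1, simplified]
  have c1: "c11 (1 / R) (2 / R) (av3 1 f) (av3_1 1 f)" using c(1) by simp
  have a0: "0 \<le> av3 1 f x" "av3 1 f x \<le> 1" for x
    by (rule av3_ge[OF bm], use fb in auto)[1] (rule av3_le[OF bm], use fb in auto)
  have a1: "av3 1 f x \<le> (\<bar>x\<bar> + 3) / R" for x
  proof (rule av3_le[OF bm])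
    fix y assume "x \<le> y" "y \<le> x + 3 * 1"
    then have "\<bar>y\<bar> / R \<le> (\<bar>x\<bar> + 3) / R" using assms by (intro divide_right_mono) auto
    then show "f y \<le> (\<bar>x\<bar> + 3) / R" by (simp add: f_def)
  qed simp
  have a2: "1 \<le> av3 1 f x" if "R + 3 \<le> \<bar>x\<bar>" for x
  proof (rule av3_ge[OF bm])
    fix y assume "x \<le> y" "y \<le> x + 3 * 1"
    then have "R \<le> \<bar>y\<bar>" using that by linarith
    then show "1 \<le> f y" using assms by (simp add: f_def)
  qed simp
  have R: "0 < 4 / R" using assms by simp
  show ?thesis
  proof (intro exI conjI allI impI)
    show "c11 (1 / R) (2 / R) (av3 1 f) (av3_1 1 f)" by (rule c1)
    fix x
    show "(av3 1 f has_real_derivative av3_1 1 f x) (at x)" by (rule c11_D(1)[OF c1])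
    show "(av3_1 1 f has_real_derivative av3_2 1 f x) (at x)" by (rule c11_D(1)[OF c(2)])
    show "(av3_2 1 f has_real_derivative av3_3 1 f x) (at x)" by (rule c(3))
    show "continuous_on UNIV (av3_3 1 f)" by (rule c(5))
    have g: "1 / R \<le> 4 / R" "2 / R \<le> 4 / R" using assms by (auto intro!: divide_right_mono)
    show "\<bar>av3 1 f x\<bar> \<le> 1 + 4 / R" using a0[of x] R by linarith
    show "\<bar>av3_1 1 f x\<bar> \<le> 1 + 4 / R" using c11_D(2)[OF c1, of x] g by linarith
    show "\<bar>av3_2 1 f x\<bar> \<le> 1 + 4 / R" using c11_D(2)[OF c(2), of x] g by linarith
    show "\<bar>av3_3 1 f x\<bar> \<le> 1 + 4 / R" using c(4)[of x] by linarith
  qed (use a0 a1 a2 in auto)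
qed

text \<open>A function that starts below \<open>u\<close> at time \<open>s\<close> and later exceeds it is modified so that it touches
\<open>u\<close> from below: a bounded penalty in space forces the maximum of the difference to be attained,
and a multiple of the cube of the positive part of \<open>t0 - t\<close> is subtracted to stay below
\<open>u\<close> also before time \<open>s\<close>.\<close>

lemma touching:
  assumes T: "0 < T" and u: "continuous_on ({0..T} \<times> UNIV) (\<lambda>p. u (fst p) (snd p))"
    and uB: "\<And>t x. t \<in> {0..T} \<Longrightarrow> \<bar>u t x\<bar> \<le> B"
    and s23: "smooth23 (-1) (T + 1) \<psi> \<psi>t \<psi>tt \<psi>x \<psi>xx \<psi>xxx"
    and s: "0 \<le> s" and init: "\<And>x. \<psi> s x \<le> u s x"
    and above: "s \<le> t'" "t' \<le> T" "u t' x' < \<psi> t' x'" and eta: "0 < \<eta>"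
  shows "\<exists>t0 x0 w wt wtt wx wxx wxxx. smooth23 (-1) (T + 1) w wt wtt wx wxx wxxx \<and> s < t0 \<and> t0 \<le> T \<and>
    (\<forall>t\<in>{0<..T}. \<forall>y. w t y \<le> u t y) \<and> w t0 x0 = u t0 x0 \<and> u t0 x0 < \<psi> t0 x0 \<and> wt t0 x0 = \<psi>t t0 x0 \<and>
    (\<forall>k\<in>K \<times> K. gen \<alpha> k (\<psi> t0) (\<psi>x t0) x0 - \<eta> \<le> gen \<alpha> k (w t0) (wx t0) x0)"
proof -
  obtain A0 where A0: "\<forall>t\<in>{-1..T+1}. \<forall>x. \<bar>\<psi> t x\<bar> \<le> A0" using smooth23_cont(2)[OF s23, of \<psi>] by blast
  \<comment> \<open>With this height the penalized difference is negative wherever the penalty has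
    reached 1.\<close>
  define A where "A = A0 + B + 1"
  have B0: "0 \<le> B" using uB[of 0 0] T by auto
  have A00: "0 \<le> A0" using A0 T by (metis abs_ge_zero atLeastAtMost_iff order_trans less_eq_real_def add_increasing2 zero_le_one neg_le_0_iff_le)
  have Apos: "0 < A" using B0 A00 by (simp add: A_def)
  define m0 where "m0 = \<psi> t' x' - u t' x'"
  have m0: "0 < m0" using above by (simp add: m0_def)
  \<comment> \<open>The terms ensure, in this order, that \<open>x'\<close> lies in the box, that
    the penalty at \<open>x'\<close> stays below the excess \<open>m0\<close>, and that the
    generator of the penalty is at most \<eta>.\<close>
  define R where "R = \<bar>x'\<bar> + 1 + A * (\<bar>x'\<bar> + 3) / m0 + A * gen_const * 3 / \<eta>"
  have Rge: "\<bar>x'\<bar> + 1 \<le> R" "A * (\<bar>x'\<bar> + 3) / m0 < R" "A * gen_const * 3 / \<eta> \<le> R"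
  proof -
    have "0 \<le> A * (\<bar>x'\<bar> + 3) / m0" "0 \<le> A * gen_const * 3 / \<eta>" using Apos m0 gen_const_pos eta by auto
    then show "\<bar>x'\<bar> + 1 \<le> R" "A * (\<bar>x'\<bar> + 3) / m0 < R" "A * gen_const * 3 / \<eta> \<le> R" unfolding R_def by linarith+
  qed
  have R: "0 < R" using Rge(1) by linarith
  obtain \<kappa> \<kappa>1 \<kappa>2 \<kappa>3 G where d\<kappa>: "\<And>x. (\<kappa> has_real_derivative \<kappa>1 x) (at x)" "\<And>x. (\<kappa>1 has_real_derivative \<kappa>2 x) (at x)" "\<And>x. (\<kappa>2 has_real_derivative \<kappa>3 x) (at x)"
    and c\<kappa>: "continuous_on UNIV \<kappa>3" and b\<kappa>: "\<And>x. \<bar>\<kappa> x\<bar> \<le> G" "\<And>x. \<bar>\<kappa>1 x\<bar> \<le> G" "\<And>x. \<bar>\<kappa>2 x\<bar> \<le> G" "\<And>x. \<bar>\<kappa>3 x\<bar> \<le> G"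
    and cc: "c11 (1 / R) (2 / R) \<kappa> \<kappa>1" and \<kappa>0: "\<And>x. 0 \<le> \<kappa> x" and \<kappa>R: "\<And>x. \<kappa> x \<le> (\<bar>x\<bar> + 3) / R" "\<And>x. R + 3 \<le> \<bar>x\<bar> \<Longrightarrow> 1 \<le> \<kappa> x"
    using penalty[OF R] by blast
  define \<Phi> where "\<Phi> t x = \<psi> t x - A * \<kappa> x - u t x" for t x
  let ?D = "{s..T} \<times> {-(R+3)..R+3}"
  have cont: "continuous_on ?D (\<lambda>p. \<Phi> (fst p) (snd p))"
  proof -
    have "continuous_on UNIV \<kappa>" using d\<kappa>(1) by (meson DERIV_continuous_on has_field_derivative_at_within)
    then have "continuous_on ?D (\<lambda>p. \<kappa> (snd p))"
      by (rule continuous_on_subset[OF continuous_fst_snd(2)]) simp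
    moreover have "continuous_on ?D (\<lambda>p. \<psi> (fst p) (snd p))"
      by (rule continuous_on_subset[OF smooth23_cont(1)[OF s23, of \<psi>]]) simp_all
    moreover have "continuous_on ?D (\<lambda>p. u (fst p) (snd p))"
      by (rule continuous_on_subset[OF u]) (use s in auto)
    ultimately show ?thesis unfolding \<Phi>_def
      by (intro continuous_on_diff continuous_on_mult continuous_on_const)
  qed
  have in': "(t', x') \<in> ?D" using above Rge(1) by auto
  obtain p0 where p0: "p0 \<in> ?D" "\<forall>p\<in>?D. \<Phi> (fst p) (snd p) \<le> \<Phi> (fst p0) (snd p0)"
  proof -
    have "compact ?D" "?D \<noteq> {}" using in' by (auto intro: compact_Times)
    from continuous_attains_sup[OF this cont] that show ?thesis by blast
  qed
  define t0 x0 where "t0 = fst p0" and "x0 = snd p0"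
  define m where "m = \<Phi> t0 x0"
  have t0: "s \<le> t0" "t0 \<le> T" using p0(1) by (auto simp: t0_def)
  have st: "s \<le> T" using above by simp
  have "0 < \<Phi> t' x'"
  proof -
    have "A * \<kappa> x' \<le> A * ((\<bar>x'\<bar> + 3) / R)" using Apos \<kappa>R(1) by (intro mult_left_mono) auto
    also have "\<dots> < m0"
    proof -
      have "A * (\<bar>x'\<bar> + 3) < R * m0" using Rge(2) m0 by (simp add: pos_divide_less_eq)
      then show ?thesis using R by (simp add: pos_divide_less_eq mult.commute)
    qed
    finally show ?thesis by (simp add: \<Phi>_def m0_def)
  qed
  then have m: "0 < m" using p0(2)[rule_format, OF in'] by (simp add: m_def t0_def x0_def)
  have psi_le: "\<psi> t x \<le> A0" if "t \<in> {-1..T+1}" for t x using A0 that by (meson abs_le_D1)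
  have max: "\<Phi> t x \<le> m" if t: "s \<le> t" "t \<le> T" for t x
  proof (cases "\<bar>x\<bar> \<le> R + 3")
    case True
    then have "(t, x) \<in> ?D" using t by auto
    then show ?thesis using p0(2) by (auto simp: m_def t0_def x0_def)
  next
    case False
    then have "A * 1 \<le> A * \<kappa> x" using Apos \<kappa>R(2)[of x] by (intro mult_left_mono) auto
    moreover have "- u t x \<le> B" using uB[of t x] t s by (auto simp: abs_le_iff)
    moreover have "\<psi> t x \<le> A0" using psi_le t s by auto
    ultimately show ?thesis using m by (simp add: \<Phi>_def A_def)
  qed
  have t0s: "s < t0"
  proof (rule ccontr)
    assume "\<not> s < t0" then have "t0 = s" using t0 by simp
    then have "m \<le> - A * \<kappa> x0" using init[of x0] by (simp add: m_def \<Phi>_def)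
    then show False using m Apos \<kappa>0[of x0] by (smt (verit) mult_nonneg_nonneg mult_minus_left)
  qed
  \<comment> \<open>At times up to \<open>s\<close> the cubic term then exceeds the total range
    \<open>A0 + B\<close>.\<close>
  define Q where "Q = (A0 + B) / (t0 - s) ^ 3"
  have Q0: "0 \<le> Q" using A00 B0 t0s by (simp add: Q_def)
  \<comment> \<open>Subtracting \<open>m\<close> makes the maximum a contact; the cube has zero
    slope at \<open>t0\<close>, so the time derivative there is still that of
    \<open>\<psi>\<close>.\<close>
  define p where "p t = - m - Q * (max 0 (t0 - t)) ^ 3" for t
  define p1 where "p1 t = Q * (3 * (max 0 (t0 - t))\<^sup>2)" for t
  define p2 where "p2 t = - Q * (6 * max 0 (t0 - t))" for t
  have cube: "((\<lambda>x. x ^ 3) has_real_derivative 3 * x\<^sup>2) (at x)" for x :: real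
    by (auto intro!: derivative_eq_intros)
  have sq: "((\<lambda>x. 3 * x\<^sup>2) has_real_derivative 6 * x) (at x)" for x :: real
    by (auto intro!: derivative_eq_intros)
  have dm: "((\<lambda>t. t0 - t) has_real_derivative -1) (at t)" for t
    by (auto intro!: derivative_eq_intros)
  have p: "(p has_real_derivative p1 t) (at t)" "(p1 has_real_derivative p2 t) (at t)" "continuous_on UNIV p2" for t
  proof -
    have "((\<lambda>t. (max 0 (t0 - t)) ^ 3) has_real_derivative 3 * (max 0 (t0 - t))\<^sup>2 * -1) (at t)"
      by (rule DERIV_chain2[OF DERIV_pos_part[OF cube] dm]) simp
    then have "(p has_real_derivative 0 - Q * (3 * (max 0 (t0 - t))\<^sup>2 * -1)) (at t)"
      unfolding p_def[abs_def] by (intro DERIV_diff DERIV_const DERIV_cmult)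
    then show "(p has_real_derivative p1 t) (at t)" by (simp add: p1_def)
    have "((\<lambda>t. 3 * (max 0 (t0 - t))\<^sup>2) has_real_derivative 6 * max 0 (t0 - t) * -1) (at t)"
      by (rule DERIV_chain2[OF DERIV_pos_part[OF sq] dm]) simp
    then have "(p1 has_real_derivative Q * (6 * max 0 (t0 - t) * -1)) (at t)"
      unfolding p1_def[abs_def] by (intro DERIV_cmult)
    then show "(p1 has_real_derivative p2 t) (at t)" by (simp add: p2_def)
    show "continuous_on UNIV p2" unfolding p2_def[abs_def] by (intro continuous_intros)
  qed
  define w where "w t x = \<psi> t x + (- A) * \<kappa> x + p t" for t x
  note S1 = smooth23_add_mult[OF s23 DERIV_const DERIV_const continuous_on_const d\<kappa> c\<kappa> b\<kappa>, of "- A"]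
  note S2 = smooth23_add_time[OF S1 p, folded w_def]
  have w_le: "w t y \<le> u t y" if t: "t \<in> {0<..T}" for t y
  proof (cases "s \<le> t")
    case True
    have "p t \<le> - m" using Q0 by (simp add: p_def)
    then show ?thesis using max[OF True, of y] t by (simp add: w_def \<Phi>_def)
  next
    case False
    have "Q * (t0 - s) ^ 3 \<le> Q * (max 0 (t0 - t)) ^ 3"
      using Q0 False t0s by (intro mult_left_mono power_mono) auto
    moreover have "Q * (t0 - s) ^ 3 = A0 + B" using t0s by (simp add: Q_def)
    moreover have "0 \<le> A * \<kappa> y" using Apos \<kappa>0 by simp
    moreover have "\<psi> t y \<le> A0" using psi_le t by auto
    moreover have "- B \<le> u t y" using uB[of t y] t by (auto simp: abs_le_iff)
    ultimately show ?thesis using m by (simp add: w_def p_def)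
  qed
  have eqs: "w t0 x0 = u t0 x0" by (simp add: w_def p_def m_def \<Phi>_def)
  have above0: "u t0 x0 < \<psi> t0 x0"
    using m Apos \<kappa>0[of x0] by (smt (verit) m_def \<Phi>_def mult_nonneg_nonneg)
  have t0r: "-1 \<le> t0" "t0 \<le> T + 1" using s t0 by auto
  obtain L1 L2 where cpsi: "c11 L1 L2 (\<psi> t0) (\<psi>x t0)" using smooth23_c11[OF s23 t0r] by blast
  have gw: "gen \<alpha> k (\<psi> t0) (\<psi>x t0) x0 - \<eta> \<le> gen \<alpha> k (w t0) (\<lambda>x. \<psi>x t0 x + (- A) * \<kappa>1 x) x0" if k: "k \<in> K \<times> K" for k
  proof -
    have cA: "c11 (A * (1 / R)) (A * (2 / R)) (\<lambda>x. A * \<kappa> x) (\<lambda>x. A * \<kappa>1 x)" by (rule c11_cmult[OF cc]) (use Apos in simp)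
    have "gen \<alpha> k (\<lambda>x. \<psi> t0 x - A * \<kappa> x + p t0) (\<lambda>x. \<psi>x t0 x - A * \<kappa>1 x) x0 = gen \<alpha> k (\<psi> t0) (\<psi>x t0) x0 - gen \<alpha> k (\<lambda>x. A * \<kappa> x) (\<lambda>x. A * \<kappa>1 x) x0"
      by (rule gen_diff[OF cpsi cA k])
    moreover have "gen \<alpha> k (\<lambda>x. A * \<kappa> x) (\<lambda>x. A * \<kappa>1 x) x0 \<le> \<eta>"
    proof -
      have "gen \<alpha> k (\<lambda>x. A * \<kappa> x) (\<lambda>x. A * \<kappa>1 x) x0 \<le> gen_const * (A * (1 / R) + A * (2 / R))"
        using gen_props(3)[OF cA k, of x0] by linarith
      also have "\<dots> = A * gen_const * 3 / R" by (simp add: field_simps)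
      also have "\<dots> \<le> \<eta>" using Rge(3) R eta by (simp add: field_simps)
      finally show ?thesis .
    qed
    ultimately show ?thesis by (simp add: w_def[abs_def])
  qed
  show ?thesis
    by (intro exI conjI, rule S2, rule t0s, rule t0(2), use w_le in blast, rule eqs, rule above0, simp add: p1_def, use gw in blast)
qed

end

section \<open>Averages in time and space\<close>

definition TA :: "real \<Rightarrow> (real \<Rightarrow> real \<Rightarrow> real) \<Rightarrow> real \<Rightarrow> real \<Rightarrow> real" where "TA h f t x = av h (\<lambda>s. f s x) t"
definition XA :: "real \<Rightarrow> (real \<Rightarrow> real \<Rightarrow> real) \<Rightarrow> real \<Rightarrow> real \<Rightarrow> real" where "XA b f t x = av b (f t) x"
definition TD :: "real \<Rightarrow> (real \<Rightarrow> real \<Rightarrow> real) \<Rightarrow> real \<Rightarrow> real \<Rightarrow> real" where "TD h f t x = dq h (\<lambda>s. f s x) t"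
definition XD :: "real \<Rightarrow> (real \<Rightarrow> real \<Rightarrow> real) \<Rightarrow> real \<Rightarrow> real \<Rightarrow> real" where "XD b f t x = dq b (f t) x"

lemma TA_smt: "TA h = smt unif h" and XA_smx: "XA b = smx unif b"
  by (intro ext, simp add: TA_def smt_def, intro ext, simp add: XA_def smx_def)

lemma unif_dist: "real_distribution unif" ..

definition xlip :: "real \<Rightarrow> (real \<Rightarrow> real \<Rightarrow> real) \<Rightarrow> bool" where "xlip L f \<longleftrightarrow> (\<forall>t. lip L (f t))"
definition tlip :: "real \<Rightarrow> (real \<Rightarrow> real \<Rightarrow> real) \<Rightarrow> bool" where "tlip L f \<longleftrightarrow> (\<forall>x. lip L (\<lambda>t. f t x))"

lemma bm2_XA: "bm2 f \<Longrightarrow> bm2 (XA b f)" and bm2_TA: "bm2 f \<Longrightarrow> bm2 (TA b f)"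
  unfolding TA_smt XA_smx using bm2_smx bm2_smt unif_dist by blast+

lemma bm2_lin:
  assumes f: "bm2 f" and g: "bm2 g" shows "bm2 (\<lambda>t x. (f t x - g t x) / h)"
proof -
  obtain A where A: "\<And>t x. \<bar>f t x\<bar> \<le> A" using bm2_bound[OF f] by metis
  obtain B where B: "\<And>t x. \<bar>g t x\<bar> \<le> B" using bm2_bound[OF g] by metis
  have [measurable]: "(\<lambda>p. f (fst p) (snd p)) \<in> borel_measurable (borel \<Otimes>\<^sub>M borel)" "(\<lambda>p. g (fst p) (snd p)) \<in> borel_measurable (borel \<Otimes>\<^sub>M borel)"
    using bm2_measurable[OF f measurable_fst measurable_snd] bm2_measurable[OF g measurable_fst measurable_snd] by blast+
  show ?thesis
  proof (rule bm2I)
    show "(\<lambda>p. (f (fst p) (snd p) - g (fst p) (snd p)) / h) \<in> borel_measurable (borel \<Otimes>\<^sub>M borel)" by measurable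
    show "\<bar>(f t x - g t x) / h\<bar> \<le> (A + B) / \<bar>h\<bar>" for t x
      using A[of t x] B[of t x] by (simp add: abs_divide divide_right_mono)
  qed
qed

lemma bm2_shift: assumes "bm2 f" shows "bm2 (\<lambda>t x. f (t + c) (x + d))"
proof -
  obtain A where A: "\<And>t x. \<bar>f t x\<bar> \<le> A" using bm2_bound[OF assms] by metis
  show ?thesis
  proof (rule bm2I[of _ A])
    show "(\<lambda>p. f (fst p + c) (snd p + d)) \<in> borel_measurable (borel \<Otimes>\<^sub>M borel)"
      by (rule bm2_measurable[OF assms]) simp_all
  qed (rule A)
qed

lemma bm2_XD: assumes "bm2 f" shows "bm2 (XD b f)"
  using bm2_lin[OF bm2_shift[OF assms, of 0 b] assms, of b] by (simp add: XD_def[abs_def] dq_def)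
lemma bm2_TD: assumes "bm2 f" shows "bm2 (TD b f)"
  using bm2_lin[OF bm2_shift[OF assms, of b 0] assms, of b] by (simp add: TD_def[abs_def] dq_def)

lemma bm2_diff: assumes "bm2 f" "bm2 g" shows "bm2 (\<lambda>t x. f t x - g t x)"
  using bm2_lin[OF assms, of 1] by simp

lemma lip_av_param:
  assumes "\<And>x. bm (\<lambda>s. G s x)" "\<And>s. lip L (\<lambda>x. G s x)"
  shows "lip L (\<lambda>x. av h (\<lambda>s. G s x) t)"
  unfolding lip_def
proof (intro allI)
  fix x y
  have "av h (\<lambda>s. G s x) t - av h (\<lambda>s. G s y) t = av h (\<lambda>s. G s x - G s y) t"
    by (rule unif.sm_diff[symmetric]) (rule assms(1))+
  also have "\<bar>\<dots>\<bar> \<le> L * \<bar>x - y\<bar>" by (rule unif.sm_abs_le) (rule lipD[OF assms(2)])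
  finally show "\<bar>av h (\<lambda>s. G s x) t - av h (\<lambda>s. G s y) t\<bar> \<le> L * \<bar>x - y\<bar>" .
qed

lemma lip_dq_param:
  assumes "\<And>s. lip L (\<lambda>x. G s x)" "0 < h"
  shows "lip (2 * L / h) (\<lambda>x. dq h (\<lambda>s. G s x) t)"
  unfolding lip_def
proof (intro allI)
  fix x y
  have "\<bar>(G (t + h) x - G t x) - (G (t + h) y - G t y)\<bar> \<le> 2 * L * \<bar>x - y\<bar>"
    using lipD[OF assms(1), of "t + h" x y] lipD[OF assms(1), of t x y] by linarith
  then have "\<bar>(G (t + h) x - G t x) - (G (t + h) y - G t y)\<bar> / h \<le> 2 * L * \<bar>x - y\<bar> / h"
    using assms(2) by (intro divide_right_mono) auto
  then show "\<bar>dq h (\<lambda>s. G s x) t - dq h (\<lambda>s. G s y) t\<bar> \<le> 2 * L / h * \<bar>x - y\<bar>"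
    unfolding dq_def using assms(2) by (simp add: diff_divide_distrib[symmetric])
qed

lemma xlip_TA: "bm2 f \<Longrightarrow> xlip L f \<Longrightarrow> xlip L (TA h f)"
  unfolding xlip_def TA_def by (intro allI lip_av_param bm2_slices) auto
lemma tlip_XA: "bm2 f \<Longrightarrow> tlip L f \<Longrightarrow> tlip L (XA h f)"
  unfolding tlip_def XA_def by (intro allI lip_av_param[of "\<lambda>x t. f t x"] bm2_slices) auto
lemma xlip_XA: "bm2 f \<Longrightarrow> xlip L f \<Longrightarrow> xlip L (XA h f)"
  unfolding xlip_def XA_def[abs_def] by (intro allI av_lip_lip bm2_slices) auto
lemma tlip_TA: "bm2 f \<Longrightarrow> tlip L f \<Longrightarrow> tlip L (TA h f)"
  unfolding tlip_def TA_def[abs_def] by (intro allI av_lip_lip bm2_slices) auto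
lemma xlip_TD: "xlip L f \<Longrightarrow> 0 < h \<Longrightarrow> xlip (2 * L / h) (TD h f)"
  unfolding xlip_def TD_def[abs_def] by (intro allI lip_dq_param) auto
lemma tlip_XD: "tlip L f \<Longrightarrow> 0 < h \<Longrightarrow> tlip (2 * L / h) (XD h f)"
  unfolding tlip_def XD_def[abs_def] by (intro allI lip_dq_param[of L "\<lambda>x t. f t x"]) auto
lemma xlip_XD: "xlip L f \<Longrightarrow> 0 < h \<Longrightarrow> xlip (2 * L / h) (XD h f)"
  unfolding xlip_def XD_def[abs_def] by (intro allI dq_lip) auto
lemma tlip_TD: "tlip L f \<Longrightarrow> 0 < h \<Longrightarrow> tlip (2 * L / h) (TD h f)"
  unfolding tlip_def TD_def[abs_def] by (intro allI dq_lip) auto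

lemma tlip_TA_bm: assumes "bm2 f" "0 < h" obtains M where "tlip M (TA h f)"
proof -
  obtain A where A: "\<And>t x. \<bar>f t x\<bar> \<le> A" using bm2_bound[OF assms(1)] by metis
  have "tlip (2 * A / h) (TA h f)" unfolding tlip_def TA_def[abs_def]
    by (intro allI av_lip[OF bm2_slices(2)[OF assms(1)] A assms(2)])
  then show ?thesis by (rule that)
qed

text \<open>This class is closed under averages and difference quotients and consists of jointly
  continuous bounded functions. Smoothness of an iterated average thus reduces to membership of its
  innermost term.\<close>

definition good :: "(real \<Rightarrow> real \<Rightarrow> real) \<Rightarrow> bool" where
  "good f \<longleftrightarrow> bm2 f \<and> (\<exists>L. xlip L f) \<and> (\<exists>M. tlip M f)"

lemma good_ops: assumes "good f" "0 < h"
  shows "good (XA h f)" "good (TA h f)" "good (XD h f)" "good (TD h f)"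
  using assms bm2_XA bm2_TA bm2_XD bm2_TD xlip_TA tlip_XA xlip_XA tlip_TA xlip_TD tlip_XD xlip_XD tlip_TD
  unfolding good_def by meson+

lemma good_TA: assumes "bm2 f" "xlip L f" "0 < h" shows "good (TA h f)"
  using tlip_TA_bm[OF assms(1,3)] bm2_TA[OF assms(1)] xlip_TA[OF assms(1,2)] unfolding good_def by metis

lemma good_continuous: assumes "good f" shows "continuous_on UNIV (\<lambda>p. f (fst p) (snd p))"
proof -
  obtain L M where L: "xlip L f" and M: "tlip M f" using assms by (auto simp: good_def)
  have "((\<lambda>q. f (fst q) (snd q)) \<longlongrightarrow> f (fst p) (snd p)) (at p)" for p :: "real \<times> real"
  proof (rule LIM_zero_cancel, rule Lim_null_comparison)
    show "\<forall>\<^sub>F q in at p. norm (f (fst q) (snd q) - f (fst p) (snd p)) \<le> M * \<bar>fst q - fst p\<bar> + L * \<bar>snd q - snd p\<bar>"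
    proof (intro always_eventually allI)
      fix q :: "real \<times> real"
      have "lip M (\<lambda>t. f t (snd q))" "lip L (f (fst p))" using L M by (auto simp: xlip_def tlip_def)
      from lipD[OF this(1), of "fst q" "fst p"] lipD[OF this(2), of "snd q" "snd p"]
      show "norm (f (fst q) (snd q) - f (fst p) (snd p)) \<le> M * \<bar>fst q - fst p\<bar> + L * \<bar>snd q - snd p\<bar>"
        unfolding real_norm_def by linarith
    qed
    show "((\<lambda>q. M * \<bar>fst q - fst p\<bar> + L * \<bar>snd q - snd p\<bar>) \<longlongrightarrow> 0) (at p)"
      by (auto intro!: tendsto_eq_intros)
  qed
  then show ?thesis by (simp add: continuous_on_def)
qed

lemma TA_XA: "bm2 f \<Longrightarrow> TA h (XA b f) = XA b (TA h f)"
  unfolding TA_smt XA_smx by (rule smt_smx[OF unif_dist unif_dist])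

definition VA :: "real \<Rightarrow> real \<Rightarrow> (real \<Rightarrow> real \<Rightarrow> real) \<Rightarrow> real \<Rightarrow> real \<Rightarrow> real" where
  "VA h b f = TA h (TA h (TA h (XA b (XA b (XA b f)))))"

text \<open>The form with space averages outermost, from which the space derivatives are computed;
  the definition itself has the time averages outermost.\<close>

lemma VA_alt: assumes "bm2 f" shows "VA h b f = XA b (XA b (XA b (TA h (TA h (TA h f)))))"
  unfolding VA_def by (simp add: TA_XA bm2_XA bm2_TA assms)

lemma VA_x: assumes "bm2 f" shows "VA h b f t = av3 b (TA h (TA h (TA h f)) t)"
  unfolding VA_alt[OF assms] by (intro ext) (simp add: XA_def[abs_def] av3_def)

lemma VA_t: "VA h b f t x = av3 h (\<lambda>s. av3 b (f s) x) t"
  unfolding VA_def by (simp add: TA_def[abs_def] XA_def[abs_def] av3_def)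

definition VAt where "VAt h b f = TD h (TA h (TA h (XA b (XA b (XA b f)))))"
definition VAtt where "VAtt h b f = TD h (TD h (TA h (XA b (XA b (XA b f)))))"
definition VAx where "VAx h b f = XD b (XA b (XA b (TA h (TA h (TA h f)))))"
definition VAxx where "VAxx h b f = XD b (XD b (XA b (TA h (TA h (TA h f)))))"
definition VAxxx where "VAxxx h b f = XD b (XD b (XD b (TA h (TA h (TA h f)))))"

lemma TA_deriv: assumes "good f" "0 < h" shows "((\<lambda>s. TA h f s x) has_real_derivative TD h f t x) (at t)"
proof -
  obtain M where "tlip M f" using assms by (auto simp: good_def)
  then have "lip M (\<lambda>t. f t x)" by (simp add: tlip_def)
  from av_dq[OF lip_continuous[OF this] assms(2)] show ?thesis by (simp add: TA_def[abs_def] TD_def)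
qed

lemma XA_deriv: assumes "good f" "0 < h" shows "(XA h f t has_real_derivative XD h f t x) (at x)"
proof -
  obtain M where "xlip M f" using assms by (auto simp: good_def)
  then have "lip M (f t)" by (simp add: xlip_def)
  from av_dq[OF lip_continuous[OF this] assms(2)] show ?thesis by (simp add: XA_def[abs_def] XD_def)
qed

lemma TD_deriv: assumes "\<And>t. ((\<lambda>s. f s x) has_real_derivative f' t x) (at t)"
  shows "((\<lambda>s. TD h f s x) has_real_derivative TD h f' t x) (at t)"
  unfolding TD_def[abs_def] by (rule dq_has_derivative[OF assms])

lemma XD_deriv: assumes "\<And>x. (f t has_real_derivative f' t x) (at x)"
  shows "(XD h f t has_real_derivative XD h f' t x) (at x)"
  unfolding XD_def[abs_def] by (rule dq_has_derivative[OF assms])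

lemma VA_smooth:
  assumes f: "bm2 f" "xlip L f" and hb: "0 < h" "0 < b"
  shows "smooth23 a c (VA h b f) (VAt h b f) (VAtt h b f) (VAx h b f) (VAxx h b f) (VAxxx h b f)"
proof -
  note x3 = bm2_XA[OF bm2_XA[OF bm2_XA[OF f(1)]]]
  have l3: "xlip L (XA b (XA b (XA b f)))" by (intro xlip_XA bm2_XA f)
  \<comment> \<open>Since \<open>f\<close> may jump in time, the innermost time average is used up
    here to gain Lipschitz continuity; two remain for the two time derivatives.\<close>
  have g1: "good (TA h (XA b (XA b (XA b f))))" by (rule good_TA[OF x3 l3 hb(1)])
  have t3: "good (TA h (TA h (TA h f)))" by (intro good_ops good_TA[OF f] hb)
  have G: "good (VA h b f)" "good (VAt h b f)" "good (VAtt h b f)" "good (VAx h b f)" "good (VAxx h b f)" "good (VAxxx h b f)"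
    unfolding VA_def VAt_def VAtt_def VAx_def VAxx_def VAxxx_def
    by (intro good_ops g1 t3 hb)+
  have bnd: "continuous_on UNIV (\<lambda>p. g (fst p) (snd p)) \<and> (\<exists>B. \<forall>t\<in>{a..c}. \<forall>x. \<bar>g t x\<bar> \<le> B)" if "good g" for g
    using good_continuous[OF that] that unfolding good_def bm2_def by blast
  have D: "((\<lambda>s. VA h b f s x) has_real_derivative VAt h b f t x) (at t)"
    "((\<lambda>s. VAt h b f s x) has_real_derivative VAtt h b f t x) (at t)"
    "(VA h b f t has_real_derivative VAx h b f t x) (at x)"
    "(VAx h b f t has_real_derivative VAxx h b f t x) (at x)"
    "(VAxx h b f t has_real_derivative VAxxx h b f t x) (at x)" for t x
    unfolding VAt_def VAtt_def VA_def VAx_def VAxx_def VAxxx_def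
    subgoal by (intro TA_deriv good_ops g1 hb)
    subgoal by (intro TD_deriv TA_deriv good_ops g1 hb)
    subgoal unfolding VA_alt[OF f(1), unfolded VA_def] by (intro XA_deriv good_ops t3 hb)
    subgoal by (intro XD_deriv XA_deriv good_ops t3 hb)
    subgoal by (intro XD_deriv XA_deriv good_ops t3 hb)
    done
  show ?thesis unfolding smooth23_def ball_simps
    by (intro conjI allI D) (simp_all add: bnd G)
qed

lemma VA_c11:
  assumes f: "bm2 f" "xlip L f" and hb: "0 < h" "0 < b"
  shows "c11 L (2 * L / b) (VA h b f t) (VAx h b f t)" "c11 (2 * L / b) (4 * L / b\<^sup>2) (VAx h b f t) (VAxx h b f t)"
proof -
  let ?P = "TA h (TA h (TA h f))"
  have P: "bm2 ?P" "xlip L ?P" by (intro bm2_TA xlip_TA f)+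
  have e: "VA h b f t = av3 b (?P t)" "VAx h b f t = av3_1 b (?P t)" "VAxx h b f t = av3_2 b (?P t)"
    unfolding VA_x[OF f(1)] VAx_def VAxx_def by (intro ext; simp add: XA_def[abs_def] XD_def[abs_def] av3_1_def av3_2_def)+
  have "bm (?P t)" "lip L (?P t)" using P bm2_slices by (auto simp: xlip_def)
  from av3_c11(1,2)[OF this hb(2)] show "c11 L (2 * L / b) (VA h b f t) (VAx h b f t)" "c11 (2 * L / b) (4 * L / b\<^sup>2) (VAx h b f t) (VAxx h b f t)"
    unfolding e by auto
qed

lemma VA_le:
  assumes f: "bm2 f" and hb: "0 \<le> h" "0 \<le> b"
    and le: "\<And>s y. t \<le> s \<Longrightarrow> s \<le> t + 3 * h \<Longrightarrow> x \<le> y \<Longrightarrow> y \<le> x + 3 * b \<Longrightarrow> f s y \<le> c"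
  shows "VA h b f t x \<le> c"
proof -
  have e: "(\<lambda>s. av3 b (f s) x) = (\<lambda>s. XA b (XA b (XA b f)) s x)"
    by (simp add: XA_def[abs_def] av3_def)
  have bm: "bm (\<lambda>s. av3 b (f s) x)" unfolding e by (intro bm2_slices bm2_XA f)
  show ?thesis unfolding VA_t
  proof (rule av3_le[OF bm hb(1)])
    fix s assume "t \<le> s" "s \<le> t + 3 * h"
    then show "av3 b (f s) x \<le> c" by (intro av3_le[OF bm2_slices(1)[OF f] hb(2)] le) auto
  qed
qed

lemma av3_diff: "bm f \<Longrightarrow> bm g \<Longrightarrow> av3 b (\<lambda>x. f x - g x) = (\<lambda>x. av3 b f x - av3 b g x)"
proof -
  have e: "av b (\<lambda>x. f x - g x) = (\<lambda>x. av b f x - av b g x)" if "bm f" "bm g" for f g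
    using unif.sm_diff[OF that] by blast
  assume "bm f" "bm g"
  then show ?thesis unfolding av3_def by (simp add: e unif.bm_sm)
qed

lemma av3_shift: "av3 b (\<lambda>x. f (x + c)) x = av3 b f (x + c)"
proof -
  have e: "av b (\<lambda>x. f (x + c)) = (\<lambda>x. av b f (x + c))" for f :: "real \<Rightarrow> real"
    by (intro ext) (rule unif.sm_shift)
  show ?thesis unfolding av3_def e ..
qed

lemma VA_diff: assumes "bm2 f" "bm2 g" shows "VA h b (\<lambda>t x. f t x - g t x) t x = VA h b f t x - VA h b g t x"
proof -
  have e: "(\<lambda>s. av3 b (f s) x) = (\<lambda>s. XA b (XA b (XA b f)) s x)" for f
    by (simp add: XA_def[abs_def] av3_def)
  have bm: "bm (\<lambda>s. av3 b (f s) x)" if "bm2 f" for f unfolding e using that by (intro bm2_slices bm2_XA)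
  have "VA h b (\<lambda>t x. f t x - g t x) t x = av3 h (\<lambda>s. av3 b (f s) x - av3 b (g s) x) t"
    unfolding VA_t av3_diff[OF bm2_slices(1)[OF assms(1)] bm2_slices(1)[OF assms(2)]] ..
  also have "\<dots> = VA h b f t x - VA h b g t x"
    unfolding VA_t av3_diff[OF bm[OF assms(1)] bm[OF assms(2)]] ..
  finally show ?thesis .
qed

lemma VA_tshift: "VA h b (\<lambda>t x. f (t + c) x) t x = VA h b f (t + c) x"
  unfolding VA_t using av3_shift[of h "\<lambda>s. av3 b (f s) x" c t] by simp

lemma VA_uminus: "VA h b (\<lambda>t x. - f t x) t x = - VA h b f t x"
  unfolding VA_t av3_uminus ..

lemma bm2_uminus: assumes "bm2 f" shows "bm2 (\<lambda>t x. - f t x)"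
proof -
  have "bm2 (\<lambda>t x. 0)" by (rule bm2I[of _ 0]) auto
  from bm2_diff[OF this assms] show ?thesis by simp
qed

lemma VA_ge:
  assumes f: "bm2 f" and hb: "0 \<le> h" "0 \<le> b"
    and le: "\<And>s y. t \<le> s \<Longrightarrow> s \<le> t + 3 * h \<Longrightarrow> x \<le> y \<Longrightarrow> y \<le> x + 3 * b \<Longrightarrow> c \<le> f s y"
  shows "c \<le> VA h b f t x"
  using VA_le[OF bm2_uminus[OF f] hb, of t x "- c"] le by (simp add: VA_uminus)

text \<open>Averaging is monotone and commutes with shifts. The inequality is asked only for times
  in the window of length 3 h, so that it can be applied to functions whose inequality is known on
  \<open>{0..T}\<close> only.\<close>

lemma VA_compare:
  assumes f: "bm2 f" and g: "bm2 g" and hb: "0 \<le> h" "0 \<le> b"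
    and le: "\<And>s y. t \<le> s \<Longrightarrow> s \<le> t + 3 * h \<Longrightarrow> g s y - \<kappa> \<le> f (s + d) y"
  shows "VA h b g t x - \<kappa> \<le> VA h b f (t + d) x"
proof -
  have f': "bm2 (\<lambda>t x. f (t + d) x)" using bm2_shift[OF f, of d 0] by simp
  have "VA h b (\<lambda>t x. g t x - f (t + d) x) t x \<le> \<kappa>"
    by (rule VA_le[OF bm2_diff[OF g f'] hb]) (use le in \<open>auto simp: algebra_simps\<close>)
  then show ?thesis by (simp add: VA_diff[OF g f'] VA_tshift[of h b f])
qed

lemma VA_smx: assumes "real_distribution M" "bm2 f" shows "smx M d (VA h b f) = VA h b (smx M d f)"
  unfolding VA_def TA_smt XA_smx
  by (simp add: smt_smx[OF unif_dist assms(1), symmetric] smx_smx[OF assms(1) unif_dist] bm2_smx bm2_smt unif_dist assms)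

text \<open>Two of the three time averages become difference quotients, so the second derivative is
  a second difference of the remaining average over h^2. The oscillation over one window suffices as
  input, which functions with jumps in time also provide.\<close>

lemma VAtt_bound:
  assumes f: "bm2 f" and hb: "0 < h" and osc: "\<And>s y. \<bar>f (s + h) y - f s y\<bar> \<le> \<omega>"
  shows "\<bar>VAtt h b f t x\<bar> \<le> 2 * \<omega> / h\<^sup>2"
proof -
  define G where "G = TA h (XA b (XA b (XA b f)))"
  have x3: "XA b (XA b (XA b f)) s x = av3 b (f s) x" for s x by (simp add: XA_def[abs_def] av3_def)
  have g1: "\<bar>av3 b (f (s + h)) x - av3 b (f s) x\<bar> \<le> \<omega>" for s x
  proof -
    have "av3 b (f (s + h)) x - av3 b (f s) x = av3 b (\<lambda>y. f (s + h) y - f s y) x"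
      by (simp add: av3_diff bm2_slices[OF f])
    also have "\<bar>\<dots>\<bar> \<le> \<omega>" unfolding av3_def by (intro unif.sm_abs_le osc)
    finally show ?thesis .
  qed
  have bmG: "bm (\<lambda>s. av3 b (f s) x)" for x unfolding x3[symmetric] by (intro bm2_slices bm2_XA f)
  have g2: "\<bar>G (s + h) x - G s x\<bar> \<le> \<omega>" for s x
  proof -
    have "G (s + h) x - G s x = av h (\<lambda>s. av3 b (f (s + h)) x - av3 b (f s) x) s"
      unfolding G_def TA_def x3
      by (simp add: unif.sm_diff[OF bm_shift[OF bmG] bmG] unif.sm_shift[of h "\<lambda>s. av3 b (f s) x" h])
    also have "\<bar>\<dots>\<bar> \<le> \<omega>" by (intro unif.sm_abs_le g1)
    finally show ?thesis .
  qed
  have "VAtt h b f t x = ((G (t + h + h) x - G (t + h) x) - (G (t + h) x - G t x)) / h\<^sup>2"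
    unfolding VAtt_def G_def[symmetric] TD_def dq_def using hb by (simp add: field_simps power2_eq_square)
  also have "\<bar>\<dots>\<bar> \<le> (\<omega> + \<omega>) / h\<^sup>2"
    unfolding abs_divide using g2[of "t + h" x] g2[of t x] by (simp add: divide_right_mono)
  finally show ?thesis by simp
qed

lemma taylor_bound:
  assumes "\<And>x. (f has_real_derivative f' x) (at x)" "\<And>x. (f' has_real_derivative f'' x) (at x)" "\<And>x. \<bar>f'' x\<bar> \<le> M" "0 \<le> d"
  shows "\<bar>f (t + d) - f t - d * f' t\<bar> \<le> M * d\<^sup>2 / 2"
proof (cases "d = 0")
  case False
  then have d: "0 < d" using assms by simp
  have "\<exists>t'>t. t' < t + d \<and> f (t + d) = (\<Sum>m<2. (if m = 0 then f else if m = 1 then f' else f'') t / fact m * (t + d - t) ^ m) + (if (2::nat) = 0 then f else if (2::nat) = 1 then f' else f'') t' / fact 2 * (t + d - t) ^ 2"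
    by (rule Taylor_up[where n = 2 and diff = "\<lambda>m. if m = 0 then f else if m = 1 then f' else f''" and b = "t + d" and a = t and c = t])
       (use d assms(1,2) in \<open>auto simp: less_2_cases_iff\<close>)
  then obtain t' where "f (t + d) = f t + f' t * d + f'' t' / 2 * d\<^sup>2"
    by (auto simp: numeral_2_eq_2)
  then have "\<bar>f (t + d) - f t - d * f' t\<bar> = \<bar>f'' t'\<bar> * d\<^sup>2 / 2" by (simp add: abs_mult)
  also have "\<dots> \<le> M * d\<^sup>2 / 2" using assms(3) by (intro divide_right_mono mult_right_mono) auto
  finally show ?thesis .
qed simp

context stable_scheme begin

lemma gen_uminus: "gen \<alpha> k (\<lambda>x. - f x) (\<lambda>x. - f' x) x = - gen \<alpha> k f f' x"
proof -
  have "gen \<alpha> k (\<lambda>x. - f x) (\<lambda>x. - f' x) x = (\<integral>z. - (f (x + z) - f x - f' x * z) \<partial>stable_levy_measure \<alpha> k)"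
    unfolding gen_def by (intro Bochner_Integration.integral_cong refl) simp
  also have "\<dots> = - gen \<alpha> k f f' x" unfolding gen_def by (rule Bochner_Integration.integral_minus)
  finally show ?thesis .
qed

lemma KK_ne: "K \<times> K \<noteq> {}" using K by auto

section \<open>Upper bound\<close>

lemma pide_clamp:
  assumes s: "smooth23 (-1) (T + 1) w wt wtt wx wxx wxxx" and t: "0 < t" "t \<le> T"
  shows "pide_operator \<alpha> K (\<lambda>t x. w (clamp T t) x) t x = wt t x - (SUP k\<in>K \<times> K. gen \<alpha> k (w t) (wx t) x)"
    and "bdd_above ((\<lambda>k. gen \<alpha> k (w t) (wx t) x) ` (K \<times> K))"
proof -
  have "((\<lambda>s. w (clamp T s) x) has_real_derivative wt (clamp T t) x * clamp1 T t) (at t)"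
    by (rule DERIV_chain2[OF smooth23_D(1)[OF s] clamp_deriv(1)])
  then have "deriv (\<lambda>s. w (clamp T s) x) t = wt t x"
    using t by (simp add: DERIV_imp_deriv clamp_id)
  moreover have "deriv (w t) x = wx t x" by (rule DERIV_imp_deriv[OF smooth23_D(3)[OF s]])
  ultimately show "pide_operator \<alpha> K (\<lambda>t x. w (clamp T t) x) t x = wt t x - (SUP k\<in>K \<times> K. gen \<alpha> k (w t) (wx t) x)"
    using t by (simp add: pide_operator_def delta_def clamp_id gen_def)
  obtain L1 L2 where c: "c11 L1 L2 (w t) (wx t)" using smooth23_c11[OF s, of t] t by auto
  show "bdd_above ((\<lambda>k. gen \<alpha> k (w t) (wx t) x) ` (K \<times> K))"
    by (rule bdd_aboveI2[of _ _ "gen_const * (L1 + L2)"]) (use gen_props(3)[OF c] in \<open>auto simp: abs_le_iff\<close>)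
qed

text \<open>The supremum in the operator dominates every member, so the inequality holds for all
  \<open>k\<close> at the same point. That \<open>\<psi>\<close> exceeds \<open>u\<close> there is
  kept in the conclusion because it is what later confines the contact time.\<close>

lemma super_touch:
  assumes T: "0 < T" and u: "continuous_on ({0..T} \<times> UNIV) (\<lambda>p. u (fst p) (snd p))"
    and vs: "viscosity_supersolution \<alpha> K T \<phi> u"
    and s23: "smooth23 (-1) (T + 1) \<psi> \<psi>t \<psi>tt \<psi>x \<psi>xx \<psi>xxx"
    and s: "0 \<le> s" and init: "\<And>x. \<psi> s x \<le> u s x"
    and above: "s \<le> t'" "t' \<le> T" "u t' x' < \<psi> t' x'" and eta: "0 < \<eta>"
  shows "\<exists>t0 x0. s < t0 \<and> t0 \<le> T \<and> u t0 x0 < \<psi> t0 x0 \<and> (\<forall>k\<in>K \<times> K. gen \<alpha> k (\<psi> t0) (\<psi>x t0) x0 - \<eta> \<le> \<psi>t t0 x0)"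
proof -
  have "bounded ((\<lambda>(t, x). u t x) ` ({0..T} \<times> UNIV))" using vs by (simp add: viscosity_supersolution_def)
  then obtain B where "\<forall>t\<in>{0..T}. \<forall>x. \<bar>u t x\<bar> \<le> B" by (auto simp: bounded_iff)
  then have B: "\<And>t x. t \<in> {0..T} \<Longrightarrow> \<bar>u t x\<bar> \<le> B" by blast
  obtain t0 x0 w wt wtt wx wxx wxxx where w: "smooth23 (-1) (T + 1) w wt wtt wx wxx wxxx" and t0: "s < t0" "t0 \<le> T"
    and le: "\<forall>t\<in>{0<..T}. \<forall>y. w t y \<le> u t y" and eq: "w t0 x0 = u t0 x0" and lt: "u t0 x0 < \<psi> t0 x0" and wt: "wt t0 x0 = \<psi>t t0 x0"
    and g: "\<forall>k\<in>K \<times> K. gen \<alpha> k (\<psi> t0) (\<psi>x t0) x0 - \<eta> \<le> gen \<alpha> k (w t0) (wx t0) x0"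
    using touching[where u = u and \<psi> = \<psi>, OF T u B s23 s init above eta] by blast
  have t00: "0 < t0" using s t0 by simp
  have "0 \<le> pide_operator \<alpha> K (\<lambda>t x. w (clamp T t) x) t0 x0"
  proof -
    have "test_function (\<lambda>t x. w (clamp T t) x)" by (rule test_function_clamp[OF w T])
    moreover have "\<forall>s\<in>{0<..T}. \<forall>y. w (clamp T s) y \<le> u s y" using le by (simp add: clamp_id)
    moreover have "w (clamp T t0) x0 = u t0 x0" using eq t0 by (simp add: clamp_id)
    moreover have "t0 \<in> {0<..T}" using t00 t0 by simp
    ultimately show ?thesis using vs unfolding viscosity_supersolution_def by blast
  qed
  then have "(SUP k\<in>K \<times> K. gen \<alpha> k (w t0) (wx t0) x0) \<le> \<psi>t t0 x0"
    unfolding pide_clamp(1)[OF w t00 t0(2)] wt by simp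
  then have "gen \<alpha> k (w t0) (wx t0) x0 \<le> \<psi>t t0 x0" if "k \<in> K \<times> K" for k
    using cSUP_upper[OF that pide_clamp(2)[OF w t00 t0(2)], of x0] by linarith
  then show ?thesis using t0 lt g by (meson order_trans)
qed

text \<open>The contact argument is applied to \<open>- u\<close> and \<open>- \<psi>\<close>. Now
  the supremum bounds from above, and a nearly maximal \<open>k\<close> must be picked; half of
  \<eta> pays for this choice, the other half for the contact function.\<close>

lemma sub_touch:
  assumes T: "0 < T" and u: "continuous_on ({0..T} \<times> UNIV) (\<lambda>p. u (fst p) (snd p))"
    and vs: "viscosity_subsolution \<alpha> K T \<phi> u"
    and s23: "smooth23 (-1) (T + 1) \<psi> \<psi>t \<psi>tt \<psi>x \<psi>xx \<psi>xxx"
    and s: "0 \<le> s" and init: "\<And>x. u s x \<le> \<psi> s x"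
    and above: "s \<le> t'" "t' \<le> T" "\<psi> t' x' < u t' x'" and eta: "0 < \<eta>"
  shows "\<exists>t0 x0. \<exists>k\<in>K \<times> K. s < t0 \<and> t0 \<le> T \<and> \<psi>t t0 x0 \<le> gen \<alpha> k (\<psi> t0) (\<psi>x t0) x0 + \<eta>"
proof -
  have "bounded ((\<lambda>(t, x). u t x) ` ({0..T} \<times> UNIV))" using vs by (simp add: viscosity_subsolution_def)
  then obtain B where "\<forall>t\<in>{0..T}. \<forall>x. \<bar>- u t x\<bar> \<le> B" by (auto simp: bounded_iff)
  then have B: "\<And>t x. t \<in> {0..T} \<Longrightarrow> \<bar>- u t x\<bar> \<le> B" by blast
  have eta2: "0 < \<eta> / 2" using eta by simp
  have u': "continuous_on ({0..T} \<times> UNIV) (\<lambda>p. - u (fst p) (snd p))" by (rule continuous_on_minus[OF u])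
  have init': "- \<psi> s x \<le> - u s x" for x using init by simp
  have above': "- u t' x' < - \<psi> t' x'" using above by simp
  obtain t0 x0 w wt wtt wx wxx wxxx where w: "smooth23 (-1) (T + 1) w wt wtt wx wxx wxxx" and t0: "s < t0" "t0 \<le> T"
    and le: "\<forall>t\<in>{0<..T}. \<forall>y. w t y \<le> - u t y" and eq: "w t0 x0 = - u t0 x0" and wt: "wt t0 x0 = - \<psi>t t0 x0"
    and g: "\<forall>k\<in>K \<times> K. gen \<alpha> k (\<lambda>x. - \<psi> t0 x) (\<lambda>x. - \<psi>x t0 x) x0 - \<eta> / 2 \<le> gen \<alpha> k (w t0) (wx t0) x0"
    using touching[where u = "\<lambda>t x. - u t x" and \<psi> = "\<lambda>t x. - \<psi> t x", OF T u' B smooth23_uminus[OF s23] s init' above(1,2) above' eta2] by blast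
  have t00: "0 < t0" using s t0 by simp
  note w' = smooth23_uminus[OF w]
  have "pide_operator \<alpha> K (\<lambda>t x. - w (clamp T t) x) t0 x0 \<le> 0"
  proof -
    have "test_function (\<lambda>t x. - w (clamp T t) x)" by (rule test_function_clamp[OF w' T])
    moreover have "\<forall>s\<in>{0<..T}. \<forall>y. u s y \<le> - w (clamp T s) y" using le by (simp add: clamp_id le_minus_iff)
    moreover have "- w (clamp T t0) x0 = u t0 x0" using eq t0 by (simp add: clamp_id)
    moreover have "t0 \<in> {0<..T}" using t00 t0 by simp
    ultimately show ?thesis using vs unfolding viscosity_subsolution_def by blast
  qed
  then have "\<psi>t t0 x0 \<le> (SUP k\<in>K \<times> K. gen \<alpha> k (\<lambda>x. - w t0 x) (\<lambda>x. - wx t0 x) x0)"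
    unfolding pide_clamp(1)[OF w' t00 t0(2)] wt by simp
  then have "\<psi>t t0 x0 - \<eta> / 2 < (SUP k\<in>K \<times> K. gen \<alpha> k (\<lambda>x. - w t0 x) (\<lambda>x. - wx t0 x) x0)" using eta by simp
  then obtain k where k: "k \<in> K \<times> K" "\<psi>t t0 x0 - \<eta> / 2 < gen \<alpha> k (\<lambda>x. - w t0 x) (\<lambda>x. - wx t0 x) x0"
    using less_cSUP_iff[OF KK_ne pide_clamp(2)[OF w' t00 t0(2)]] by blast
  have "gen \<alpha> k (\<lambda>x. - w t0 x) (\<lambda>x. - wx t0 x) x0 \<le> gen \<alpha> k (\<psi> t0) (\<psi>x t0) x0 + \<eta> / 2"
    using g[rule_format, OF k(1)] by (simp add: gen_uminus)
  then have "\<psi>t t0 x0 \<le> gen \<alpha> k (\<psi> t0) (\<psi>x t0) x0 + \<eta>" using k(2) by linarith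
  then show ?thesis using k(1) t0 by blast
qed

text \<open>The scheme in closed form. It makes sense beyond \<open>T\<close> and equals \<phi> at
  negative times, so averages that look ahead can be applied to it directly.\<close>

definition walk :: "real \<Rightarrow> (real \<Rightarrow> real) \<Rightarrow> real \<Rightarrow> real \<Rightarrow> real" where
  "walk \<Delta> \<phi> t = (S (K \<times> K) \<Delta> ^^ nat \<lfloor>t / \<Delta>\<rfloor>) \<phi>"

definition time_mod :: "real \<Rightarrow> real \<Rightarrow> real" where
  "time_mod \<Delta> s = sqrt (2 * I1 \<Delta> * s) + 2 * I2 \<Delta> * s"

abbreviation "ID \<Delta> \<equiv> I_Delta \<alpha> K \<beta>1 \<beta>2 \<Delta>"

text \<open>The square root needs 2 c \<le> r^2 and the linear part c \<le> r, with e \<le> 1;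
  together they form \<open>I_Delta\<close>. The fractions in later uses are such pairs: (3/4, 5/4),
  (5/4, 8/5), (13/10, 13/8) and (7/4, 15/8).\<close>

lemma time_mod_le:
  assumes t: "0 < \<Delta>" "\<Delta> < 1" and e: "0 \<le> e" "e \<le> 1" and c: "0 \<le> c" "c \<le> r" "2 * c \<le> r\<^sup>2" and s: "0 \<le> s" "s \<le> c * e\<^sup>2"
  shows "time_mod \<Delta> s \<le> r * ID \<Delta> * e"
proof -
  note I = I_bounds(3,4)[OF t]
  have r: "0 \<le> r" using c by simp
  have "sqrt (2 * I1 \<Delta> * s) \<le> sqrt ((r\<^sup>2 * e\<^sup>2) * I1 \<Delta>)"
  proof (rule real_sqrt_le_mono)
    have "2 * s \<le> 2 * (c * e\<^sup>2)" using s by simp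
    also have "\<dots> = (2 * c) * e\<^sup>2" by simp
    also have "\<dots> \<le> r\<^sup>2 * e\<^sup>2" using c by (intro mult_right_mono) auto
    finally have "2 * s * I1 \<Delta> \<le> r\<^sup>2 * e\<^sup>2 * I1 \<Delta>" using I by (intro mult_right_mono) auto
    then show "2 * I1 \<Delta> * s \<le> r\<^sup>2 * e\<^sup>2 * I1 \<Delta>" by (simp add: ac_simps)
  qed
  also have "\<dots> = r * e * sqrt (I1 \<Delta>)" using r e by (simp add: real_sqrt_mult)
  finally have 1: "sqrt (2 * I1 \<Delta> * s) \<le> r * e * sqrt (I1 \<Delta>)" .
  have "s \<le> r * e"
  proof -
    have "c * e\<^sup>2 \<le> r * e" using c e by (intro mult_mono) (auto simp: power2_eq_square mult_left_le_one_le)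
    then show ?thesis using s by simp
  qed
  then have "2 * I2 \<Delta> * s \<le> 2 * I2 \<Delta> * (r * e)" using I by (intro mult_left_mono) auto
  then show ?thesis using 1 unfolding time_mod_def I_Delta_def by (simp add: algebra_simps)
qed

lemma I_Delta_nonneg: assumes "0 < \<Delta>" "\<Delta> < 1" shows "0 \<le> ID \<Delta>"
  unfolding I_Delta_def using I_bounds(3,4)[OF assms] by simp

lemma walk_steps:
  assumes d: "0 < \<Delta>" "\<Delta> < 1" and phi: "lip L \<phi>" and s: "0 < s" "real n * \<Delta> \<le> s"
  shows "\<bar>(S (K \<times> K) \<Delta> ^^ (n + m)) \<phi> x - (S (K \<times> K) \<Delta> ^^ m) \<phi> x\<bar> \<le> L * time_mod \<Delta> s"
proof -
  let ?S = "S (K \<times> K) \<Delta>"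
  have "(?S ^^ (n + m)) \<phi> = (?S ^^ n) ((?S ^^ m) \<phi>)" by (simp add: funpow_add)
  then show ?thesis
    using S_pow_near_sqrt[OF order_refl KK_ne S_pow_lip[OF order_refl KK_ne phi d] d s] by (simp add: time_mod_def)
qed

text \<open>Rounding both times down to the grid may add one step, hence the extra \<Delta>.\<close>

lemma walk_near:
  assumes d: "0 < \<Delta>" "\<Delta> < 1" and phi: "lip L \<phi>" and ts: "t \<le> t'" "t' - t + \<Delta> \<le> s"
  shows "\<bar>walk \<Delta> \<phi> t' x - walk \<Delta> \<phi> t x\<bar> \<le> L * time_mod \<Delta> s"
proof -
  define n where "n = nat \<lfloor>t' / \<Delta>\<rfloor> - nat \<lfloor>t / \<Delta>\<rfloor>"
  have le: "nat \<lfloor>t / \<Delta>\<rfloor> \<le> nat \<lfloor>t' / \<Delta>\<rfloor>" using ts d by (intro nat_mono floor_mono divide_right_mono) auto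
  have "real n \<le> (t' - t) / \<Delta> + 1"
  proof -
    have "of_int \<lfloor>t' / \<Delta>\<rfloor> \<le> t' / \<Delta>" "t / \<Delta> - 1 \<le> of_int \<lfloor>t / \<Delta>\<rfloor>" by linarith+
    then have "of_int \<lfloor>t' / \<Delta>\<rfloor> - of_int \<lfloor>t / \<Delta>\<rfloor> \<le> (t' - t) / \<Delta> + 1" unfolding diff_divide_distrib by linarith
    moreover have "int n \<le> max 0 (\<lfloor>t' / \<Delta>\<rfloor> - \<lfloor>t / \<Delta>\<rfloor>)" unfolding n_def using le by linarith
    moreover have "0 \<le> (t' - t) / \<Delta>" using ts d by simp
    ultimately show ?thesis by linarith
  qed
  then have "real n * \<Delta> \<le> ((t' - t) / \<Delta> + 1) * \<Delta>" using d by (intro mult_right_mono) auto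
  also have "\<dots> = t' - t + \<Delta>" using d by (simp add: field_simps)
  finally have "real n * \<Delta> \<le> s" using ts by simp
  moreover have "0 < s" using ts d by simp
  moreover have "nat \<lfloor>t' / \<Delta>\<rfloor> = n + nat \<lfloor>t / \<Delta>\<rfloor>" using le by (simp add: n_def)
  ultimately show ?thesis using walk_steps[OF d phi] unfolding walk_def by simp
qed

lemma walk_init:
  assumes d: "0 < \<Delta>" "\<Delta> < 1" and phi: "lip L \<phi>" and ts: "0 \<le> t" "t \<le> s" "0 < s"
  shows "\<bar>walk \<Delta> \<phi> t x - \<phi> x\<bar> \<le> L * time_mod \<Delta> s"
proof -
  have "real (nat \<lfloor>t / \<Delta>\<rfloor>) \<le> t / \<Delta>" using ts d by (simp add: floor_divide_lower)
  then have "real (nat \<lfloor>t / \<Delta>\<rfloor>) * \<Delta> \<le> t / \<Delta> * \<Delta>" using d by (intro mult_right_mono) auto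
  also have "\<dots> \<le> s" using ts d by simp
  finally have "real (nat \<lfloor>t / \<Delta>\<rfloor>) * \<Delta> \<le> s" .
  from walk_steps[OF d phi ts(3) this, of 0] show ?thesis by (simp add: walk_def)
qed

lemma walk_step: assumes "0 < \<Delta>" "0 \<le> t" shows "walk \<Delta> \<phi> (t + \<Delta>) = S (K \<times> K) \<Delta> (walk \<Delta> \<phi> t)"
proof -
  have "nat \<lfloor>(t + \<Delta>) / \<Delta>\<rfloor> = Suc (nat \<lfloor>t / \<Delta>\<rfloor>)"
    using assms by (simp add: add_divide_distrib nat_add_distrib)
  then show ?thesis by (simp add: walk_def)
qed

lemma walk_bm2:
  assumes d: "0 < \<Delta>" "\<Delta> < 1" and phi: "lip L \<phi>" "\<And>x. \<bar>\<phi> x\<bar> \<le> B"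
  shows "bm2 (walk \<Delta> \<phi>)" "xlip L (walk \<Delta> \<phi>)"
proof -
  have l: "lip L ((S (K \<times> K) \<Delta> ^^ n) \<phi>)" for n by (rule S_pow_lip[OF order_refl KK_ne phi(1) d])
  then show "xlip L (walk \<Delta> \<phi>)" by (simp add: xlip_def walk_def)
  show "bm2 (walk \<Delta> \<phi>)"
  proof (rule bm2I)
    show "\<bar>walk \<Delta> \<phi> t x\<bar> \<le> B" for t x
      unfolding walk_def by (rule S_pow_abs_le[OF order_refl KK_ne phi(1) d phi(2)])
    have m: "(\<lambda>p. (S (K \<times> K) \<Delta> ^^ n) \<phi> (snd p)) \<in> borel_measurable (borel \<Otimes>\<^sub>M borel)" for n
      by (rule measurable_compose[OF measurable_snd lip_measurable[OF l]])
    \<comment> \<open>Time enters only through a natural number, so it is enough to check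
      measurability for each of its values.\<close>
    have "(\<lambda>p. (\<lambda>n p. (S (K \<times> K) \<Delta> ^^ n) \<phi> (snd p)) (nat \<lfloor>fst p / \<Delta>\<rfloor>) p) \<in> borel_measurable (borel \<Otimes>\<^sub>M borel)"
      by (rule measurable_compose_countable[OF m]) measurable
    then show "(\<lambda>p. walk \<Delta> \<phi> (fst p) (snd p)) \<in> borel_measurable (borel \<Otimes>\<^sub>M borel)" by (simp add: walk_def)
  qed
qed

text \<open>The Taylor error in time gives \<omega> \<Delta> / h^2. In space, \<open>E_props\<close>
  with slopes \<open>L\<close> and \<open>2 * L / b\<close> gives the term from (A3).\<close>

lemma scheme_consistency:
  assumes d: "0 < \<Delta>" "\<Delta> < 1" and k: "k \<in> K \<times> K" and hb: "0 < h" "0 < b" and f: "bm2 f" "xlip L f"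
    and osc: "\<And>s y. \<bar>f (s + h) y - f s y\<bar> \<le> \<omega>"
  shows "\<bar>(VA h b f (t + \<Delta>) x - E \<Delta> k (VA h b f t) x) - \<Delta> * (VAt h b f t x - gen \<alpha> k (VA h b f t) (VAx h b f t) x)\<bar>
     \<le> \<Delta> * (C * \<Delta> powr q * (4 / b + 4) * L + \<omega> * \<Delta> / h\<^sup>2)"
proof -
  have s: "smooth23 0 0 (VA h b f) (VAt h b f) (VAtt h b f) (VAx h b f) (VAxx h b f) (VAxxx h b f)" by (rule VA_smooth[OF f hb])
  have "\<bar>VA h b f (t + \<Delta>) x - VA h b f t x - \<Delta> * VAt h b f t x\<bar> \<le> 2 * \<omega> / h\<^sup>2 * \<Delta>\<^sup>2 / 2"
    by (rule taylor_bound[where f' = "\<lambda>s. VAt h b f s x" and f'' = "\<lambda>s. VAtt h b f s x"])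
       (use smooth23_D(1,2)[OF s] VAtt_bound[OF f(1) hb(1) osc] d in auto)
  also have "\<dots> = \<Delta> * (\<omega> * \<Delta> / h\<^sup>2)" by (simp add: power2_eq_square)
  finally have 1: "\<bar>VA h b f (t + \<Delta>) x - VA h b f t x - \<Delta> * VAt h b f t x\<bar> \<le> \<Delta> * (\<omega> * \<Delta> / h\<^sup>2)" .
  have "\<bar>E \<Delta> k (VA h b f t) x - VA h b f t x - \<Delta> * gen \<alpha> k (VA h b f t) (VAx h b f t) x\<bar> \<le> \<Delta> * (C * \<Delta> powr q * (2 * (2 * L / b) + 4 * L))"
    by (rule E_props(1)[OF VA_c11(1)[OF f hb] k d])
  also have "2 * (2 * L / b) + 4 * L = (4 / b + 4) * L" by (simp add: algebra_simps)
  finally show ?thesis using 1 by (simp add: algebra_simps)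
qed

lemma E_VA: assumes "k \<in> K \<times> K" "bm2 f" shows "E \<tau> k (VA h b f t) x = VA h b (\<lambda>t. E \<tau> k (f t)) t x"
proof -
  have "(\<lambda>t. E \<tau> k (g t)) = smx (W k) (\<tau> powr (1 / \<alpha>)) g" for g by (simp add: E_def smx_def[abs_def])
  then show ?thesis using fun_cong[OF fun_cong[OF VA_smx[OF W_dist[OF assms(1)] assms(2)]]] by metis
qed

lemma bm2_E: assumes "k \<in> K \<times> K" "bm2 f" shows "bm2 (\<lambda>t. E \<tau> k (f t))"
  using bm2_smx[OF W_dist[OF assms(1)] assms(2)] by (simp add: E_def smx_def[abs_def])

lemma upper_bound:
  assumes T: "0 < T" and u: "continuous_on ({0..T} \<times> UNIV) (\<lambda>p. u (fst p) (snd p))"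
    and vs: "viscosity_subsolution \<alpha> K T \<phi> u"
    and d: "0 < \<Delta>" "\<Delta> < 1" and phi: "lip L \<phi>" "\<And>x. \<bar>\<phi> x\<bar> \<le> B"
    and e: "0 < e" "e \<le> 1" "\<Delta> \<le> e ^ 4" "\<Delta> powr q \<le> e\<^sup>2" and t: "0 \<le> t" "t \<le> T"
  shows "u t x - walk \<Delta> \<phi> t x \<le> L * (1 / 10 + 25 / 8 * ID \<Delta> + T * (26 * ID \<Delta> + 244 * C)) * e"
proof -
  \<comment> \<open>The orders e^2 and e balance all errors; the factors make the resulting
    constants fit below \<open>U_0\<close>.\<close>
  define h b where "h = e\<^sup>2 / 4" and "b = e / 60"
  have hb: "0 < h" "0 < b" using e by (auto simp: h_def b_def)
  have L: "0 \<le> L" by (rule lip_nonneg[OF phi(1)])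
  have I0: "0 \<le> ID \<Delta>" by (rule I_Delta_nonneg[OF d])
  have e2: "e ^ 4 \<le> e\<^sup>2" using e by (intro power_decreasing) auto
  have de: "\<Delta> \<le> e\<^sup>2" using e e2 by linarith
  let ?f = "walk \<Delta> \<phi>"
  note f = walk_bm2[OF d phi]
  let ?V = "VA h b ?f" and ?Vt = "VAt h b ?f" and ?Vx = "VAx h b ?f"
  \<comment> \<open>A window plus one step is at most 5/4 e^2, and (8/5)^2 \<ge> 2 * 5/4.\<close>
  define \<omega> where "\<omega> = L * (8 / 5 * ID \<Delta> * e)"
  have osc: "\<bar>?f (s + h) y - ?f s y\<bar> \<le> \<omega>" for s y
  proof -
    have "\<bar>?f (s + h) y - ?f s y\<bar> \<le> L * time_mod \<Delta> (h + \<Delta>)" by (rule walk_near[OF d phi(1)]) (use hb in auto)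
    also have "\<dots> \<le> \<omega>" unfolding \<omega>_def
      by (intro mult_left_mono[OF _ L] time_mod_le[OF d, where c = "5 / 4"])
         (use e d de hb in \<open>auto simp: h_def power2_eq_square\<close>)
    finally show ?thesis .
  qed
  define er where "er = C * \<Delta> powr q * (4 / b + 4) * L + \<omega> * \<Delta> / h\<^sup>2"
  \<comment> \<open>Convexity in action: \<open>E \<Delta> k\<close> commutes with the averages and
    lies below the supremum that defines the next value of the scheme.\<close>
  have gen_le: "gen \<alpha> k (?V s) (?Vx s) y - er \<le> ?Vt s y" if k: "k \<in> K \<times> K" and s: "0 \<le> s" for k s y
  proof -
    have "E \<Delta> k (?V s) y - 0 \<le> ?V (s + \<Delta>) y"
      unfolding E_VA[OF k f(1)]
    proof (rule VA_compare[OF f(1) bm2_E[OF k f(1)]])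
      fix s' y assume "s \<le> s'"
      then show "E \<Delta> k (?f s') y - 0 \<le> ?f (s' + \<Delta>) y"
        using walk_step[OF d(1), of s'] S_ge[OF order_refl _ d k, of L "?f s'" y] f(2) s by (simp add: xlip_def)
    qed (use hb in auto)
    then have "\<Delta> * (gen \<alpha> k (?V s) (?Vx s) y - ?Vt s y) \<le> \<Delta> * er"
      using scheme_consistency[OF d k hb f osc, of s y] unfolding er_def by (simp add: algebra_simps abs_le_iff)
    then show ?thesis using d by simp
  qed
  have er_le: "er \<le> L * (26 * ID \<Delta> + 244 * C) * e"
  proof -
    \<comment> \<open>Here 4 / b is 240 / e, and 4 \<le> 4 / e.\<close>
    have "C * \<Delta> powr q * (4 / b + 4) * L \<le> C * e\<^sup>2 * (244 / e) * L"
      using C e L hb by (intro mult_right_mono mult_mono) (auto simp: b_def field_simps)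
    also have "\<dots> = L * (244 * C) * e" using e by (simp add: power2_eq_square)
    finally have 1: "C * \<Delta> powr q * (4 / b + 4) * L \<le> L * (244 * C) * e" .
    have "\<omega> * \<Delta> / h\<^sup>2 \<le> \<omega> * e ^ 4 / h\<^sup>2"
      using e L I0 by (intro divide_right_mono mult_left_mono) (auto simp: \<omega>_def)
    also have "\<dots> = L * (128 / 5 * ID \<Delta>) * e"
      using e by (simp add: h_def \<omega>_def power2_eq_square power4_eq_xxxx)
    also have "\<dots> \<le> L * (26 * ID \<Delta>) * e"
      using L I0 e by (intro mult_right_mono mult_left_mono) auto
    finally show ?thesis using 1 unfolding er_def by (simp add: algebra_simps)
  qed
  have near: "\<bar>?f s' y - \<phi> x\<bar> \<le> L * (e / 20 + 5 / 4 * ID \<Delta> * e)"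
    if "0 \<le> s'" "s' \<le> 3 * h" "x \<le> y" "y \<le> x + 3 * b" for s' x y
  proof -
    have "\<bar>?f s' y - \<phi> y\<bar> \<le> L * time_mod \<Delta> (3 * h)" by (rule walk_init[OF d phi(1)]) (use that hb in auto)
    also have "\<dots> \<le> L * (5 / 4 * ID \<Delta> * e)"
      by (intro mult_left_mono[OF _ L] time_mod_le[OF d, where c = "3 / 4"]) (use e hb in \<open>auto simp: h_def power2_eq_square\<close>)
    finally have "\<bar>?f s' y - \<phi> y\<bar> \<le> L * (5 / 4 * ID \<Delta> * e)" .
    moreover have "\<bar>\<phi> y - \<phi> x\<bar> \<le> L * (e / 20)"
      using lipD[OF phi(1), of y x] mult_left_mono[of "\<bar>y - x\<bar>" "e / 20" L] that L by (auto simp: b_def)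
    ultimately show ?thesis unfolding distrib_left by linarith
  qed
  define c0 where "c0 = L * (e / 20 + 5 / 4 * ID \<Delta> * e)"
  have init: "u 0 x \<le> ?V 0 x + c0" for x
  proof -
    have "\<phi> x - c0 \<le> ?V 0 x"
    proof (rule VA_ge[OF f(1)])
      fix s y assume "0 \<le> s" "s \<le> 0 + 3 * h" "x \<le> y" "y \<le> x + 3 * b"
      then show "\<phi> x - c0 \<le> ?f s y" using near[of s x y] by (auto simp: c0_def abs_le_iff)
    qed (use hb in auto)
    moreover have "u 0 x \<le> \<phi> x" using vs by (simp add: viscosity_subsolution_def)
    ultimately show ?thesis by linarith
  qed
  have main: "u t x \<le> ?V t x + c0 + t * er"
  proof (rule ccontr)
    assume contra: "\<not> ?thesis"
    \<comment> \<open>Over the whole interval the extra slope \<eta> uses up only half of the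
      assumed excess, so the corrected function is still exceeded by \<open>u\<close> at
      \<open>(t, x)\<close>.\<close>
    define \<eta> where "\<eta> = (u t x - (?V t x + c0 + t * er)) / (2 * T)"
    have eta: "0 < \<eta>" using contra T by (simp add: \<eta>_def)
    define p where "p s = c0 + s * (er + \<eta>)" for s
    have dp: "(p has_real_derivative er + \<eta>) (at s)" for s
      unfolding p_def[abs_def] by (auto intro!: derivative_eq_intros)
    note S = smooth23_add_time[OF VA_smooth[OF f hb, of "-1" "T + 1"] dp DERIV_const continuous_on_const]
    have "t * \<eta> \<le> T * \<eta>" using eta t by (intro mult_right_mono) auto
    moreover have "2 * (T * \<eta>) = u t x - (?V t x + c0 + t * er)" using T by (simp add: \<eta>_def)
    ultimately have "?V t x + p t < u t x" using mult_pos_pos[OF T eta] unfolding p_def distrib_left by linarith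
    moreover have "u 0 x \<le> ?V 0 x + p 0" for x using init by (simp add: p_def add.assoc)
    moreover have "0 < \<eta> / 2" using eta by simp
    ultimately obtain t0 x0 k where k: "k \<in> K \<times> K" and t0: "0 < t0" "t0 \<le> T"
      and le: "?Vt t0 x0 + (er + \<eta>) \<le> gen \<alpha> k (\<lambda>x. ?V t0 x + p t0) (?Vx t0) x0 + \<eta> / 2"
      using sub_touch[where u = u and \<psi> = "\<lambda>t x. ?V t x + p t" and s = 0 and t' = t and x' = x and \<eta> = "\<eta> / 2", OF T u vs S] t by blast
    have "gen \<alpha> k (\<lambda>x. ?V t0 x + p t0) (?Vx t0) x0 = gen \<alpha> k (?V t0) (?Vx t0) x0" by (simp add: gen_def)
    then show False using le gen_le[OF k, of t0 x0] t0 eta by linarith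
  qed
  have "?V t x \<le> ?f t x + L * (e / 20 + 15 / 8 * ID \<Delta> * e)"
  proof (rule VA_le[OF f(1)])
    fix s y assume s: "t \<le> s" "s \<le> t + 3 * h" "x \<le> y" "y \<le> x + 3 * b"
    have "\<bar>?f s y - ?f t y\<bar> \<le> L * time_mod \<Delta> (3 * h + \<Delta>)" by (rule walk_near[OF d phi(1)]) (use s in auto)
    also have "\<dots> \<le> L * (15 / 8 * ID \<Delta> * e)"
      by (intro mult_left_mono[OF _ L] time_mod_le[OF d, where c = "7 / 4"]) (use e d de hb in \<open>auto simp: h_def power2_eq_square\<close>)
    finally have "\<bar>?f s y - ?f t y\<bar> \<le> L * (15 / 8 * ID \<Delta> * e)" .
    moreover have "\<bar>?f t y - ?f t x\<bar> \<le> L * (e / 20)"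
    proof -
      have "lip L (?f t)" using f(2) by (simp add: xlip_def)
      from lipD[OF this, of y x] mult_left_mono[of "\<bar>y - x\<bar>" "e / 20" L] show ?thesis using s L by (auto simp: b_def)
    qed
    ultimately show "?f s y \<le> ?f t x + L * (e / 20 + 15 / 8 * ID \<Delta> * e)" unfolding distrib_left by linarith
  qed (use hb in auto)
  moreover have "t * er \<le> T * (L * (26 * ID \<Delta> + 244 * C) * e)"
  proof -
    have "0 \<le> L * (26 * ID \<Delta> + 244 * C) * e" using L I0 C e by auto
    then show ?thesis using t er_le by (meson mult_left_mono mult_right_mono order_trans)
  qed
  ultimately show ?thesis using main unfolding c0_def by (simp add: algebra_simps)
qed

end

section \<open>Lower bound\<close>

lemma lip_of_deriv:
  assumes "\<And>x. (f has_real_derivative f' x) (at x)" "\<And>x. \<bar>f' x\<bar> \<le> L" shows "lip L f"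
  unfolding lip_def
proof (intro allI)
  fix x y
  have "norm (f x - f y) \<le> L * norm (x - y)"
    by (rule field_differentiable_bound[of UNIV f f' L]) (use assms in auto)
  then show "\<bar>f x - f y\<bar> \<le> L * \<bar>x - y\<bar>" by simp
qed

section \<open>Linear operators with small steps below a viscosity supersolution\<close>

context stable_scheme begin

lemma E_sm: "E \<tau> k = sm (W k) (\<tau> powr (1 / \<alpha>))" by (simp add: E_def)

lemma E_bm: "k \<in> K \<times> K \<Longrightarrow> bm f \<Longrightarrow> bm (E \<tau> k f)"
  unfolding E_sm by (rule real_distribution.bm_sm[OF W_dist])

lemma E_av: "k \<in> K \<times> K \<Longrightarrow> bm f \<Longrightarrow> E \<tau> k (av b f) = av b (E \<tau> k f)"
  unfolding E_sm by (intro ext sm_commute[OF W_dist unif_dist])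

lemma E_dq: assumes "k \<in> K \<times> K" "bm f" shows "E \<tau> k (dq b f) = dq b (E \<tau> k f)"
proof
  fix x
  interpret W: real_distribution "W k" using W_dist[OF assms(1)] .
  have "E \<tau> k (dq b f) x = E \<tau> k (\<lambda>x. f (x + b) - f x) x / b"
    unfolding E_sm dq_def[abs_def] by (simp add: sm_def)
  also have "E \<tau> k (\<lambda>x. f (x + b) - f x) x = E \<tau> k f (x + b) - E \<tau> k f x"
    unfolding E_sm W.sm_diff[OF bm_shift[OF assms(2)] assms(2)] by (simp add: W.sm_shift)
  finally show "E \<tau> k (dq b f) x = dq b (E \<tau> k f) x" unfolding dq_def[of b "E \<tau> k f" x] .
qed

text \<open>Derivatives of the averaged \<open>E \<tau> k f\<close> are \<open>E \<tau> k\<close> of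
  derivatives, so the difference of two consecutive profiles is small together with its derivatives
  as \<tau> tends to 0.\<close>

lemma E_av3:
  assumes "k \<in> K \<times> K" "bm f"
  shows "E \<tau> k (av3 b f) = av3 b (E \<tau> k f)" "E \<tau> k (av3_1 b f) = av3_1 b (E \<tau> k f)" "E \<tau> k (av3_2 b f) = av3_2 b (E \<tau> k f)"
  unfolding av3_def av3_1_def av3_2_def
  by (simp_all add: E_av[OF assms(1)] E_dq[OF assms(1)] unif.bm_sm bm_dq assms)

text \<open>The modulus \<open>time_mod\<close> with constants independent of the step, which now
  tends to 0 while the elapsed time is fixed.\<close>

definition time_mod_bound :: "real \<Rightarrow> real" where "time_mod_bound s = sqrt (2 * IB1 * s) + 2 * IB2 * s"

lemma IB_nonneg: "0 \<le> IB1" "0 \<le> IB2"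
  using I_bounds(1-4)[of "1/2"] by auto

lemma time_mod_bound_nonneg: "0 \<le> s \<Longrightarrow> 0 \<le> time_mod_bound s"
  unfolding time_mod_bound_def using IB_nonneg by auto

lemma time_mod_le_bound: assumes "0 < \<tau>" "\<tau> < 1" "0 \<le> s" shows "time_mod \<tau> s \<le> time_mod_bound s"
  unfolding time_mod_def time_mod_bound_def using I_bounds(1,2)[OF assms(1,2)] assms(3)
  by (intro add_mono real_sqrt_le_mono mult_right_mono mult_left_mono) auto

lemma time_mod_bound_tendsto: "(time_mod_bound \<longlongrightarrow> 0) (at_right 0)"
proof -
  have "((\<lambda>s. sqrt (2 * IB1 * s) + 2 * IB2 * s) \<longlongrightarrow> sqrt (2 * IB1 * 0) + 2 * IB2 * 0) (at_right 0)"
    by (intro tendsto_intros)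
  then show ?thesis unfolding time_mod_bound_def[abs_def] by simp
qed

lemma E_pow_near:
  assumes k: "k \<in> K \<times> K" and f: "lip L f" and t: "0 < \<tau>" "\<tau> < 1" and s: "0 < s" "real n * \<tau> \<le> s"
  shows "\<bar>(E \<tau> k ^^ n) f x - f x\<bar> \<le> L * time_mod_bound s"
proof -
  have "{k} \<subseteq> K \<times> K" "{k} \<noteq> {}" using k by auto
  from S_pow_near_sqrt[OF this f t s, of x]
  have "\<bar>(E \<tau> k ^^ n) f x - f x\<bar> \<le> L * time_mod \<tau> s" by (simp add: S_singleton time_mod_def)
  also have "\<dots> \<le> L * time_mod_bound s" using time_mod_le_bound[OF t, of s] s lip_nonneg[OF f] by (intro mult_left_mono) auto
  finally show ?thesis .
qed

lemma E_near:
  assumes k: "k \<in> K \<times> K" and f: "lip L f" and t: "0 < \<tau>" "\<tau> < 1"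
  shows "\<bar>E \<tau> k f x - f x\<bar> \<le> L * time_mod_bound \<tau>"
  using E_pow_near[OF k f t t(1), of 1 x] by simp

text \<open>The first summand is the consistency error for slopes \<open>L\<close> and
  \<open>2 * L / b\<close>; the second is the generator of the difference of consecutive profiles,
  doubled because the interpolation parameter may reach 2.\<close>

definition step_error :: "real \<Rightarrow> real \<Rightarrow> real \<Rightarrow> real" where
  "step_error L b \<tau> = C * \<tau> powr q * (2 * (2 * L / b) + 4 * L) + 2 * (gen_const * (2 * L / b * time_mod_bound \<tau> + 4 * L / b\<^sup>2 * time_mod_bound \<tau>))"

lemma powr_q_tendsto: "((\<lambda>\<tau>. \<tau> powr q) \<longlongrightarrow> 0) (at_right 0)"
proof -
  have "((\<lambda>\<tau>. \<tau> powr q) \<longlongrightarrow> 0 powr q) (at_right 0)"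
    by (rule tendsto_powr'[OF tendsto_ident_at tendsto_const]) (use q in \<open>auto simp: eventually_at_filter\<close>)
  then show ?thesis by simp
qed

lemma step_error_tendsto: "(step_error L b \<longlongrightarrow> 0) (at_right 0)"
proof -
  have "((\<lambda>\<tau>. C * \<tau> powr q * (2 * (2 * L / b) + 4 * L) + 2 * (gen_const * (2 * L / b * time_mod_bound \<tau> + 4 * L / b\<^sup>2 * time_mod_bound \<tau>)))
     \<longlongrightarrow> C * 0 * (2 * (2 * L / b) + 4 * L) + 2 * (gen_const * (2 * L / b * 0 + 4 * L / b\<^sup>2 * 0))) (at_right 0)"
    by (intro tendsto_intros powr_q_tendsto time_mod_bound_tendsto)
  then show ?thesis unfolding step_error_def[abs_def] by simp
qed

lemma step_error_nonneg: assumes "0 \<le> L" "0 < b" "0 < \<tau>" shows "0 \<le> step_error L b \<tau>"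
  unfolding step_error_def using assms C gen_const_pos time_mod_bound_nonneg[of \<tau>] by (intro add_nonneg_nonneg mult_nonneg_nonneg) auto

text \<open>The test function moves linearly in time from the profile at \<open>s\<close> to the
  profile one step later. Its time derivative is the increment over \<tau>, which approximates the
  generator of the first profile, and the generator changes little along the way. The slope
  \<open>step_error L b \<tau> + \<kappa>\<close> is made just large enough to contradict the
  inequality at a contact point.\<close>

lemma one_step:
  assumes T: "0 < T" and u: "continuous_on ({0..T} \<times> UNIV) (\<lambda>p. u (fst p) (snd p))"
    and vs: "viscosity_supersolution \<alpha> K T \<phi> u" and k: "k \<in> K \<times> K"
    and f: "bm f" "lip L f" and b: "0 < b" and t: "0 < \<tau>" "\<tau> < 1" and s: "0 \<le> s" "s + \<tau> \<le> T"
    and kap: "0 < \<kappa>" and le: "\<And>x. av3 b f x - a \<le> u s x"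
  shows "av3 b (E \<tau> k f) x - a - \<tau> * (step_error L b \<tau> + \<kappa>) \<le> u (s + \<tau>) x"
proof (rule ccontr)
  assume contra: "\<not> ?thesis"
  have "bounded ((\<lambda>(t, x). u t x) ` ({0..T} \<times> UNIV))" using vs by (simp add: viscosity_supersolution_def)
  then obtain Bu where "\<forall>t\<in>{0..T}. \<forall>x. \<bar>u t x\<bar> \<le> Bu" by (auto simp: bounded_iff)
  then have Bu: "\<And>t x. t \<in> {0..T} \<Longrightarrow> \<bar>u t x\<bar> \<le> Bu" by blast
  obtain Bf where Bf: "\<And>x. \<bar>f x\<bar> \<le> Bf" using bm_bound[OF f(1)] by metis
  let ?Ef = "E \<tau> k f"
  have Ef: "bm ?Ef" "lip L ?Ef" using E_bm[OF k f(1)] E_lip[OF k f(2)] by auto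
  have Bf': "\<bar>?Ef x\<bar> \<le> Bf" for x by (rule E_abs_le[OF k Bf])
  have L: "0 \<le> L" by (rule lip_nonneg[OF f(2)])
  define g where "g = av3 b f"
  define g1 where "g1 = av3_1 b f"
  define D where "D x = av3 b f x - av3 b ?Ef x" for x
  define D1 where "D1 x = av3_1 b f x - av3_1 b ?Ef x" for x
  define D2 where "D2 x = av3_2 b f x - av3_2 b ?Ef x" for x
  define D3 where "D3 x = av3_3 b f x - av3_3 b ?Ef x" for x
  note c = av3_c11[OF f b] and c' = av3_c11[OF Ef b]
  have dD: "(D has_real_derivative D1 x) (at x)" "(D1 has_real_derivative D2 x) (at x)" "(D2 has_real_derivative D3 x) (at x)" for x
    unfolding D_def[abs_def] D1_def[abs_def] D2_def[abs_def] D3_def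
    by (intro DERIV_diff c11_D(1)[OF c(1)] c11_D(1)[OF c'(1)] c11_D(1)[OF c(2)] c11_D(1)[OF c'(2)] c(3) c'(3))+
  have cD3: "continuous_on UNIV D3" unfolding D3_def[abs_def] by (intro continuous_on_diff c(5) c'(5))
  have gB: "\<bar>av3 b f x\<bar> \<le> Bf" "\<bar>av3 b ?Ef x\<bar> \<le> Bf" for x
    unfolding av3_def by (intro unif.sm_abs_le Bf Bf')+
  define G where "G = 2 * Bf + 2 * L + 2 * (2 * L / b) + 2 * (4 * L / b\<^sup>2)"
  have Gs: "0 \<le> Bf" "0 \<le> 2 * L / b" "0 \<le> 4 * L / b\<^sup>2" using Bf[of 0] L b by auto
  have Gg: "\<bar>av3 b f x\<bar> \<le> G" "\<bar>av3_1 b f x\<bar> \<le> G" "\<bar>av3_2 b f x\<bar> \<le> G" "\<bar>av3_3 b f x\<bar> \<le> G" for x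
    using gB[of x] c11_D(2)[OF c(1), of x] c11_D(2)[OF c(2), of x] c(4)[of x] Gs L unfolding G_def by linarith+
  have two: "\<bar>x - y\<bar> \<le> 2 * M" if "\<bar>x\<bar> \<le> M" "\<bar>y\<bar> \<le> M" for x y M :: real
    using that by linarith
  have GD: "\<bar>D x\<bar> \<le> G" "\<bar>D1 x\<bar> \<le> G" "\<bar>D2 x\<bar> \<le> G" "\<bar>D3 x\<bar> \<le> G" for x
  proof -
    have "\<bar>D x\<bar> \<le> 2 * Bf" "\<bar>D1 x\<bar> \<le> 2 * L" "\<bar>D2 x\<bar> \<le> 2 * (2 * L / b)" "\<bar>D3 x\<bar> \<le> 2 * (4 * L / b\<^sup>2)"
      unfolding D_def D1_def D2_def D3_def
      by (intro two gB c11_D(2)[OF c(1)] c11_D(2)[OF c'(1)] c11_D(2)[OF c(2)] c11_D(2)[OF c'(2)] c(4) c'(4))+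
    then show "\<bar>D x\<bar> \<le> G" "\<bar>D1 x\<bar> \<le> G" "\<bar>D2 x\<bar> \<le> G" "\<bar>D3 x\<bar> \<le> G"
      using Gs L unfolding G_def by linarith+
  qed
  \<comment> \<open>The contact may occur after \<open>s + \<tau>\<close>. From
    \<open>s + 2 * \<tau>\<close> on, the cubic term with this factor pushes the test function below
    \<open>u\<close>.\<close>
  define P where "P = (Bf + T / \<tau> * (2 * Bf) + \<bar>a\<bar> + Bu + 1) / \<tau> ^ 3"
  have P0: "0 \<le> P" unfolding P_def using Gs T t Bu[of 0 0] by (intro divide_nonneg_nonneg add_nonneg_nonneg) auto
  define m where "m t = max 0 (t - (s + \<tau>))" for t
  define p where "p t = - a - (t - s) * (step_error L b \<tau> + \<kappa>) - P * (m t) ^ 3" for t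
  define p1 where "p1 t = - (step_error L b \<tau> + \<kappa>) - P * (3 * (m t)\<^sup>2)" for t
  define p2 where "p2 t = - (P * (6 * m t))" for t
  have cube: "((\<lambda>x. x ^ 3) has_real_derivative 3 * x\<^sup>2) (at x)" for x :: real by (auto intro!: derivative_eq_intros)
  have sq: "((\<lambda>x. 3 * x\<^sup>2) has_real_derivative 6 * x) (at x)" for x :: real by (auto intro!: derivative_eq_intros)
  have dm: "((\<lambda>t. t - (s + \<tau>)) has_real_derivative 1) (at t)" for t by (auto intro!: derivative_eq_intros)
  have p: "(p has_real_derivative p1 t) (at t)" "(p1 has_real_derivative p2 t) (at t)" "continuous_on UNIV p2" for t
  proof -
    have m3: "((\<lambda>t. (m t) ^ 3) has_real_derivative 3 * (m t)\<^sup>2 * 1) (at t)"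
      unfolding m_def by (rule DERIV_chain2[OF DERIV_pos_part[OF cube] dm]) simp
    have "((\<lambda>t. - a - (t - s) * (step_error L b \<tau> + \<kappa>)) has_real_derivative - (step_error L b \<tau> + \<kappa>)) (at t)"
      by (auto intro!: derivative_eq_intros)
    from DERIV_diff[OF this DERIV_cmult[OF m3, of P]]
    show "(p has_real_derivative p1 t) (at t)" unfolding p_def[abs_def] p1_def by simp
    have m2: "((\<lambda>t. 3 * (m t)\<^sup>2) has_real_derivative 6 * m t * 1) (at t)"
      unfolding m_def by (rule DERIV_chain2[OF DERIV_pos_part[OF sq] dm]) simp
    from DERIV_diff[OF DERIV_const DERIV_cmult[OF m2, of P]]
    show "(p1 has_real_derivative p2 t) (at t)" unfolding p1_def[abs_def] p2_def by simp
    show "continuous_on UNIV p2" unfolding p2_def[abs_def] m_def[abs_def] by (intro continuous_intros)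
  qed
  \<comment> \<open>As \<open>D\<close> is the old profile minus the new one, \<open>r\<close> runs
    from 0 at \<open>s\<close> to -1 at \<open>s + \<tau>\<close>.\<close>
  define r where "r t = - ((t - s) / \<tau>)" for t
  have dr: "(r has_real_derivative - (1 / \<tau>)) (at t)" for t
    unfolding r_def[abs_def] using t by (auto intro!: derivative_eq_intros)
  define \<psi> where "\<psi> t x = 0 + 1 * av3 b f x + r t * D x + p t" for t x
  define \<psi>t where "\<psi>t t x = 0 + 0 * av3 b f x + - (1 / \<tau>) * D x + p1 t" for t x
  define \<psi>x where "\<psi>x t x = 0 + 1 * av3_1 b f x + r t * D1 x" for t x
  note S1 = smooth23_add_mult[OF smooth23_zero, where p = "\<lambda>_. 1", OF DERIV_const DERIV_const continuous_on_const c11_D(1)[OF c(1)] c11_D(1)[OF c(2)] c(3) c(5) Gg, of "-1" "T + 1"]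
  note S2 = smooth23_add_mult[OF S1 dr DERIV_const continuous_on_const dD cD3 GD]
  note S3 = smooth23_add_time[OF S2 p, folded \<psi>_def \<psi>t_def \<psi>x_def]
  have init: "\<psi> s x \<le> u s x" for x
    using le[of x] t by (simp add: \<psi>_def r_def p_def m_def)
  have r1: "r (s + \<tau>) = - 1" using t by (simp add: r_def)
  have above: "u (s + \<tau>) x < \<psi> (s + \<tau>) x"
    using contra unfolding \<psi>_def r1 by (simp add: p_def m_def D_def)
  have sle: "s \<le> s + \<tau>" "0 < \<kappa> / 2" using t kap by auto
  obtain t0 x0 where t0: "s < t0" "t0 \<le> T" and lt: "u t0 x0 < \<psi> t0 x0"
    and gen: "gen \<alpha> k (\<psi> t0) (\<psi>x t0) x0 - \<kappa> / 2 \<le> \<psi>t t0 x0"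
    using super_touch[where u = u and \<psi> = \<psi>, OF T u vs S3 s(1) init sle(1) s(2) above sle(2)] k by blast
  define th where "th = (t0 - s) / \<tau>"
  have th0: "0 \<le> th" using t0 t by (simp add: th_def)
  have om0: "0 \<le> step_error L b \<tau>" by (rule step_error_nonneg[OF L b t(1)])
  \<comment> \<open>A contact requires the test function to exceed \<open>u\<close>, which the cubic
    term excludes at late times.\<close>
  have tl: "t0 < s + 2 * \<tau>"
  proof (rule ccontr)
    assume "\<not> t0 < s + 2 * \<tau>"
    then have "\<tau> ^ 3 \<le> m t0 ^ 3" using t by (intro power_mono) (auto simp: m_def)
    then have "P * \<tau> ^ 3 \<le> P * m t0 ^ 3" using P0 by (intro mult_left_mono) auto
    then have P3: "Bf + T / \<tau> * (2 * Bf) + \<bar>a\<bar> + Bu + 1 \<le> P * m t0 ^ 3" using t by (simp add: P_def)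
    have "- (th * D x0) \<le> T / \<tau> * (2 * Bf)"
    proof -
      have "\<bar>th * D x0\<bar> \<le> T / \<tau> * (2 * Bf)" unfolding abs_mult
      proof (rule mult_mono)
        show "\<bar>th\<bar> \<le> T / \<tau>" using th0 t0 s t by (auto simp: th_def intro!: divide_right_mono)
        show "\<bar>D x0\<bar> \<le> 2 * Bf" using gB[of x0] unfolding D_def by linarith
      qed (use T t in auto)
      then show ?thesis by linarith
    qed
    moreover have "0 \<le> (t0 - s) * (step_error L b \<tau> + \<kappa>)" using t0 om0 kap by simp
    moreover have "av3 b f x0 \<le> Bf" using gB[of x0] by linarith
    moreover have "- Bu \<le> u t0 x0" using Bu[of t0 x0] t0 s by (auto simp: abs_le_iff)
    ultimately have "\<psi> t0 x0 < u t0 x0" using P3 unfolding \<psi>_def r_def p_def th_def by simp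
    then show False using lt by simp
  qed
  then have th2: "th \<le> 2" using t by (simp add: th_def field_simps)
  have T0: "0 \<le> time_mod_bound \<tau>" using t by (intro time_mod_bound_nonneg) simp
  have cD: "c11 (2 * L / b * time_mod_bound \<tau>) (4 * L / b\<^sup>2 * time_mod_bound \<tau>) D D1"
    unfolding c11_def
  proof (intro conjI allI dD)
    fix x
    have "D1 x = av3_1 b f x - E \<tau> k (av3_1 b f) x" by (simp add: D1_def E_av3[OF k f(1)])
    then show "\<bar>D1 x\<bar> \<le> 2 * L / b * time_mod_bound \<tau>"
      using E_near[OF k c11_D(3)[OF c(1)] t, of x] by (simp add: abs_minus_commute)
  next
    have e: "D2 x = av3_2 b f x - E \<tau> k (av3_2 b f) x" for x by (simp add: D2_def E_av3[OF k f(1)])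
    show "lip (4 * L / b\<^sup>2 * time_mod_bound \<tau>) D1"
    proof (rule lip_of_deriv[OF dD(2)])
      show "\<bar>D2 x\<bar> \<le> 4 * L / b\<^sup>2 * time_mod_bound \<tau>" for x
        using E_near[OF k c11_D(3)[OF c(2)] t, of x] unfolding e by (simp add: abs_minus_commute)
    qed
  qed
  note cD' = c11_cmult[OF cD th0]
  have "\<psi> t0 = (\<lambda>x. av3 b f x - th * D x + p t0)" "\<psi>x t0 = (\<lambda>x. av3_1 b f x - th * D1 x)"
    unfolding \<psi>_def[abs_def] \<psi>x_def[abs_def] r_def th_def by auto
  then have "gen \<alpha> k (\<psi> t0) (\<psi>x t0) x0 = gen \<alpha> k (av3 b f) (av3_1 b f) x0 - gen \<alpha> k (\<lambda>x. th * D x) (\<lambda>x. th * D1 x) x0"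
    using gen_diff[OF c(1) cD' k, of "p t0" x0] by simp
  moreover have "gen \<alpha> k (\<lambda>x. th * D x) (\<lambda>x. th * D1 x) x0 \<le> 2 * (gen_const * (2 * L / b * time_mod_bound \<tau> + 4 * L / b\<^sup>2 * time_mod_bound \<tau>))"
  proof -
    let ?l = "2 * L / b * time_mod_bound \<tau> + 4 * L / b\<^sup>2 * time_mod_bound \<tau>"
    have l0: "0 \<le> ?l" using Gs T0 by (intro add_nonneg_nonneg mult_nonneg_nonneg)
    have "gen \<alpha> k (\<lambda>x. th * D x) (\<lambda>x. th * D1 x) x0 \<le> gen_const * (th * ?l)"
      using gen_props(3)[OF cD' k, of x0] unfolding distrib_left[symmetric] by linarith
    also have "\<dots> \<le> gen_const * (2 * ?l)" using gen_const_pos th2 l0 by (intro mult_left_mono mult_right_mono) auto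
    finally show ?thesis unfolding mult.left_commute[of gen_const 2] .
  qed
  moreover have "- (1 / \<tau>) * D x0 \<le> gen \<alpha> k (av3 b f) (av3_1 b f) x0 + C * \<tau> powr q * (2 * (2 * L / b) + 4 * L)"
  proof -
    have "- D x0 \<le> \<tau> * (gen \<alpha> k (av3 b f) (av3_1 b f) x0 + C * \<tau> powr q * (2 * (2 * L / b) + 4 * L))"
      using E_props(1)[OF c(1) k t, of x0] unfolding D_def E_av3(1)[OF k f(1), symmetric] distrib_left by linarith
    then have "- D x0 / \<tau> \<le> gen \<alpha> k (av3 b f) (av3_1 b f) x0 + C * \<tau> powr q * (2 * (2 * L / b) + 4 * L)"
      using t by (subst pos_divide_le_eq) (auto simp: mult.commute)
    then show ?thesis by simp
  qed
  moreover have "p1 t0 \<le> - (step_error L b \<tau> + \<kappa>)" using P0 by (simp add: p1_def)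
  ultimately have "step_error L b \<tau> + \<kappa> / 2 \<le> C * \<tau> powr q * (2 * (2 * L / b) + 4 * L) + 2 * (gen_const * (2 * L / b * time_mod_bound \<tau> + 4 * L / b\<^sup>2 * time_mod_bound \<tau>))"
    using gen unfolding \<psi>t_def by linarith
  then show False using kap unfolding step_error_def by linarith
qed

lemma E_pow_bm: "k \<in> K \<times> K \<Longrightarrow> bm f \<Longrightarrow> bm ((E \<tau> k ^^ n) f)"
  by (induction n) (auto intro: E_bm)

lemma E_pow_lip: "k \<in> K \<times> K \<Longrightarrow> lip L f \<Longrightarrow> lip L ((E \<tau> k ^^ n) f)"
  by (induction n) (auto intro: E_lip)

text \<open>The induction is run for averaged profiles, since averaging commutes with each step.
  Smoothing is thus paid for only at the start and at the end, with 3 b L each, instead of once per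
  step.\<close>

lemma many_steps:
  assumes T: "0 < T" and u: "continuous_on ({0..T} \<times> UNIV) (\<lambda>p. u (fst p) (snd p))"
    and vs: "viscosity_supersolution \<alpha> K T \<phi> u" and k: "k \<in> K \<times> K"
    and us: "bm (u s)" "lip L (u s)" and b: "0 < b" and t: "0 < \<tau>" "\<tau> < 1" and s: "0 \<le> s" "s + real n * \<tau> \<le> T"
    and kap: "0 < \<kappa>"
  shows "(E \<tau> k ^^ n) (u s) x - 6 * b * L - real n * \<tau> * (step_error L b \<tau> + \<kappa>) \<le> u (s + real n * \<tau>) x"
proof -
  let ?g = "\<lambda>n. (E \<tau> k ^^ n) (u s)"
  have near: "\<bar>av3 b f x - f x\<bar> \<le> 3 * b * L" if "bm f" "lip L f" for f x
  proof -
    have "f x - 3 * b * L \<le> f y \<and> f y \<le> f x + 3 * b * L" if y: "x \<le> y" "y \<le> x + 3 * b" for y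
    proof -
      have "L * \<bar>y - x\<bar> \<le> L * (3 * b)" using lip_nonneg[OF us(2)] y by (intro mult_left_mono) auto
      then show ?thesis using lipD[OF \<open>lip L f\<close>, of y x] by (auto simp: abs_le_iff algebra_simps)
    qed
    then have "av3 b f x \<le> f x + 3 * b * L" "f x - 3 * b * L \<le> av3 b f x"
      using b by (auto intro!: av3_le[OF that(1)] av3_ge[OF that(1)])
    then show ?thesis by (simp add: abs_le_iff)
  qed
  have "av3 b (?g n) x - (3 * b * L + real n * (\<tau> * (step_error L b \<tau> + \<kappa>))) \<le> u (s + real n * \<tau>) x" for x
    using s(2)
  proof (induction n arbitrary: x)
    case 0
    show ?case using near[OF us, of x] by simp
  next
    case (Suc n)
    have sn: "s + real n * \<tau> + \<tau> \<le> T" "0 \<le> s + real n * \<tau>" "s + real n * \<tau> \<le> T" using Suc.prems t s by (auto simp: algebra_simps)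
    have "av3 b (E \<tau> k (?g n)) x - (3 * b * L + real n * (\<tau> * (step_error L b \<tau> + \<kappa>))) - \<tau> * (step_error L b \<tau> + \<kappa>) \<le> u (s + real n * \<tau> + \<tau>) x"
      by (rule one_step[OF T u vs k E_pow_bm[OF k us(1)] E_pow_lip[OF k us(2)] b t sn(2,1) kap Suc.IH[OF sn(3)]])
    then show ?case by (simp add: algebra_simps)
  qed
  from this[of x] near[OF E_pow_bm[OF k us(1), of n \<tau>] E_pow_lip[OF k us(2), of n \<tau>], of x]
  show ?thesis by (simp add: algebra_simps)
qed

lemma E_diff: assumes "k \<in> K \<times> K" "lip L f" "lip M g" shows "E \<tau> k (\<lambda>x. f x - g x) x = E \<tau> k f x - E \<tau> k g x"
  unfolding E_sm sm_def by (rule Bochner_Integration.integral_diff[OF E_int[OF assms(1,2)] E_int[OF assms(1,3)]])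

lemma E_pow_diff: assumes "k \<in> K \<times> K" "lip L f" "lip M g"
  shows "(E \<tau> k ^^ n) (\<lambda>x. f x - g x) = (\<lambda>x. (E \<tau> k ^^ n) f x - (E \<tau> k ^^ n) g x)"
proof (induction n)
  case (Suc n)
  show ?case using E_diff[OF assms(1) E_pow_lip[OF assms(1,2)] E_pow_lip[OF assms(1,3)]] by (simp add: Suc.IH)
qed simp

text \<open>Telescoping: the total increment is the sum of the iterates of the first increment
  \<open>D\<close>. As \<open>D\<close> is Lipschitz with a constant of order \<tau>, its iterates
  stay close to it over the time \<open>h\<close>, and n copies of \<open>D\<close> amount to
  \<open>h\<close> times the generator up to the error from (A3).\<close>

lemma E_pow_ge:
  assumes f: "c11 L1 L2 f f'" "c11 L2 L3 f' f''" and k: "k \<in> K \<times> K" and h: "0 < h" "h < 1" and n: "0 < n"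
  shows "f x + h * (gen \<alpha> k f f' x - C * (h / n) powr q * (2 * L2 + 4 * L1) - (L3 * IB1 + 2 * L2 * IB2) * time_mod_bound h) \<le> (E (h / real n) k ^^ n) f x"
proof -
  define \<tau> where "\<tau> = h / real n"
  have t: "0 < \<tau>" "\<tau> < 1" using h n by (auto simp: \<tau>_def field_simps)
  have nt: "real n * \<tau> = h" using n by (simp add: \<tau>_def)
  define D where "D x = E \<tau> k f x - f x" for x
  define Lm where "Lm = L3 * IB1 + 2 * L2 * IB2"
  have L: "0 \<le> L2" "0 \<le> L3" using c11_D(4,5)[OF f(2)] .
  have fl: "lip L1 f" by (rule c11_lip[OF f(1)])
  \<comment> \<open>The growth estimate is applied to \<open>f\<close> minus its translate by
    \<open>d\<close>, whose two constants are \<open>L2\<close> and \<open>L3\<close> times the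
    length of \<open>d\<close>.\<close>
  have Dl: "lip (\<tau> * Lm) D" unfolding lip_def
  proof (intro allI)
    fix x y :: real
    define d where "d = y - x"
    have c: "c11 (L2 * \<bar>d\<bar>) (L3 * \<bar>d\<bar>) (\<lambda>z. f z - f (z + d)) (\<lambda>z. f' z - f' (z + d))"
    proof (rule c11_sharpen[OF c11_diff[OF f(1) c11_shift[OF f(1)]]])
      show "\<bar>f' z - f' (z + d)\<bar> \<le> L2 * \<bar>d\<bar>" for z using lipD[OF c11_D(3)[OF f(1)], of z "z + d"] by simp
      show "lip (L3 * \<bar>d\<bar>) (\<lambda>z. f' z - f' (z + d))"
      proof (rule lip_of_deriv)
        show "((\<lambda>z. f' z - f' (z + d)) has_real_derivative f'' z - f'' (z + d)) (at z)" for z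
          by (rule DERIV_diff[OF c11_D(1)[OF f(2)] c11_D(1)[OF c11_shift[OF f(2)]]])
        show "\<bar>f'' z - f'' (z + d)\<bar> \<le> L3 * \<bar>d\<bar>" for z using lipD[OF c11_D(3)[OF f(2)], of z "z + d"] by simp
      qed
    qed
    have "E \<tau> k (\<lambda>z. f z - f (z + d)) x = E \<tau> k f x - E \<tau> k f (x + d)"
      using E_diff[OF k fl lip_shift[OF fl]] E_affine[OF k fl, of \<tau> 0 1 d x] by simp
    then have "D x - D y = E \<tau> k (\<lambda>z. f z - f (z + d)) x - (f x - f (x + d))"
      by (simp add: D_def d_def)
    also have "\<bar>\<dots>\<bar> \<le> \<tau> * (L3 * \<bar>d\<bar> * I1 \<tau> + 2 * (L2 * \<bar>d\<bar>) * I2 \<tau>)" by (rule E_props(2)[OF c k t])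
    also have "\<dots> \<le> \<tau> * (L3 * \<bar>d\<bar> * IB1 + 2 * (L2 * \<bar>d\<bar>) * IB2)"
      using t L I_bounds(1,2)[OF t] by (intro mult_left_mono add_mono) auto
    also have "\<dots> = \<tau> * Lm * \<bar>x - y\<bar>" by (simp add: Lm_def d_def algebra_simps abs_minus_commute)
    finally show "\<bar>D x - D y\<bar> \<le> \<tau> * Lm * \<bar>x - y\<bar>" .
  qed
  have step: "(E \<tau> k ^^ Suc j) f x = (E \<tau> k ^^ j) f x + (E \<tau> k ^^ j) D x" for j
  proof -
    have "(E \<tau> k ^^ j) D = (\<lambda>x. (E \<tau> k ^^ j) (E \<tau> k f) x - (E \<tau> k ^^ j) f x)"
      unfolding D_def[abs_def] by (rule E_pow_diff[OF k E_lip[OF k fl] fl])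
    then show ?thesis by (simp add: funpow_swap1)
  qed
  have "f x + real j * (D x - \<tau> * Lm * time_mod_bound h) \<le> (E \<tau> k ^^ j) f x" if "j \<le> n" for j
    using that
  proof (induction j)
    case (Suc j)
    have "real j * \<tau> \<le> real n * \<tau>" using Suc.prems t by (intro mult_right_mono) auto
    then have "real j * \<tau> \<le> h" by (simp add: nt)
    from E_pow_near[OF k Dl t h(1) this, of x] have "D x - \<tau> * Lm * time_mod_bound h \<le> (E \<tau> k ^^ j) D x" by linarith
    then show ?case using Suc.IH Suc.prems unfolding step by (simp add: algebra_simps)
  qed simp
  moreover have "real n * (\<tau> * Lm * time_mod_bound h) = h * (Lm * time_mod_bound h)" by (simp add: mult.assoc[symmetric] nt)
  ultimately have "f x + (real n * D x - h * (Lm * time_mod_bound h)) \<le> (E \<tau> k ^^ n) f x"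
    by (metis order_refl right_diff_distrib)
  moreover have "h * (gen \<alpha> k f f' x - C * \<tau> powr q * (2 * L2 + 4 * L1)) \<le> real n * D x"
  proof -
    have "\<tau> * (gen \<alpha> k f f' x - C * \<tau> powr q * (2 * L2 + 4 * L1)) \<le> D x"
      using E_props(1)[OF f(1) k t, of x] unfolding D_def right_diff_distrib by linarith
    then have "real n * (\<tau> * (gen \<alpha> k f f' x - C * \<tau> powr q * (2 * L2 + 4 * L1))) \<le> real n * D x"
      by (intro mult_left_mono) auto
    then show ?thesis unfolding mult.assoc[symmetric] nt .
  qed
  ultimately show ?thesis unfolding \<tau>_def[symmetric] Lm_def[symmetric] right_diff_distrib by linarith
qed

end

text \<open>The averages look ahead in time, so \<open>u\<close> is extended constantly beyond \<open>[0, T]\<close>.\<close>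

definition freeze :: "real \<Rightarrow> (real \<Rightarrow> real \<Rightarrow> real) \<Rightarrow> real \<Rightarrow> real \<Rightarrow> real" where
  "freeze T u t x = u (max 0 (min T t)) x"

context stable_scheme begin

definition hoelder :: "real \<Rightarrow> real \<Rightarrow> (real \<Rightarrow> real \<Rightarrow> real) \<Rightarrow> bool" where
  "hoelder T H u \<longleftrightarrow> (\<forall>s\<in>{0..T}. \<forall>t\<in>{0..T}. \<forall>x y. \<bar>u t x - u s y\<bar> \<le> H * (\<bar>x - y\<bar> + \<bar>t - s\<bar> powr (1 / \<alpha>)))"

lemma hoelder_nonneg: assumes "hoelder T H u" "0 < T" shows "0 \<le> H"
proof -
  have "\<bar>u 0 1 - u 0 0\<bar> \<le> H * (\<bar>1 - 0\<bar> + \<bar>0 - 0\<bar> powr (1 / \<alpha>))"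
    using assms(1)[unfolded hoelder_def, rule_format, of 0 0 1 0] assms(2) by simp
  then show ?thesis by simp
qed

lemma freeze_hoelder:
  assumes "hoelder T H u" "0 < T"
  shows "\<bar>freeze T u t x - freeze T u s y\<bar> \<le> H * (\<bar>x - y\<bar> + \<bar>t - s\<bar> powr (1 / \<alpha>))"
proof -
  let ?c = "\<lambda>t. max 0 (min T t)"
  have c: "?c t \<in> {0..T}" for t using assms(2) by auto
  have "\<bar>freeze T u t x - freeze T u s y\<bar> \<le> H * (\<bar>x - y\<bar> + \<bar>?c t - ?c s\<bar> powr (1 / \<alpha>))"
    using assms(1) c unfolding hoelder_def freeze_def by blast
  also have "\<dots> \<le> H * (\<bar>x - y\<bar> + \<bar>t - s\<bar> powr (1 / \<alpha>))"
  proof (intro mult_left_mono add_left_mono powr_mono2 hoelder_nonneg[OF assms])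
    show "\<bar>?c t - ?c s\<bar> \<le> \<bar>t - s\<bar>" by (simp add: max_def min_def)
  qed (use alpha in auto)
  finally show ?thesis .
qed

lemma freeze_id: "0 \<le> t \<Longrightarrow> t \<le> T \<Longrightarrow> freeze T u t = u t"
  by (intro ext) (simp add: freeze_def)

lemma freeze_continuous:
  assumes "hoelder T H u" "0 < T" shows "continuous_on A (\<lambda>p. freeze T u (fst p) (snd p))"
proof -
  have "((\<lambda>q. freeze T u (fst q) (snd q)) \<longlongrightarrow> freeze T u (fst p) (snd p)) (at p)" for p :: "real \<times> real"
  proof (rule LIM_zero_cancel, rule Lim_null_comparison)
    show "\<forall>\<^sub>F q in at p. norm (freeze T u (fst q) (snd q) - freeze T u (fst p) (snd p)) \<le> H * (\<bar>snd q - snd p\<bar> + \<bar>fst q - fst p\<bar> powr (1 / \<alpha>))"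
      using freeze_hoelder[OF assms] by (intro always_eventually allI) simp
    have "((\<lambda>q. \<bar>fst q - fst p\<bar> powr (1 / \<alpha>)) \<longlongrightarrow> 0 powr (1 / \<alpha>)) (at p)"
    proof (rule tendsto_powr'[OF _ tendsto_const])
      show "((\<lambda>q. \<bar>fst q - fst p\<bar>) \<longlongrightarrow> 0) (at p)" by (auto intro!: tendsto_eq_intros)
    qed (use alpha in auto)
    then show "((\<lambda>q. H * (\<bar>snd q - snd p\<bar> + \<bar>fst q - fst p\<bar> powr (1 / \<alpha>))) \<longlongrightarrow> 0) (at p)"
      using alpha by (auto intro!: tendsto_eq_intros)
  qed
  then have "continuous_on UNIV (\<lambda>p. freeze T u (fst p) (snd p))" by (simp add: continuous_on_def)
  then show ?thesis by (rule continuous_on_subset) simp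
qed

lemma hoelder_continuous:
  assumes "hoelder T H u" "0 < T" shows "continuous_on ({0..T} \<times> UNIV) (\<lambda>p. u (fst p) (snd p))"
  using freeze_continuous[OF assms, of "{0..T} \<times> UNIV"]
  by (rule continuous_on_eq) (auto simp: freeze_id)

lemma freeze_good:
  assumes "hoelder T H u" "0 < T" "\<And>t x. t \<in> {0..T} \<Longrightarrow> \<bar>u t x\<bar> \<le> B"
  shows "bm2 (freeze T u)" "xlip H (freeze T u)"
proof -
  show "bm2 (freeze T u)"
  proof (rule bm2I)
    show "(\<lambda>p. freeze T u (fst p) (snd p)) \<in> borel_measurable (borel \<Otimes>\<^sub>M borel)"
      unfolding borel_prod by (rule borel_measurable_continuous_onI[OF freeze_continuous[OF assms(1,2)]])
    show "\<bar>freeze T u t x\<bar> \<le> B" for t x unfolding freeze_def by (rule assms(3)) (use assms(2) in auto)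
  qed
  show "xlip H (freeze T u)"
    unfolding xlip_def lip_def
  proof (intro allI)
    show "\<bar>freeze T u t x - freeze T u t y\<bar> \<le> H * \<bar>x - y\<bar>" for t x y
      using freeze_hoelder[OF assms(1,2), of t x t y] by simp
  qed
qed

lemma bm2_E_pow: assumes "k \<in> K \<times> K" "bm2 f" shows "bm2 (\<lambda>t. (E \<tau> k ^^ n) (f t))"
  by (induction n) (simp_all add: assms bm2_E)

lemma E_pow_VA: assumes "k \<in> K \<times> K" "bm2 f" shows "(E \<tau> k ^^ n) (VA h b f t) = VA h b (\<lambda>t. (E \<tau> k ^^ n) (f t)) t"
proof (induction n)
  case (Suc n)
  show ?case using E_VA[OF assms(1) bm2_E_pow[OF assms, of n \<tau>], of \<tau> h b t] by (auto simp: Suc.IH)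
qed simp

text \<open>The inequality between \<open>u\<close> at two times at distance \<open>d\<close> is
  averaged and expanded to first order in \<open>d\<close> on both sides. The strict inequality in
  the assumption on \<open>t\<close> leaves room for \<open>d\<close> after the window of length 3
  h.\<close>

lemma averaged_supersolution:
  assumes T: "0 < T" and vs: "viscosity_supersolution \<alpha> K T \<phi> u" and hu: "hoelder T H u" and k: "k \<in> K \<times> K"
    and hb: "0 < h" "0 < b" and t: "0 \<le> t" "t + 3 * h < T"
  shows "gen \<alpha> k (VA h b (freeze T u) t) (VAx h b (freeze T u) t) x \<le> VAt h b (freeze T u) t x"
proof (rule ccontr)
  assume contra: "\<not> ?thesis"
  let ?f = "freeze T u"
  let ?V = "VA h b ?f" and ?Vx = "VAx h b ?f" and ?Vt = "VAt h b ?f"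
  have "bounded ((\<lambda>(t, x). u t x) ` ({0..T} \<times> UNIV))" using vs by (simp add: viscosity_supersolution_def)
  then obtain B where "\<forall>t\<in>{0..T}. \<forall>x. \<bar>u t x\<bar> \<le> B" by (auto simp: bounded_iff)
  then have B: "\<And>t x. t \<in> {0..T} \<Longrightarrow> \<bar>u t x\<bar> \<le> B" by blast
  note f = freeze_good[OF hu T B]
  note u = hoelder_continuous[OF hu T]
  have H: "0 \<le> H" by (rule hoelder_nonneg[OF hu T])
  \<comment> \<open>Four errors will each be at most d \<rho>, against an assumed gap of 5 d
    \<rho>.\<close>
  define \<rho> where "\<rho> = (gen \<alpha> k (?V t) (?Vx t) x - ?Vt t x) / 5"
  have rho: "0 < \<rho>" using contra by (simp add: \<rho>_def)
  define M where "M = 2 * (H * h powr (1 / \<alpha>)) / h\<^sup>2"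
  have tt: "\<bar>VAtt h b ?f s y\<bar> \<le> M" for s y unfolding M_def
  proof (rule VAtt_bound[OF f(1) hb(1)])
    show "\<bar>?f (s + h) y - ?f s y\<bar> \<le> H * h powr (1 / \<alpha>)" for s y
      using freeze_hoelder[OF hu T, of "s + h" y s y] hb by simp
  qed
  note V = VA_smooth[OF f hb, of 0 0]
  define L2 L3 where "L2 = 2 * H / b" and "L3 = 4 * H / b\<^sup>2"
  have c: "c11 H L2 (?V s) (?Vx s)" "c11 L2 L3 (?Vx s) (VAxx h b ?f s)" for s
    unfolding L2_def L3_def using VA_c11[OF f hb] by auto
  define Lm where "Lm = L3 * IB1 + 2 * L2 * IB2"
  have "((\<lambda>d. Lm * time_mod_bound d + M * d / 2) \<longlongrightarrow> Lm * 0 + M * 0 / 2) (at_right 0)"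
    by (intro tendsto_intros time_mod_bound_tendsto) simp
  then have "\<forall>\<^sub>F d in at_right 0. Lm * time_mod_bound d + M * d / 2 < \<rho>"
    by (rule order_tendstoD(2)) (use rho in simp)
  moreover have "\<forall>\<^sub>F d in at_right (0::real). d \<in> {0<..<min 1 (T - t - 3 * h)}"
    by (rule eventually_at_right_real) (use t in auto)
  ultimately have "\<forall>\<^sub>F d in at_right 0. Lm * time_mod_bound d + M * d / 2 < \<rho> \<and> d \<in> {0<..<min 1 (T - t - 3 * h)}"
    by (rule eventually_conj)
  then obtain d where d1: "Lm * time_mod_bound d + M * d / 2 < \<rho>" and d: "0 < d" "d < 1" "d < T - t - 3 * h"
    using eventually_happens'[OF trivial_limit_at_right_real] by fastforce
  \<comment> \<open>The order of choices matters: \<open>d\<close> first, then the auxiliary width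
    \<open>b2\<close> with smoothing cost small against \<open>d\<close>, then the step, because
    \<open>step_error\<close> is small only once \<open>b2\<close> is fixed.\<close>
  define b2 where "b2 = d * \<rho> / (6 * (H + 1))"
  have b2: "0 < b2" using d rho H by (simp add: b2_def)
  have b2H: "6 * b2 * H \<le> d * \<rho>"
  proof -
    have "6 * b2 * H = d * \<rho> * (H / (H + 1))" using H by (simp add: b2_def field_simps)
    also have "\<dots> \<le> d * \<rho> * 1" using H d rho by (intro mult_left_mono) auto
    finally show ?thesis by simp
  qed
  have "((\<lambda>\<tau>. C * \<tau> powr q * (2 * L2 + 4 * H) + step_error H b2 \<tau>) \<longlongrightarrow> C * 0 * (2 * L2 + 4 * H) + 0) (at_right 0)"
    by (intro tendsto_intros step_error_tendsto powr_q_tendsto)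
  then have "\<forall>\<^sub>F \<tau> in at_right 0. C * \<tau> powr q * (2 * L2 + 4 * H) + step_error H b2 \<tau> < \<rho>"
    by (rule order_tendstoD(2)) (use rho in simp)
  then obtain \<tau>0 where \<tau>0: "0 < \<tau>0" "\<And>\<tau>. 0 < \<tau> \<Longrightarrow> \<tau> < \<tau>0 \<Longrightarrow> C * \<tau> powr q * (2 * L2 + 4 * H) + step_error H b2 \<tau> < \<rho>"
    unfolding eventually_at_right_field by auto
  obtain n0 :: nat where "d / \<tau>0 < real n0" using reals_Archimedean2 by blast
  then obtain n where n: "0 < n" "d / \<tau>0 < real n" using d \<tau>0 by (metis divide_pos_pos less_trans of_nat_0_less_iff)
  define \<tau> where "\<tau> = d / real n"
  have tau: "0 < \<tau>" "\<tau> < \<tau>0" "\<tau> < 1" using n d \<tau>0 by (auto simp: \<tau>_def field_simps intro: less_le_trans)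
  have nt: "real n * \<tau> = d" using n by (simp add: \<tau>_def)
  define k' where "k' = 6 * b2 * H + d * (step_error H b2 \<tau> + \<rho>)"
  have "VA h b (\<lambda>t. (E \<tau> k ^^ n) (?f t)) t x - k' \<le> ?V (t + d) x"
  proof (rule VA_compare[OF f(1) bm2_E_pow[OF k f(1)]])
    fix s y assume s: "t \<le> s" "s \<le> t + 3 * h"
    have ids: "?f s = u s" "?f (s + d) = u (s + d)" using s t d hb by (intro freeze_id; simp)+
    have us: "bm (u s)" "lip H (u s)" using bm2_slices(1)[OF f(1), of s] f(2) ids unfolding xlip_def by metis+
    have sT: "0 \<le> s" "s + real n * \<tau> \<le> T" using s t d unfolding nt by auto
    from many_steps[OF T u vs k us b2 tau(1,3) sT rho, of y]
    show "(E \<tau> k ^^ n) (?f s) y - k' \<le> ?f (s + d) y" unfolding ids nt k'_def by simp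
  qed (use hb in auto)
  moreover have eqV: "VA h b (\<lambda>t. (E \<tau> k ^^ n) (?f t)) t = (E \<tau> k ^^ n) (?V t)"
    by (rule E_pow_VA[OF k f(1), symmetric])
  moreover have "?V t x + d * (gen \<alpha> k (?V t) (?Vx t) x - C * \<tau> powr q * (2 * L2 + 4 * H) - Lm * time_mod_bound d) \<le> VA h b (\<lambda>t. (E \<tau> k ^^ n) (?f t)) t x"
    using E_pow_ge[OF c k d(1,2) n(1), of t x]
    unfolding \<tau>_def[symmetric] Lm_def[symmetric] eqV .
  moreover have "?V (t + d) x \<le> ?V t x + d * ?Vt t x + M * d\<^sup>2 / 2"
    using taylor_bound[where f = "\<lambda>s. ?V s x" and f' = "\<lambda>s. ?Vt s x" and f'' = "\<lambda>s. VAtt h b ?f s x", OF smooth23_D(1)[OF V] smooth23_D(2)[OF V] tt, of d t] d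
    by linarith
  ultimately have "d * gen \<alpha> k (?V t) (?Vx t) x \<le> d * ?Vt t x + d * (M * d / 2 + Lm * time_mod_bound d) + d * (C * \<tau> powr q * (2 * L2 + 4 * H) + step_error H b2 \<tau>) + d * \<rho> + 6 * b2 * H"
    unfolding k'_def by (simp add: algebra_simps power2_eq_square)
  also have "\<dots> \<le> d * ?Vt t x + d * \<rho> + d * \<rho> + d * \<rho> + d * \<rho>"
    using d1 \<tau>0(2)[OF tau(1,2)] b2H d by (intro add_mono mult_left_mono order_refl) auto
  also have "\<dots> = d * (?Vt t x + 4 * \<rho>)" by (simp add: algebra_simps)
  finally have "gen \<alpha> k (?V t) (?Vx t) x \<le> ?Vt t x + 4 * \<rho>" using d by simp
  moreover have "5 * \<rho> = gen \<alpha> k (?V t) (?Vx t) x - ?Vt t x" unfolding \<rho>_def by simp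
  ultimately show False using rho by linarith
qed

lemma lower_bound:
  assumes T: "0 < T" and vs: "viscosity_supersolution \<alpha> K T \<phi> u" and hu: "hoelder T H u"
    and d: "0 < \<Delta>" "\<Delta> < 1" and phi: "lip L \<phi>" and u0: "\<And>x. u 0 x = \<phi> x"
    and e: "0 < e" "e \<le> 1" "\<Delta> \<le> e ^ 4" "\<Delta> powr q \<le> e\<^sup>2" and t: "0 \<le> t" "t \<le> T"
  shows "walk \<Delta> \<phi> t x - u t x \<le> (L * (13 / 8 * ID \<Delta>) + H * (39 / 20 + T * (32 + 244 * C))) * e"
proof -
  \<comment> \<open>With this window the time oscillation gives exactly the factor 32 in
    \<open>er\<close>, which is half of the 64 available in the constants.\<close>
  define h b where "h = e\<^sup>2 / 10" and "b = e / 60"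
  have hb: "0 < h" "0 < b" using e by (auto simp: h_def b_def)
  have L: "0 \<le> L" by (rule lip_nonneg[OF phi(1)])
  have H: "0 \<le> H" by (rule hoelder_nonneg[OF hu T])
  have I0: "0 \<le> ID \<Delta>" by (rule I_Delta_nonneg[OF d])
  have e2: "e ^ 4 \<le> e\<^sup>2" using e by (intro power_decreasing) auto
  have de: "\<Delta> \<le> e\<^sup>2" using e e2 by linarith
  have al: "1 / 2 \<le> 1 / \<alpha>" "1 / \<alpha> \<le> 1" using alpha by (auto simp: field_simps)
  have "bounded ((\<lambda>(t, x). u t x) ` ({0..T} \<times> UNIV))" using vs by (simp add: viscosity_supersolution_def)
  then obtain B where "\<forall>t\<in>{0..T}. \<forall>x. \<bar>u t x\<bar> \<le> B" by (auto simp: bounded_iff)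
  then have B: "\<And>t x. t \<in> {0..T} \<Longrightarrow> \<bar>u t x\<bar> \<le> B" by blast
  let ?f = "freeze T u"
  note f = freeze_good[OF hu T B]
  let ?V = "VA h b ?f" and ?Vt = "VAt h b ?f" and ?Vx = "VAx h b ?f"
  have pw: "s powr (1 / \<alpha>) \<le> m * e" if s: "0 \<le> s" "s \<le> c * e\<^sup>2" "c \<le> 1" "c \<le> m\<^sup>2" "0 \<le> m" for s c m
  proof -
    have "c * e\<^sup>2 \<le> 1 * 1" using that e by (intro mult_mono) (auto simp: power_le_one)
    then have s1: "s \<le> 1" using s by simp
    have "s powr (1 / \<alpha>) \<le> s powr (1 / 2)"
    proof (cases "s = 0")
      case False then show ?thesis using s s1 al by (intro powr_mono') auto
    qed simp
    also have "\<dots> = sqrt s" using s by (simp add: powr_half_sqrt)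
    also have "\<dots> \<le> sqrt ((m * e)\<^sup>2)"
    proof (rule real_sqrt_le_mono)
      have "c * e\<^sup>2 \<le> m\<^sup>2 * e\<^sup>2" using s by (intro mult_right_mono) auto
      then show "s \<le> (m * e)\<^sup>2" using s by (simp add: power_mult_distrib)
    qed
    also have "\<dots> = m * e" using s e by simp
    finally show ?thesis .
  qed
  \<comment> \<open>Since 13/10 e^2 may exceed 1, where the exponent 1/\<alpha> no longer improves
    on 1/2, the factor 13/10 is split off.\<close>
  have pw13: "s powr (1 / \<alpha>) \<le> 13 / 10 * e" if s: "0 \<le> s" "s \<le> 13 / 10 * e\<^sup>2" for s
  proof -
    have "s powr (1 / \<alpha>) \<le> (13 / 10 * e\<^sup>2) powr (1 / \<alpha>)" using s alpha by (intro powr_mono2) auto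
    also have "\<dots> = (13 / 10) powr (1 / \<alpha>) * (e\<^sup>2) powr (1 / \<alpha>)" by (rule powr_mult)
    also have "\<dots> \<le> (13 / 10) powr 1 * (1 * e)"
      using al e by (intro mult_mono powr_mono pw[of "e\<^sup>2" 1 1]) auto
    finally show ?thesis by simp
  qed
  define \<omega> where "\<omega> = H * h powr (1 / \<alpha>)"
  have osc: "\<bar>?f (s + h) y - ?f s y\<bar> \<le> \<omega>" for s y
    using freeze_hoelder[OF hu T, of "s + h" y s y] hb by (simp add: \<omega>_def)
  define er where "er = C * \<Delta> powr q * (4 / b + 4) * H + \<omega> * \<Delta> / h\<^sup>2"
  have er0: "0 \<le> er" using C H hb d by (simp add: er_def \<omega>_def)
  have er_le: "er \<le> H * (32 + 244 * C) * e"
  proof -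
    have "C * \<Delta> powr q * (4 / b + 4) * H \<le> C * e\<^sup>2 * (244 / e) * H"
      using C e H hb by (intro mult_right_mono mult_mono) (auto simp: b_def field_simps)
    also have "\<dots> = H * (244 * C) * e" using e by (simp add: power2_eq_square)
    finally have 1: "C * \<Delta> powr q * (4 / b + 4) * H \<le> H * (244 * C) * e" .
    have "h powr (1 / \<alpha>) \<le> 8 / 25 * e" by (rule pw[where c = "1 / 10"]) (auto simp: h_def power2_eq_square)
    then have "\<omega> \<le> H * (8 / 25 * e)" unfolding \<omega>_def using H by (intro mult_left_mono)
    then have "\<omega> * \<Delta> / h\<^sup>2 \<le> H * (8 / 25 * e) * e ^ 4 / h\<^sup>2"
      using e d H by (intro divide_right_mono mult_mono) auto
    also have "\<dots> = H * 32 * e" using e by (simp add: h_def power2_eq_square power4_eq_xxxx)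
    finally show ?thesis using 1 unfolding er_def by (simp add: algebra_simps)
  qed
  \<comment> \<open>Strictness in \<open>r + 3 * h < T\<close> holds in the induction below because
    one more step still ends at \<open>T\<close> or earlier.\<close>
  have step: "E \<Delta> k (?V r) y \<le> ?V (r + \<Delta>) y + \<Delta> * er" if k: "k \<in> K \<times> K" and r: "0 \<le> r" "r + 3 * h < T" for k r y
  proof -
    have "\<Delta> * (gen \<alpha> k (?V r) (?Vx r) y - ?Vt r y) \<le> 0"
      using averaged_supersolution[OF T vs hu k hb r, of y] d by (intro mult_nonneg_nonpos) auto
    then show ?thesis using scheme_consistency[OF d k hb f osc, of r y] unfolding er_def[symmetric] by (simp add: algebra_simps abs_le_iff)
  qed
  have b3: "3 * b = e / 20" by (simp add: b_def)
  show ?thesis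
  \<comment> \<open>Before time 3 h there is no earlier average to compare with, and the moduli of
    continuity in time suffice.\<close>
  proof (cases "t < 3 * h")
    case True
    have "\<bar>walk \<Delta> \<phi> t x - \<phi> x\<bar> \<le> L * time_mod \<Delta> (3 * h)" by (rule walk_init[OF d phi]) (use t True hb in auto)
    also have "\<dots> \<le> L * (13 / 8 * ID \<Delta> * e)"
      by (intro mult_left_mono[OF _ L] time_mod_le[OF d, where c = "13 / 10"]) (use e hb in \<open>auto simp: h_def power2_eq_square\<close>)
    finally have 1: "\<bar>walk \<Delta> \<phi> t x - \<phi> x\<bar> \<le> L * (13 / 8 * ID \<Delta> * e)" .
    have "\<bar>u t x - u 0 x\<bar> \<le> H * (\<bar>x - x\<bar> + \<bar>t - 0\<bar> powr (1 / \<alpha>))"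
      using hu[unfolded hoelder_def, rule_format, of 0 t x x] t T by simp
    also have "\<dots> \<le> H * (13 / 10 * e)"
    proof (rule mult_left_mono[OF _ H])
      have "t \<le> 13 / 10 * e\<^sup>2" using True zero_le_power2[of e] unfolding h_def by linarith
      from pw13[OF t(1) this] show "\<bar>x - x\<bar> + \<bar>t - 0\<bar> powr (1 / \<alpha>) \<le> 13 / 10 * e" using t by simp
    qed
    finally have 2: "\<bar>u t x - \<phi> x\<bar> \<le> H * (13 / 10 * e)" unfolding u0 .
    have "0 \<le> H * (13 / 20 + T * (32 + 244 * C)) * e" using H T C e by auto
    moreover have "walk \<Delta> \<phi> t x - u t x \<le> L * (13 / 8 * ID \<Delta> * e) + H * (13 / 10 * e)" using 1 2 by linarith
    ultimately show ?thesis by (simp add: algebra_simps)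
  next
    case False
    define n where "n = nat \<lfloor>(t - 3 * h) / \<Delta>\<rfloor>"
    \<comment> \<open>Counting back in steps from \<open>t - 3 * h\<close>. The scheme runs 3 h
      ahead of the average, so that the average at \<open>t - 3 * h\<close> involves
      \<open>u\<close> only up to time \<open>t\<close>.\<close>
    define s where "s = t - 3 * h - real n * \<Delta>"
    have nn: "real n \<le> (t - 3 * h) / \<Delta>" "(t - 3 * h) / \<Delta> < real n + 1"
      using False d unfolding n_def by simp_all
    have s: "0 \<le> s" "s \<le> \<Delta>"
      using nn d by (auto simp: s_def field_simps)
    define c0 where "c0 = L * (13 / 8 * ID \<Delta> * e) + H * (e / 20 + 13 / 10 * e)"
    have base: "walk \<Delta> \<phi> (s + 3 * h) y \<le> ?V s y + c0" for y
    proof -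
      have "\<bar>walk \<Delta> \<phi> (s + 3 * h) y - \<phi> y\<bar> \<le> L * time_mod \<Delta> (\<Delta> + 3 * h)" by (rule walk_init[OF d phi]) (use s hb d in auto)
      also have "\<dots> \<le> L * (13 / 8 * ID \<Delta> * e)"
        by (intro mult_left_mono[OF _ L] time_mod_le[OF d, where c = "13 / 10"]) (use e hb d de in \<open>auto simp: h_def power2_eq_square\<close>)
      finally have 1: "walk \<Delta> \<phi> (s + 3 * h) y \<le> \<phi> y + L * (13 / 8 * ID \<Delta> * e)" by linarith
      have "\<phi> y - H * (e / 20 + 13 / 10 * e) \<le> ?V s y"
      proof (rule VA_ge[OF f(1)])
        fix r z assume r: "s \<le> r" "r \<le> s + 3 * h" "y \<le> z" "z \<le> y + 3 * b"
        have "\<bar>?f r z - ?f 0 y\<bar> \<le> H * (\<bar>z - y\<bar> + \<bar>r - 0\<bar> powr (1 / \<alpha>))" by (rule freeze_hoelder[OF hu T])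
        also have "\<dots> \<le> H * (e / 20 + 13 / 10 * e)"
        proof (intro mult_left_mono[OF _ H] add_mono)
          show "\<bar>z - y\<bar> \<le> e / 20" using r b3 by auto
          have "0 \<le> r" "r \<le> 13 / 10 * e\<^sup>2" using r s de unfolding h_def by auto
          from pw13[OF this] show "\<bar>r - 0\<bar> powr (1 / \<alpha>) \<le> 13 / 10 * e" using \<open>0 \<le> r\<close> by simp
        qed
        finally have "\<bar>?f r z - ?f 0 y\<bar> \<le> H * (e / 20 + 13 / 10 * e)" .
        moreover have "?f 0 y = \<phi> y" using freeze_id[of 0 T u] T by (simp add: u0)
        ultimately show "\<phi> y - H * (e / 20 + 13 / 10 * e) \<le> ?f r z" by linarith
      qed (use hb in auto)
      then show ?thesis using 1 by (simp add: c0_def)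
    qed
    \<comment> \<open>Monotonicity of each \<open>E \<Delta> k\<close> carries the comparison over
      one step, at the cost of one consistency error.\<close>
    have ind: "walk \<Delta> \<phi> (s + 3 * h + real j * \<Delta>) y \<le> ?V (s + real j * \<Delta>) y + c0 + real j * (\<Delta> * er)" if "j \<le> n" for j y
      using that
    proof (induction j arbitrary: y)
      case 0
      then show ?case using base by simp
    next
      case (Suc j)
      let ?r = "s + real j * \<Delta>"
      have "real (Suc j) * \<Delta> \<le> real n * \<Delta>" using Suc.prems d by (intro mult_right_mono) auto
      then have "?r + \<Delta> + 3 * h \<le> T" using t unfolding s_def by (simp add: algebra_simps)
      then have r: "0 \<le> ?r" "?r + 3 * h < T" using s d by auto
      have w: "walk \<Delta> \<phi> (s + 3 * h + real (Suc j) * \<Delta>) = S (K \<times> K) \<Delta> (walk \<Delta> \<phi> (?r + 3 * h))"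
        using walk_step[of \<Delta> "?r + 3 * h" \<phi>] r d hb by (simp add: algebra_simps)
      have lw: "lip L (walk \<Delta> \<phi> (?r + 3 * h))" unfolding walk_def by (rule S_pow_lip[OF order_refl KK_ne phi d])
      have lV: "lip H (?V ?r)" by (rule c11_lip[OF VA_c11(1)[OF f hb]])
      have "E \<Delta> k (walk \<Delta> \<phi> (?r + 3 * h)) y \<le> ?V (s + real (Suc j) * \<Delta>) y + c0 + real (Suc j) * (\<Delta> * er)" if k: "k \<in> K \<times> K" for k
      proof -
        have "lip H (\<lambda>x. (c0 + real j * (\<Delta> * er)) + 1 * ?V ?r (x + 0))"
          using lV by (simp add: lip_def)
        then have "E \<Delta> k (walk \<Delta> \<phi> (?r + 3 * h)) y \<le> E \<Delta> k (\<lambda>x. (c0 + real j * (\<Delta> * er)) + 1 * ?V ?r (x + 0)) y"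
          by (rule E_mono[OF k lw]) (use Suc.IH Suc.prems in \<open>simp add: algebra_simps\<close>)
        also have "\<dots> = (c0 + real j * (\<Delta> * er)) + 1 * E \<Delta> k (?V ?r) (y + 0)" by (rule E_affine[OF k lV])
        also have "E \<Delta> k (?V ?r) (y + 0) \<le> ?V (?r + \<Delta>) (y + 0) + \<Delta> * er" by (rule step[OF k r])
        finally show ?thesis by (simp add: algebra_simps)
      qed
      then show ?case unfolding w by (rule S_le[OF KK_ne])
    qed
    have tn: "s + 3 * h + real n * \<Delta> = t" by (simp add: s_def)
    have sn: "s + real n * \<Delta> = t - 3 * h" by (simp add: s_def)
    have "walk \<Delta> \<phi> t x \<le> ?V (t - 3 * h) x + c0 + real n * (\<Delta> * er)" using ind[of n x] unfolding tn sn by simp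
    moreover have "real n * (\<Delta> * er) \<le> T * (H * (32 + 244 * C) * e)"
    proof -
      have "real n * \<Delta> \<le> T" using sn t s hb by linarith
      then have "real n * \<Delta> * er \<le> T * er" using er0 by (intro mult_right_mono) auto
      also have "\<dots> \<le> T * (H * (32 + 244 * C) * e)" using T er_le by (intro mult_left_mono) auto
      finally show ?thesis by (simp add: mult.assoc)
    qed
    moreover have "?V (t - 3 * h) x \<le> u t x + H * (e / 20 + 11 / 20 * e)"
    \<comment> \<open>The window reaches back by 3/10 e^2 from \<open>t\<close>, and (11/20)^2 \<ge>
      3/10.\<close>
    proof (rule VA_le[OF f(1)])
      fix r z assume r: "t - 3 * h \<le> r" "r \<le> t - 3 * h + 3 * h" "x \<le> z" "z \<le> x + 3 * b"
      have "\<bar>?f r z - ?f t x\<bar> \<le> H * (\<bar>z - x\<bar> + \<bar>r - t\<bar> powr (1 / \<alpha>))" by (rule freeze_hoelder[OF hu T])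
      also have "\<dots> \<le> H * (e / 20 + 11 / 20 * e)"
      proof (intro mult_left_mono[OF _ H] add_mono)
        show "\<bar>z - x\<bar> \<le> e / 20" using r b3 by auto
        show "\<bar>r - t\<bar> powr (1 / \<alpha>) \<le> 11 / 20 * e"
          by (rule pw[where c = "3 / 10"]) (use r in \<open>auto simp: h_def power2_eq_square\<close>)
      qed
      finally show "?f r z \<le> u t x + H * (e / 20 + 11 / 20 * e)" unfolding freeze_id[OF t, of u] by linarith
    qed (use hb in auto)
    ultimately show ?thesis unfolding c0_def by (simp add: algebra_simps)
  qed
qed

end

section \<open>The constants\<close>

text \<open>Integrating by parts twice against \<open>p\<close> with \<open>p'' = 1\<close> and \<open>|p| \<le> 1/16\<close> on \<open>[-1, 0]\<close>.\<close>

lemma abs_second_derivative_integral: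
  fixes f :: "real \<Rightarrow> real"
  assumes d: "\<And>t. (f has_real_derivative f' t) (at t)" "\<And>t. (f' has_real_derivative f'' t) (at t)"
    and c: "continuous_on UNIV f''"
    and z: "f (-1) = 0" "f 0 = 0" "f' (-1) = 0" "f' 0 = 0"
  shows "16 * (LBINT t:{-1<..<0}. f t) \<le> (LBINT t:{-1<..<0}. \<bar>f'' t\<bar>)"
proof -
  define p where "p t = (t + 1 / 2)\<^sup>2 / 2 - 1 / 16" for t :: real
  have cf: "continuous_on UNIV f" using d(1) by (meson DERIV_continuous_on has_field_derivative_at_within)
  have cp: "continuous_on UNIV p" unfolding p_def[abs_def] by (auto intro!: continuous_intros)
  have int: "set_integrable lborel {-1<..<0} g" if "continuous_on UNIV g" for g :: "real \<Rightarrow> real"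
    by (rule set_integrable_subset[of _ "{-1..0}"])
       (auto intro!: borel_integrable_atLeastAtMost' continuous_on_subset[OF that])
  have ib: "set_integrable lborel {-1<..<0} f" "set_integrable lborel {-1<..<0} (\<lambda>t. p t * f'' t)" "set_integrable lborel {-1<..<0} (\<lambda>t. \<bar>f'' t\<bar>)"
    by (intro int cf continuous_on_mult cp c continuous_on_rabs)+
  have der: "((\<lambda>t. p t * f' t - (t + 1 / 2) * f t) has_real_derivative p t * f'' t - f t) (at t within A)" for t A
    unfolding p_def by (rule DERIV_subset[where s = UNIV]) (auto intro!: derivative_eq_intros d simp: algebra_simps)
  have "(\<integral>t. indicator {-1..0} t *\<^sub>R (p t * f'' t - f t) \<partial>lborel) = (p 0 * f' 0 - (0 + 1 / 2) * f 0) - (p (-1) * f' (-1) - (-1 + 1 / 2) * f (-1))"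
    by (rule integral_FTC_Icc[where F = "\<lambda>t. p t * f' t - (t + 1 / 2) * f t"])
       (auto simp: has_real_derivative_iff_has_vector_derivative[symmetric] intro!: der continuous_intros continuous_on_subset[OF cf] continuous_on_subset[OF cp] continuous_on_subset[OF c])
  also have "\<dots> = 0" by (simp add: z)
  also have "(\<integral>t. indicator {-1..0} t *\<^sub>R (p t * f'' t - f t) \<partial>lborel) = (LBINT t:{-1<..<0}. p t * f'' t - f t)"
    unfolding set_lebesgue_integral_def
  proof (rule integral_cong_AE)
    have "AE t in lborel. t \<noteq> (-1::real)" "AE t in lborel. t \<noteq> (0::real)" by (rule AE_lborel_singleton)+
    then show "AE t in lborel. indicator {-1..0} t *\<^sub>R (p t * f'' t - f t) = indicator {-1<..<0} t *\<^sub>R (p t * f'' t - f t)"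
      by eventually_elim (auto split: split_indicator)
    have [measurable]: "(\<lambda>t. p t * f'' t - f t) \<in> borel_measurable borel"
      by (intro borel_measurable_diff borel_measurable_times borel_measurable_continuous_onI cf cp c)
    show "(\<lambda>t. indicator {-1..0} t *\<^sub>R (p t * f'' t - f t)) \<in> borel_measurable lborel"
      "(\<lambda>t. indicator {-1<..<0} t *\<^sub>R (p t * f'' t - f t)) \<in> borel_measurable lborel" by measurable
  qed
  also have "\<dots> = (LBINT t:{-1<..<0}. p t * f'' t) - (LBINT t:{-1<..<0}. f t)"
    by (rule set_integral_diff(2)[OF ib(2,1)])
  finally have "(LBINT t:{-1<..<0}. f t) = (LBINT t:{-1<..<0}. p t * f'' t)" by simp
  also have "\<dots> \<le> (LBINT t:{-1<..<0}. 1 / 16 * \<bar>f'' t\<bar>)"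
  proof (rule set_integral_mono[OF ib(2)])
    show "set_integrable lborel {-1<..<0} (\<lambda>t. 1 / 16 * \<bar>f'' t\<bar>)" using ib(3) by simp
    fix t :: real assume "t \<in> {-1<..<0}"
    then have "t * (t + 1) \<le> 0" by (intro mult_nonpos_nonneg) auto
    then have "(t + 1 / 2)\<^sup>2 \<le> 1 / 4" by (simp add: power2_eq_square algebra_simps)
    moreover have "0 \<le> (t + 1 / 2)\<^sup>2" by simp
    ultimately have "\<bar>p t\<bar> \<le> 1 / 16" unfolding p_def by linarith
    then have "\<bar>p t * f'' t\<bar> \<le> 1 / 16 * \<bar>f'' t\<bar>" unfolding abs_mult by (rule mult_right_mono) simp
    then show "p t * f'' t \<le> 1 / 16 * \<bar>f'' t\<bar>" by linarith
  qed
  also have "\<dots> = 1 / 16 * (LBINT t:{-1<..<0}. \<bar>f'' t\<bar>)" by simp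
  finally show ?thesis by simp
qed

text \<open>The pure second time derivative is enough: for each \<open>x\<close> the time slice
  vanishes with its first derivative at -1 and 0, so the one-dimensional inequality applies.
  Integrating over \<open>x\<close>, where \<open>\<zeta>\<close> has mass 1, and exchanging the
  integrals gives the bound.\<close>

lemma M_zeta_ge: assumes "mollifier \<zeta>" shows "16 \<le> M_zeta \<zeta>"
proof -
  have "smooth_plane \<zeta>" using assms by (simp add: mollifier_def)
  then obtain D :: "nat \<Rightarrow> nat \<Rightarrow> real \<Rightarrow> real \<Rightarrow> real" where D0: "D 0 0 = \<zeta>"
    and D': "\<forall>l k. continuous_on UNIV (\<lambda>(t, x). D l k t x)"
      "\<forall>l k t x. ((\<lambda>s. D l k s x) has_real_derivative D (Suc l) k t x) (at t) \<and> (D l k t has_real_derivative D l (Suc k) t x) (at x)"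
    unfolding smooth_plane_def by (elim exE conjE) (rule that)
  have Dc: "continuous_on UNIV (\<lambda>(t, x). D l k t x)" for l k using D'(1) by simp
  have Dt: "((\<lambda>s. D l k s x) has_real_derivative D (Suc l) k t x) (at t)" for l k t x using D'(2) by simp
  have pos: "0 \<le> \<zeta> t x" for t x using assms by (simp add: mollifier_def)
  have supp: "\<zeta> t x = 0" if "\<not> (-1 < t \<and> t < 0 \<and> \<bar>x\<bar> < 1)" for t x
  proof (rule ccontr)
    assume "\<zeta> t x \<noteq> 0"
    then have "(t, x) \<in> closure {(t, x). \<zeta> t x \<noteq> 0}" by (intro subsetD[OF closure_subset]) simp
    then show False using assms that unfolding mollifier_def by blast
  qed
  have one: "(LBINT p. \<zeta> (fst p) (snd p)) = 1" using assms by (simp add: mollifier_def)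
  define g where "g t x = \<bar>D 2 0 t x\<bar>" for t x
  let ?I = "{-1<..<0::real}" and ?J = "{-1<..<1::real}"
  have "partial_tx 2 0 \<zeta> = D 2 0"
  proof -
    have "deriv (\<lambda>s. D l 0 s x) t = D (Suc l) 0 t x" for l t x by (rule DERIV_imp_deriv[OF Dt])
    then show ?thesis unfolding partial_tx_def D0[symmetric] by (simp add: numeral_2_eq_2)
  qed
  then have "(LBINT t:?I. LBINT x:?J. g t x) \<in> (\<lambda>(l, k). LBINT t:{-1<..<0}. LBINT x:{-1<..<1}. \<bar>partial_tx l k \<zeta> t x\<bar>) ` {(l, k). 1 \<le> k + l \<and> k + l \<le> 2}"
    unfolding g_def by (intro image_eqI[of _ _ "(2, 0)"]) auto
  moreover have "finite {(l, k). 1 \<le> k + l \<and> k + l \<le> (2::nat)}"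
    by (rule finite_subset[of _ "{..2} \<times> {..2}"]) auto
  ultimately have ge: "(LBINT t:?I. LBINT x:?J. g t x) \<le> M_zeta \<zeta>"
    unfolding M_zeta_def by (intro Max_ge) auto
  have ci: "integrable (lborel \<Otimes>\<^sub>M lborel) (\<lambda>(t, x). indicator ?I t * indicator ?J x * h t x)" if "continuous_on UNIV (\<lambda>(t, x). h t x)" for h :: "real \<Rightarrow> real \<Rightarrow> real"
  proof -
    have "set_integrable lborel ({-1..0::real} \<times> {-1..1::real}) (\<lambda>(t, x). h t x)"
      unfolding set_integrable_def
      by (rule borel_integrable_compact[OF compact_Times[OF compact_Icc compact_Icc] continuous_on_subset[OF that]]) simp
    then have "set_integrable lborel (?I \<times> ?J) (\<lambda>(t, x). h t x)"
      by (rule set_integrable_subset) (auto simp: borel_prod[symmetric])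
    then have "integrable lborel (\<lambda>p. indicator (?I \<times> ?J) p *\<^sub>R (\<lambda>(t, x). h t x) p)" by (simp add: set_integrable_def)
    also have "(\<lambda>p. indicator (?I \<times> ?J) p *\<^sub>R (\<lambda>(t, x). h t x) p) = (\<lambda>(t, x). indicator ?I t * indicator ?J x * h t x)"
      by (auto simp: indicator_times)
    finally show ?thesis by (simp add: lborel_prod)
  qed
  have cg: "continuous_on UNIV (\<lambda>(t, x). g t x)"
    using continuous_on_rabs[OF Dc[of 2 0]] by (simp add: g_def split_beta)
  have cz: "continuous_on UNIV (\<lambda>(t, x). \<zeta> t x)" using Dc[of 0 0] by (simp add: D0)
  have z0: "\<zeta> t x = indicator ?I t * indicator ?J x * \<zeta> t x" for t x
    using supp[of t x] by (auto simp: indicator_def abs_less_iff)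
  have "1 = (\<integral>p. (\<lambda>(t, x). indicator ?I t * indicator ?J x * \<zeta> t x) p \<partial>(lborel \<Otimes>\<^sub>M lborel))"
  proof -
    have "(\<lambda>p. \<zeta> (fst p) (snd p)) = (\<lambda>(t, x). indicator ?I t * indicator ?J x * \<zeta> t x)"
      by (intro ext) (simp only: split_beta, rule z0)
    then show ?thesis using one unfolding lborel_prod by simp
  qed
  also have "\<dots> = (\<integral>x. (\<integral>t. indicator ?I t * indicator ?J x * \<zeta> t x \<partial>lborel) \<partial>lborel)"
    using lborel_pair.integral_snd[OF ci[OF cz]] by simp
  also have "\<dots> = (\<integral>x. indicator ?J x * (LBINT t:?I. \<zeta> t x) \<partial>lborel)"
    by (simp add: set_lebesgue_integral_def mult.assoc mult.left_commute[of _ "indicator ?J _"])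
  finally have o1: "1 = (\<integral>x. indicator ?J x * (LBINT t:?I. \<zeta> t x) \<partial>lborel)" .
  have slice: "16 * (LBINT t:?I. \<zeta> t x) \<le> (LBINT t:?I. g t x)" for x
    unfolding g_def
  proof (rule abs_second_derivative_integral[where f' = "\<lambda>t. D 1 0 t x"])
    show "((\<lambda>t. \<zeta> t x) has_real_derivative D 1 0 t x) (at t)" for t using Dt[of 0 0 x t] by (simp add: D0)
    show "((\<lambda>t. D 1 0 t x) has_real_derivative D 2 0 t x) (at t)" for t using Dt[of 1 0 x t] by (simp add: numeral_2_eq_2)
    show "continuous_on UNIV (\<lambda>t. D 2 0 t x)"
      using continuous_on_compose2[OF Dc[of 2 0], of UNIV "\<lambda>t. (t, x)"] by (simp add: continuous_intros)
    show z: "\<zeta> (-1) x = 0" "\<zeta> 0 x = 0" by (rule supp; simp)+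
    \<comment> \<open>A zero of the nonnegative \<open>\<zeta>\<close> is a minimum in time.\<close>
    have min: "D 1 0 t x = 0" if "\<zeta> t x = 0" for t
      by (rule DERIV_local_min[of "\<lambda>t. \<zeta> t x" _ t 1]) (use Dt[of 0 0 x t] that pos in \<open>auto simp: D0\<close>)
    show "D 1 0 (-1) x = 0" "D 1 0 0 x = 0" by (rule min[OF z(1)], rule min[OF z(2)])
  qed
  have i1: "integrable lborel (\<lambda>x. indicator ?J x * (LBINT t:?I. \<zeta> t x))"
    using lborel_pair.integrable_snd[OF ci[OF cz]] by (simp add: set_lebesgue_integral_def mult.assoc mult.left_commute[of _ "indicator ?J _"])
  have i2: "integrable lborel (\<lambda>x. indicator ?J x * (LBINT t:?I. g t x))"
    using lborel_pair.integrable_snd[OF ci[OF cg]] by (simp add: set_lebesgue_integral_def mult.assoc mult.left_commute[of _ "indicator ?J _"])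
  have "16 = (\<integral>x. 16 * (indicator ?J x * (LBINT t:?I. \<zeta> t x)) \<partial>lborel)" using o1 by simp
  also have "\<dots> \<le> (\<integral>x. indicator ?J x * (LBINT t:?I. g t x) \<partial>lborel)"
    by (rule integral_mono[OF integrable_mult_right[OF i1] i2]) (use slice in \<open>auto split: split_indicator\<close>)
  also have "\<dots> = (\<integral>x. (\<integral>t. indicator ?I t * indicator ?J x * g t x \<partial>lborel) \<partial>lborel)"
    by (simp add: set_lebesgue_integral_def mult.assoc mult.left_commute[of _ "indicator ?J _"])
  also have "\<dots> = (\<integral>t. (\<integral>x. indicator ?I t * indicator ?J x * g t x \<partial>lborel) \<partial>lborel)"
    by (rule lborel_pair.Fubini_integral[OF ci[OF cg]])
  also have "\<dots> = (LBINT t:?I. LBINT x:?J. g t x)"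
    by (simp add: set_lebesgue_integral_def mult.assoc)
  finally show ?thesis using ge by linarith
qed

text \<open>Finiteness enters first: a supremum over no laws would be minus infinity, so some law
  exists, and its expectation of an absolute value is nonnegative.\<close>

lemma Ehat_nonneg:
  assumes "ereal m = Ehat \<alpha> K (\<lambda>\<omega>. \<bar>\<omega> 1\<bar>)" shows "0 \<le> m"
proof -
  let ?F = "\<lambda>P. enn2ereal (\<integral>\<^sup>+ \<omega>. ennreal \<bar>\<omega> 1\<bar> \<partial>P) - enn2ereal (\<integral>\<^sup>+ \<omega>. ennreal (- \<bar>\<omega> 1\<bar>) \<partial>P)"
  let ?A = "nonlinear_levy_laws (stable_triplets \<alpha> K)"
  have eq: "ereal m = (SUP P\<in>?A. ?F P)" using assms by (simp add: Ehat_def)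
  have "?A \<noteq> {}"
  proof
    assume "?A = {}"
    then have "ereal m = bot" using eq by simp
    then show False by (simp add: bot_ereal_def)
  qed
  then obtain P where P: "P \<in> ?A" by blast
  have "0 \<le> ?F P" by (simp add: ennreal_neg zero_ennreal.rep_eq)
  also have "?F P \<le> (SUP P\<in>?A. ?F P)" by (rule SUP_upper[OF P])
  finally have "0 \<le> ereal m" using eq by simp
  then show ?thesis by simp
qed

context stable_scheme begin

text \<open>A real supremum can be compared with its members only if it is bounded. The first
  moments are bounded uniformly in \<open>k\<close> by one step applied to the Huber function, which
  dominates the absolute value.\<close>

lemma Etilde_abs_nonneg: "0 \<le> Etilde K W (\<lambda>z. \<bar>z\<bar>)"
proof -
  obtain \<tau> :: real where t: "0 < \<tau>" "\<tau> < 1" using dense[of 0 "1 :: real"] by auto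
  define d where "d = \<tau> powr (1 / \<alpha>)"
  have d: "0 < d" using t by (simp add: d_def)
  have bd: "(\<integral>z. \<bar>z\<bar> \<partial>W k) \<le> (huber 1 0 + \<tau> * huber_growth 1 \<tau>) / d" if k: "k \<in> K \<times> K" for k
  proof -
    interpret W: real_distribution "W k" using W_dist[OF k] .
    have "d * (\<integral>z. \<bar>z\<bar> \<partial>W k) = (\<integral>z. \<bar>0 + d * z\<bar> \<partial>W k)" using d by (simp add: abs_mult)
    also have "\<dots> \<le> (\<integral>z. huber 1 (0 + d * z) \<partial>W k)"
      by (rule integral_mono) (use E_int[OF k c11_lip[OF huber_c11[of 1]], of 0 d] W_int[OF k] huber_ge[of 1] in auto)
    also have "\<dots> = E \<tau> k (huber 1) 0" by (simp add: E_def sm_def d_def)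
    also have "\<dots> \<le> huber 1 0 + \<tau> * huber_growth 1 \<tau>"
    proof -
      have "huber_growth 1 \<tau> = 1 / 1 * I1 \<tau> + 2 * 1 * I2 \<tau>" by (simp add: huber_growth_def)
      then have "\<bar>E \<tau> k (huber 1) 0 - huber 1 0\<bar> \<le> \<tau> * huber_growth 1 \<tau>"
        using E_props(2)[OF huber_c11[of 1] k t, of 0] by simp
      then show ?thesis by linarith
    qed
    finally show ?thesis using d by (simp add: field_simps)
  qed
  obtain k where k: "k \<in> K \<times> K" using KK_ne by blast
  have "0 \<le> (\<integral>z. \<bar>z\<bar> \<partial>W k)" by simp
  also have "\<dots> \<le> Etilde K W (\<lambda>z. \<bar>z\<bar>)"
    unfolding Etilde_def by (rule cSUP_upper[OF k]) (use bd in \<open>auto intro!: bdd_aboveI2\<close>)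
  finally show ?thesis .
qed

lemma discrete_scheme_walk:
  assumes ds: "discrete_scheme \<alpha> K W T \<Delta> \<phi> v" and d: "0 < \<Delta>" and t: "0 \<le> t" "t \<le> T"
  shows "v t = walk \<Delta> \<phi> t"
proof -
  have "\<forall>t. 0 \<le> t \<and> t \<le> T \<and> nat \<lfloor>t / \<Delta>\<rfloor> = n \<longrightarrow> v t = walk \<Delta> \<phi> t" for n
  proof (induction n)
    case 0
    show ?case
    proof (intro allI impI ext)
      fix t x assume h: "0 \<le> t \<and> t \<le> T \<and> nat \<lfloor>t / \<Delta>\<rfloor> = 0"
      then have "t / \<Delta> < 1" by linarith
      then have "t < \<Delta>" using d by simp
      then show "v t x = walk \<Delta> \<phi> t x" using ds h by (simp add: discrete_scheme_def walk_def)
    qed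
  next
    case (Suc n)
    show ?case
    proof (intro allI impI ext)
      fix t x assume h: "0 \<le> t \<and> t \<le> T \<and> nat \<lfloor>t / \<Delta>\<rfloor> = Suc n"
      then have "1 \<le> t / \<Delta>" by linarith
      then have td: "\<Delta> \<le> t" using d by simp
      have "(t - \<Delta>) / \<Delta> = t / \<Delta> - 1" using d by (simp add: diff_divide_distrib)
      moreover have "\<lfloor>t / \<Delta>\<rfloor> = int (Suc n)" using h by linarith
      ultimately have "nat \<lfloor>(t - \<Delta>) / \<Delta>\<rfloor> = n" by simp
      then have IH: "v (t - \<Delta>) = walk \<Delta> \<phi> (t - \<Delta>)" using Suc.IH h td d by auto
      have "v t x = Etilde K W (\<lambda>z. v (t - \<Delta>) (x + \<Delta> powr (1 / \<alpha>) * z))"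
        using ds h td by (simp add: discrete_scheme_def)
      also have "\<dots> = S (K \<times> K) \<Delta> (walk \<Delta> \<phi> (t - \<Delta>)) x"
        unfolding IH by (simp add: Etilde_def S_def E_def sm_def)
      also have "\<dots> = walk \<Delta> \<phi> t x" using walk_step[OF d, of "t - \<Delta>"] td by simp
      finally show "v t x = walk \<Delta> \<phi> t x" .
    qed
  qed
  then show ?thesis using t by blast
qed

end

section \<open>Comparison of the numerical factors with the stated constants\<close>

lemma berry_esseen_constants:
  fixes c\<phi> cH mX m\<xi> m\<zeta> T M C I :: real
  assumes nn: "0 \<le> c\<phi>" "0 \<le> cH" "0 \<le> mX" "0 \<le> m\<xi>" "0 < T" "0 < M" "0 < C" "0 \<le> I" and mz: "16 \<le> m\<zeta>"
  shows "c\<phi> * (1 / 10 + 25 / 8 * I + T * (26 * I + 244 * C)) \<le> U_0 c\<phi> I mX m\<xi> m\<zeta> T M C"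
    and "c\<phi> * (13 / 8 * I) + cH * (39 / 20 + T * (32 + 244 * C)) \<le> (L_0 c\<phi> cH mX m\<xi> m\<zeta> T M C + U_0 c\<phi> I mX m\<xi> m\<zeta> T M C) / 2"
proof -
  define R where "R = 2 * (1 + m\<xi>) + 4 * M + 26 * C"
  have R: "2 + 26 * C \<le> R" using nn by (simp add: R_def)
  \<comment> \<open>From 16 (2 + 26 C) = 32 + 416 C and the factor 2 T in both constants come the
    numbers 64 and 832.\<close>
  have Rm: "16 * (2 + 26 * C) \<le> m\<zeta> * R" using mz R nn by (intro mult_mono) auto
  have time_mod: "T * (64 + 832 * C) \<le> 2 * T * (m\<zeta> * R)" using mult_left_mono[OF Rm, of "2 * T"] nn by (simp add: algebra_simps)
  have U: "c\<phi> * ((1 + I) * (4 + T * (64 + 832 * C))) \<le> U_0 c\<phi> I mX m\<xi> m\<zeta> T M C"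
    unfolding U_0_def R_def[symmetric]
  proof (rule mult_left_mono[OF _ nn(1)])
    have "(1 + I) * (T * (64 + 832 * C)) \<le> (1 + I) * (2 * T * (m\<zeta> * R))" using time_mod nn by (intro mult_left_mono) auto
    then show "(1 + I) * (4 + T * (64 + 832 * C)) \<le> mX + m\<xi> + 4 * (1 + I) + 2 * T * m\<zeta> * (1 + I) * R"
      using nn by (simp add: algebra_simps)
  qed
  have L: "cH * (4 + T * (64 + 832 * C)) \<le> L_0 c\<phi> cH mX m\<xi> m\<zeta> T M C"
  proof -
    have "cH * (T * (64 + 832 * C)) \<le> cH * (2 * T * (m\<zeta> * R))" using time_mod nn by (intro mult_left_mono) auto
    moreover have "0 \<le> c\<phi> * (mX + m\<xi>)" using nn by simp
    ultimately show ?thesis unfolding L_0_def R_def[symmetric] by (simp add: algebra_simps)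
  qed
  have pp: "0 \<le> T * C" "0 \<le> T * I" "0 \<le> I * (T * C)" using nn by auto
  have e1: "(1 + I) * (4 + T * (64 + 832 * C)) = 4 + 4 * I + 64 * T + 832 * (T * C) + 64 * (T * I) + 832 * (I * (T * C))"
    by (simp add: algebra_simps)
  have e2: "1 / 10 + 25 / 8 * I + T * (26 * I + 244 * C) = 1 / 10 + 25 / 8 * I + 26 * (T * I) + 244 * (T * C)"
    by (simp add: algebra_simps)
  have "1 / 10 + 25 / 8 * I + T * (26 * I + 244 * C) \<le> (1 + I) * (4 + T * (64 + 832 * C))"
    unfolding e1 e2 using pp nn by linarith
  then show "c\<phi> * (1 / 10 + 25 / 8 * I + T * (26 * I + 244 * C)) \<le> U_0 c\<phi> I mX m\<xi> m\<zeta> T M C"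
    using U nn(1) by (meson mult_left_mono order_trans)
  have "13 / 4 * I \<le> (1 + I) * (4 + T * (64 + 832 * C))" unfolding e1 using pp nn by linarith
  then have "13 / 8 * I \<le> (1 + I) * (4 + T * (64 + 832 * C)) / 2" by simp
  then have a: "c\<phi> * (13 / 8 * I) \<le> c\<phi> * ((1 + I) * (4 + T * (64 + 832 * C)) / 2)" using nn(1) by (rule mult_left_mono)
  \<comment> \<open>The factor 32 T is matched exactly; 39/20 must stay below 2, and 244 below
    416.\<close>
  have "39 / 20 + T * (32 + 244 * C) \<le> (4 + T * (64 + 832 * C)) / 2" using pp nn by (simp add: algebra_simps)
  then have b: "cH * (39 / 20 + T * (32 + 244 * C)) \<le> cH * ((4 + T * (64 + 832 * C)) / 2)" using nn(2) by (rule mult_left_mono)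
  show "c\<phi> * (13 / 8 * I) + cH * (39 / 20 + T * (32 + 244 * C)) \<le> (L_0 c\<phi> cH mX m\<xi> m\<zeta> T M C + U_0 c\<phi> I mX m\<xi> m\<zeta> T M C) / 2"
    using a b U L by simp
qed

theorem theorem5p1:
  fixes \<alpha> lam1 lam2 T \<Delta> q C M c\<phi> cH mX :: real
    and K :: "real set"
    and W :: "real \<times> real \<Rightarrow> real measure"
    and \<beta>1 \<beta>2 :: "real \<times> real \<Rightarrow> real \<Rightarrow> real"
    and \<phi> :: "real \<Rightarrow> real"
    and u u\<Delta> \<zeta> :: "real \<Rightarrow> real \<Rightarrow> real"
  assumes "1 < \<alpha>" "\<alpha> < 2"
    and "0 \<le> lam1" "0 \<le> lam2" "K \<subseteq> {lam1<..<lam2}" "K \<noteq> {}" "K \<in> sets borel"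
    and "xi_laws \<alpha> K W \<beta>1 \<beta>2"
    and "assumption_A1 K W \<beta>1 \<beta>2"
    and "0 < M" "assumption_A2 \<alpha> K \<beta>1 \<beta>2 M" "beta_bound \<alpha> K \<beta>1 \<beta>2 M"
    and "0 < q" "0 < C" "assumption_A3 \<alpha> K \<beta>1 \<beta>2 q C"
    and "bounded (range \<phi>)" "c\<phi>-lipschitz_on UNIV \<phi>"
    and "0 < T" "0 < \<Delta>" "\<Delta> < 1"
    and "\<And>t x. t \<in> {0..T} \<Longrightarrow> ereal (u t x) = Ehat \<alpha> K (\<lambda>\<omega>. \<phi> (x + \<omega> t))"
    and "viscosity_solution \<alpha> K T \<phi> u"
    and "discrete_scheme \<alpha> K W T \<Delta> \<phi> u\<Delta>"
    and "ereal mX = Ehat \<alpha> K (\<lambda>\<omega>. \<bar>\<omega> 1\<bar>)"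
    and "\<And>s t x y. s \<in> {0..T} \<Longrightarrow> t \<in> {0..T} \<Longrightarrow>
           \<bar>u t x - u s y\<bar> \<le> cH * (\<bar>x - y\<bar> + \<bar>t - s\<bar> powr (1 / \<alpha>))"
    and "mollifier \<zeta>"
  shows "\<forall>t\<in>{0..T}. \<forall>x. \<bar>u t x - u\<Delta> t x\<bar> \<le>
    (let m\<xi> = Etilde K W (\<lambda>z. \<bar>z\<bar>); m\<zeta> = M_zeta \<zeta>; I = I_Delta \<alpha> K \<beta>1 \<beta>2 \<Delta>;
         C\<^sub>0 = max (L_0 c\<phi> cH mX m\<xi> m\<zeta> T M C) (U_0 c\<phi> I mX m\<xi> m\<zeta> T M C)
     in C\<^sub>0 * \<Delta> powr rate \<alpha> q)"
proof -
  \<comment> \<open>The upper end \<open>lam2\<close> serves as \<Lambda>; positivity of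
    \<open>K\<close> comes from \<open>0 \<le> lam1\<close> and the open interval.\<close>
  interpret stable_scheme \<alpha> lam2 q C K W \<beta>1 \<beta>2
    by unfold_locales (use assms in auto)
  have sub: "viscosity_subsolution \<alpha> K T \<phi> u" and super: "viscosity_supersolution \<alpha> K T \<phi> u"
    using assms(22) by (auto simp: viscosity_solution_def)
  have hu: "hoelder T cH u" using assms(25) unfolding hoelder_def by blast
  have u0: "u 0 x = \<phi> x" for x
    using sub super unfolding viscosity_subsolution_def viscosity_supersolution_def by (meson order_antisym)
  obtain B where "\<forall>y\<in>range \<phi>. norm y \<le> B" using assms(16) unfolding bounded_iff by blast
  then have B: "\<bar>\<phi> x\<bar> \<le> B" for x by simp
  have lphi: "lip c\<phi> \<phi>" using assms(17) by (simp add: lip_def lipschitz_on_def dist_real_def)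
  \<comment> \<open>The accuracy itself is the parameter of both estimates; the entries 1/4 and q/2
    of the minimum are the two inequalities for \<open>e ^ 4\<close> and
    \<open>e\<^sup>2\<close>.\<close>
  define e where "e = \<Delta> powr rate \<alpha> q"
  have r: "rate \<alpha> q \<le> 1 / 4" "rate \<alpha> q \<le> q / 2" "0 \<le> rate \<alpha> q"
    unfolding rate_def using alpha q by auto
  have e0: "0 < e" using assms(19) by (simp add: e_def)
  have e1: "e \<le> 1" using powr_le1[of "rate \<alpha> q" \<Delta>] r assms(19,20) by (simp add: e_def)
  have e4: "\<Delta> \<le> e ^ 4"
  proof -
    have "\<Delta> powr 1 \<le> \<Delta> powr (4 * rate \<alpha> q)" using r assms(19,20) by (intro powr_mono') auto
    also have "\<dots> = e ^ 4" using assms(19) by (simp add: e_def powr_power mult.commute)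
    finally show ?thesis using assms(19) by simp
  qed
  have e2: "\<Delta> powr q \<le> e\<^sup>2"
  proof -
    have "\<Delta> powr q \<le> \<Delta> powr (2 * rate \<alpha> q)" using r assms(19,20) by (intro powr_mono') auto
    also have "\<dots> = e\<^sup>2" using assms(19) by (simp add: e_def powr_power mult.commute)
    finally show ?thesis .
  qed
  define m\<xi> where "m\<xi> = Etilde K W (\<lambda>z. \<bar>z\<bar>)"
  define L0 where "L0 = L_0 c\<phi> cH mX m\<xi> (M_zeta \<zeta>) T M C"
  define U0 where "U0 = U_0 c\<phi> (ID \<Delta>) mX m\<xi> (M_zeta \<zeta>) T M C"
  note cst = berry_esseen_constants[OF lip_nonneg[OF lphi] hoelder_nonneg[OF hu assms(18)] Ehat_nonneg[OF assms(24)] _ assms(18,10,14)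
      I_Delta_nonneg[OF assms(19,20)] M_zeta_ge[OF assms(26)], of m\<xi>, folded L0_def U0_def]
  have "\<bar>u t x - u\<Delta> t x\<bar> \<le> max L0 U0 * e" if t: "t \<in> {0..T}" for t x
  proof -
    have t': "0 \<le> t" "t \<le> T" using t by auto
    have w: "u\<Delta> t = walk \<Delta> \<phi> t" by (rule discrete_scheme_walk[OF assms(23,19) t'])
    have "u t x - u\<Delta> t x \<le> U0 * e"
      unfolding w
      by (rule order_trans[OF upper_bound[OF assms(18) hoelder_continuous[OF hu assms(18)] sub assms(19,20) lphi B e0 e1 e4 e2 t']])
         (use cst(1) e0 Etilde_abs_nonneg in \<open>auto simp: m\<xi>_def\<close>)
    also have "\<dots> \<le> max L0 U0 * e" using e0 by (intro mult_right_mono) auto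
    finally have 1: "u t x - u\<Delta> t x \<le> max L0 U0 * e" .
    \<comment> \<open>In this direction \<phi> contributes through the scheme and the Hoelder
      constant through the averages of \<open>u\<close>, so half of each constant is spent.\<close>
    have "u\<Delta> t x - u t x \<le> (L0 + U0) / 2 * e"
      unfolding w
      by (rule order_trans[OF lower_bound[OF assms(18) super hu assms(19,20) lphi u0 e0 e1 e4 e2 t']])
         (use cst(2) e0 Etilde_abs_nonneg in \<open>auto simp: m\<xi>_def\<close>)
    also have "\<dots> \<le> max L0 U0 * e" using e0 by (intro mult_right_mono) auto
    finally show ?thesis using 1 by (simp add: abs_le_iff)
  qed
  then show ?thesis unfolding Let_def m\<xi>_def[symmetric] L0_def[symmetric] U0_def[symmetric] e_def by blast
qed

end
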